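(* Let $0<\alpha<1$. There exist a nonzero function $f\in \mathrm{dom}\,U_\alpha$, a set $V\subset\mathbb{R}$ of positive length and a positive number $r$ such that $f$ and $U_\alpha f$ are identically zero on $V$ and $f$ satisfies H\"older's condition with exponent $r$ on $\mathbb{R}$.
   Context: For $0<\alpha<1$, $\mathrm{dom}\,U_\alpha$ denotes the set of all locally summable functions $f:\mathbb{R}\to\mathbb{C}$ with $\int_{\mathbb{R}}\frac{|f(x)|\,dx}{1+|x|^{1-\alpha}}<+\infty$. For $f\in \mathrm{dom}\,U_\alpha$ the M. Rietz potential is $(U_\alpha f)(t):=\int_{\mathbb{R}}\frac{f(x)\,dx}{|t-x|^{1-\alpha}}$, $t\in\mathbb{R}$ (defined almost everywhere). Length means Lebesgue measure on $\mathbb{R}$. Functions are complex-valued. *)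

theory Defs
  imports "HOL-Analysis.Analysis"
begin

definition dom_U :: "real \<Rightarrow> (real \<Rightarrow> complex) set" where
  "dom_U \<alpha> = {f. (\<forall>K. compact K \<longrightarrow> f absolutely_integrable_on K) \<and>
     integrable lebesgue (\<lambda>x. norm (f x) / (1 + \<bar>x\<bar> powr (1 - \<alpha>)))}"

text \<open>At \<open>x = t\<close> the kernel below takes the value \<open>0\<close> (division by zero), which does
  not affect the integral. Where the integrand is not integrable, \<open>riesz_potential\<close> has the
  default value \<open>0\<close>; the predicate \<open>riesz_potential_defined\<close> excludes such points.\<close>

definition riesz_integrand :: "real \<Rightarrow> (real \<Rightarrow> complex) \<Rightarrow> real \<Rightarrow> real \<Rightarrow> complex" where
  "riesz_integrand \<alpha> f t x = f x / complex_of_real (\<bar>t - x\<bar> powr (1 - \<alpha>))"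

definition riesz_potential_defined :: "real \<Rightarrow> (real \<Rightarrow> complex) \<Rightarrow> real \<Rightarrow> bool" where
  "riesz_potential_defined \<alpha> f t \<longleftrightarrow> integrable lebesgue (riesz_integrand \<alpha> f t)"

definition riesz_potential :: "real \<Rightarrow> (real \<Rightarrow> complex) \<Rightarrow> real \<Rightarrow> complex" where
  "riesz_potential \<alpha> f t = integral\<^sup>L lebesgue (riesz_integrand \<alpha> f t)"

definition holder_condition :: "real \<Rightarrow> (real \<Rightarrow> complex) \<Rightarrow> bool" where
  "holder_condition r f \<longleftrightarrow> (\<exists>C. \<forall>x y. norm (f x - f y) \<le> C * \<bar>x - y\<bar> powr r)"

end

theory Submission
  imports Defs "HOL-Real_Asymp.Real_Asymp"
begin

text \<open>
  The function is a limit of finite sums of translated and dilated copies of one real bump, the atom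
  of width \<open>w\<close>: the second difference of step \<open>w\<close> of the function \<open>|x|^(1-\<alpha>)\<close>, with the sign and the
  factor that make it tend to \<open>K x = |x|^(-(1+\<alpha>))\<close> as \<open>w\<close> tends to 0. The Riesz potential of an atom
  vanishes identically outside \<open>(-w, w)\<close>: the potential of \<open>|x|^(1-\<alpha>)\<close>, regularised at infinity by
  subtracting a constant, is by dilation invariance a multiple of \<open>|t|\<close>, and the second difference of
  \<open>|t|\<close> is zero there (\<open>atom_potential_vanishes\<close>). So any sum of atoms has zero potential outside
  the union of the intervals of half-width \<open>w\<close> about their centres, and what remains is to make such a sum
  vanish on a large set while these intervals stay small. This is done by reducing an integral of
  \<open>|f|^p\<close>, for a small exponent \<open>p\<close>, step by step to zero.

  One gain. There is a finite combination \<open>\<psi>\<close> of atoms centred in \<open>[0, 1]\<close>, with coefficients that do not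
  depend on the width, such that the integral over the line of \<open>|1_[0,1) + \<psi>|^p\<close> is at most some \<open>q < 1\<close>
  for all small widths (\<open>exists_profile\<close>). Cut \<open>[0, 1)\<close> into many cells and put a negative charge, a multiple
  of \<open>K\<close>, at the centre of each. After rescaling, a cell sees \<open>1 - |y|^(-(1+\<alpha>))\<close>, and the point is that
  the integral of \<open>ln |1 - |y|^(-s)|\<close> over long intervals is bounded by a negative constant for \<open>1 < s < 2\<close>: for \<open>s = 2\<close> there is
  an elementary primitive and the integral over the whole line is 0, while smaller \<open>s\<close> only makes the absolute value smaller.
  A negative integral of the logarithm means that some small power has mean value less than 1
  (\<open>exists_exponent_integral_less\<close>). The tails of the charges are not \<open>p\<close>-integrable for small \<open>p\<close>;
  finitely many further atoms cancel sufficiently many moments (\<open>atom_interpolation_error\<close>).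

  Iteration. Let \<open>f\<close> be the function reached so far. On each interval of length \<open>D^(-n)\<close> that is
  still alive, pick a sample point \<open>y\<close> at which a sum of \<open>|f|^p\<close> and the local oscillation of \<open>f\<close> is at most
  average, and add \<open>f y\<close> times the copy of \<open>\<psi>\<close> scaled to the interval. There \<open>f\<close> is nearly \<open>f y\<close>, so the integral of
  \<open>|f|^p\<close> is multiplied by \<open>q\<close> up to oscillation terms, which are negligible once \<open>D\<close> is large
  (\<open>correction_step\<close>, \<open>osc_corrected_le\<close>). Intervals with too large a sample are abandoned; the thresholds
  decrease geometrically, yet so slowly that the abandoned measure is a small geometric series
  (\<open>iterated_correction\<close>). Thus the coefficients decay geometrically, and the widths can decrease geometrically at a slower
  rate, so that the corrections still decay geometrically in supremum norm while the excluded
  intervals around the centres have small total length.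

  Limit. The integral of \<open>|f|^p\<close> over the set that stays alive is zero, so the limit \<open>f\<close> vanishes almost
  everywhere on it; outside the excluded intervals its potential is the limit of potentials that are all zero. The corrections
  have geometrically small supremum norm and at most geometrically growing Hoelder constants, which gives
  a Hoelder exponent for their sum (\<open>holder_suminf\<close>). Finally \<open>f\<close> is not zero: the
  initial atom decays like \<open>|x|^(-(1+\<alpha>))\<close>, all corrections together like \<open>x^(-2)\<close>.
\<close>

section \<open>Inequalities for fractional powers\<close>

lemma powr_subadditive:
  fixes x y b :: real
  assumes "0 \<le> x" "0 \<le> y" "0 < b" "b \<le> 1"
  shows "(x + y) powr b \<le> x powr b + y powr b"
proof (cases "x + y = 0")
  case False
  then have pos: "x + y > 0" using assms by auto
  have *: "u \<le> u powr b" if "0 \<le> u" "u \<le> 1" for u :: real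
  proof (cases "u = 0")
    case False
    then have "u powr 1 \<le> u powr b" using that assms by (intro powr_mono') auto
    then show ?thesis using that False by simp
  qed simp
  have "1 = x / (x + y) + y / (x + y)" using pos by (simp add: add_divide_distrib[symmetric])
  also have "\<dots> \<le> (x / (x + y)) powr b + (y / (x + y)) powr b"
    using assms pos by (intro add_mono *) auto
  also have "\<dots> = (x powr b + y powr b) / (x + y) powr b"
    using assms pos by (simp add: powr_divide add_divide_distrib)
  finally show ?thesis using pos by (simp add: field_simps)
qed (use assms in auto)

lemma abs_add_powr_le:
  fixes x y p :: real
  assumes "0 < p" "p \<le> 1"
  shows "\<bar>x + y\<bar> powr p \<le> \<bar>x\<bar> powr p + \<bar>y\<bar> powr p"
proof -
  have "\<bar>x + y\<bar> powr p \<le> (\<bar>x\<bar> + \<bar>y\<bar>) powr p" using assms by (intro powr_mono2) auto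
  also have "\<dots> \<le> \<bar>x\<bar> powr p + \<bar>y\<bar> powr p" using assms by (intro powr_subadditive) auto
  finally show ?thesis .
qed

lemma abs_sum_powr_le:
  fixes g :: "'i \<Rightarrow> real"
  assumes "0 < p" "p \<le> 1"
  shows "\<bar>\<Sum>i\<in>I. g i\<bar> powr p \<le> (\<Sum>i\<in>I. \<bar>g i\<bar> powr p)"
proof (induction I rule: infinite_finite_induct)
  case (insert x F)
  then show ?case using abs_add_powr_le[OF assms, of "g x" "sum g F"] by simp
qed auto

text \<open>Subadditivity of the power, applied to \<open>x = (x - y) + y\<close>. All Hoelder estimates for atoms rest on this.\<close>

lemma abs_powr_diff_le:
  fixes x y b :: real
  assumes "0 < b" "b \<le> 1"
  shows "\<bar>\<bar>x\<bar> powr b - \<bar>y\<bar> powr b\<bar> \<le> \<bar>x - y\<bar> powr b"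
proof -
  have "\<bar>y - x\<bar> = \<bar>x - y\<bar>" by (rule abs_minus_commute)
  then show ?thesis
    using abs_add_powr_le[OF assms, of "x - y" y] abs_add_powr_le[OF assms, of "y - x" x]
    unfolding abs_le_iff by simp
qed

lemma divide_powr_minus:
  fixes x c e :: real
  assumes "0 \<le> x" "0 < c"
  shows "(x / c) powr - e = c powr e * x powr - e"
  using assms by (simp add: powr_divide powr_minus_divide)

lemma has_real_derivative_abs_powr:
  fixes z b :: real
  assumes "z \<noteq> 0"
  shows "((\<lambda>x. \<bar>x\<bar> powr b) has_real_derivative b * (sgn z * \<bar>z\<bar> powr (b - 1))) (at z)"
proof (cases "z > 0")
  case True
  have "((\<lambda>x. x powr b) has_real_derivative b * z powr (b - 1)) (at z)"
    using True by (auto intro!: derivative_eq_intros simp: powr_diff)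
  then have "((\<lambda>x. \<bar>x\<bar> powr b) has_real_derivative b * z powr (b - 1)) (at z)"
    by (rule has_field_derivative_transform_within_open[of _ _ _ "{0<..}"]) (use True in auto)
  then show ?thesis using True by simp
next
  case False
  then have z: "z < 0" using assms by auto
  have "((\<lambda>x. (- x) powr b) has_real_derivative - (b * (- z) powr (b - 1))) (at z)"
    using z by (auto intro!: derivative_eq_intros simp: powr_diff)
  then have "((\<lambda>x. \<bar>x\<bar> powr b) has_real_derivative - (b * (- z) powr (b - 1))) (at z)"
    by (rule has_field_derivative_transform_within_open[of _ _ _ "{..<0}"]) (use z in auto)
  then show ?thesis using z by simp
qed

lemma has_real_derivative_sgn_abs_powr:
  fixes z b :: real
  assumes "z \<noteq> 0"
  shows "((\<lambda>x. sgn x * \<bar>x\<bar> powr b) has_real_derivative b * \<bar>z\<bar> powr (b - 1)) (at z)"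
proof (cases "z > 0")
  case True
  have "((\<lambda>x. \<bar>x\<bar> powr b) has_real_derivative b * \<bar>z\<bar> powr (b - 1)) (at z)"
    using has_real_derivative_abs_powr[of z b] True by simp
  then show ?thesis
    by (rule has_field_derivative_transform_within_open[of _ _ _ "{0<..}"]) (use True in auto)
next
  case False
  then have z: "z < 0" using assms by auto
  have "((\<lambda>x. - (\<bar>x\<bar> powr b)) has_real_derivative b * \<bar>z\<bar> powr (b - 1)) (at z)"
    using DERIV_minus[OF has_real_derivative_abs_powr[of z b]] z by simp
  then show ?thesis
    by (rule has_field_derivative_transform_within_open[of _ _ _ "{..<0}"]) (use z in auto)
qed

text \<open>Two applications of the mean value theorem, the first of them to \<open>t \<mapsto> g t - g (t - w)\<close>.\<close>

lemma second_difference_mvt: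
  fixes g g' g'' :: "real \<Rightarrow> real"
  assumes w: "w > 0"
    and d1: "\<And>v. \<bar>v\<bar> \<le> w \<Longrightarrow> (g has_real_derivative g' v) (at v)"
    and d2: "\<And>v. \<bar>v\<bar> \<le> w \<Longrightarrow> (g' has_real_derivative g'' v) (at v)"
  shows "\<exists>\<xi>. \<bar>\<xi>\<bar> < w \<and> g w + g (- w) - 2 * g 0 = w\<^sup>2 * g'' \<xi>"
proof -
  have "\<exists>z. 0 < z \<and> z < w \<and> (\<lambda>t. g t - g (t - w)) w - (\<lambda>t. g t - g (t - w)) 0
      = (w - 0) * (g' z - g' (z - w))"
  proof (rule MVT2)
    show "0 < w" by (rule w)
    fix x assume x: "0 \<le> x" "x \<le> w"
    have "((\<lambda>t. g (t - w)) has_real_derivative g' (x - w)) (at x)"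
      using d1[of "x - w"] x DERIV_shift[of g "g' (x - w)" x "- w"] by simp
    then show "((\<lambda>t. g t - g (t - w)) has_real_derivative g' x - g' (x - w)) (at x)"
      using d1[of x] x by (auto intro!: derivative_eq_intros)
  qed
  then obtain z where z: "0 < z" "z < w" "g w - g 0 - (g 0 - g (- w)) = w * (g' z - g' (z - w))"
    by auto
  have "\<exists>u. z - w < u \<and> u < z \<and> g' z - g' (z - w) = (z - (z - w)) * g'' u"
    by (rule MVT2) (use z w d2 in auto)
  then obtain u where "z - w < u" "u < z" "g' z - g' (z - w) = w * g'' u" by auto
  then show ?thesis using z by (intro exI[of _ u]) (auto simp: power2_eq_square)
qed

section \<open>Atoms\<close>

locale riesz_order =
  fixes \<alpha> :: real
  assumes \<alpha>_pos: "0 < \<alpha>" and \<alpha>_less: "\<alpha> < 1"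
begin

definition K :: "real \<Rightarrow> real" where
  "K x = \<bar>x\<bar> powr - (1 + \<alpha>)"

text \<open>The quotient is minus the second difference quotient of \<open>|x|^(1-\<alpha>)\<close>, divided by \<open>\<alpha> (1-\<alpha>)\<close>; since
  \<open>- (|x|^(1-\<alpha>))'' = \<alpha> (1-\<alpha>) |x|^(-(1+\<alpha>))\<close>, it tends to \<open>K x\<close> as \<open>w\<close> tends to 0.\<close>

definition atom :: "real \<Rightarrow> real \<Rightarrow> real" where
  "atom w x = (2 * \<bar>x\<bar> powr (1 - \<alpha>) - \<bar>x - w\<bar> powr (1 - \<alpha>) - \<bar>x + w\<bar> powr (1 - \<alpha>))
     / (\<alpha> * (1 - \<alpha>) * w\<^sup>2)"

lemma normalizer_pos: "\<alpha> * (1 - \<alpha>) > 0" using \<alpha>_pos \<alpha>_less by simp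

lemma atom_minus [simp]: "atom w (- x) = atom w x"
proof -
  have "\<bar>- x - w\<bar> = \<bar>x + w\<bar>" "\<bar>- x + w\<bar> = \<bar>x - w\<bar>" by auto
  then show ?thesis unfolding atom_def by (simp only: abs_minus_cancel) (simp add: algebra_simps)
qed

lemma K_nonneg: "K x \<ge> 0" by (simp add: K_def)

lemma K_diff_le:
  assumes r: "r > 0" and u: "\<bar>u\<bar> \<ge> r" and v: "\<bar>v\<bar> \<ge> r"
  shows "\<bar>K u - K v\<bar> \<le> 2 * r powr - (2 + \<alpha>) * \<bar>u - v\<bar>"
proof -
  have main: "x powr - (1 + \<alpha>) - y powr - (1 + \<alpha>) \<le> 2 * r powr - (2 + \<alpha>) * (y - x)"
    if "r \<le> x" "x < y" for x y
  proof -
    have "\<exists>z. x < z \<and> z < y \<and> y powr - (1 + \<alpha>) - x powr - (1 + \<alpha>)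
       = (y - x) * ((- (1 + \<alpha>)) * z powr (- (1 + \<alpha>) - 1))"
    proof (rule MVT2)
      fix v assume "x \<le> v" "v \<le> y"
      then show "((\<lambda>v. v powr - (1 + \<alpha>)) has_real_derivative - (1 + \<alpha>) * v powr (- (1 + \<alpha>) - 1)) (at v)"
        using that r by (intro has_real_derivative_powr) auto
    qed (use that in auto)
    then obtain z where z: "x < z" "z < y" "x powr - (1 + \<alpha>) - y powr - (1 + \<alpha>)
       = (y - x) * ((1 + \<alpha>) * z powr - (2 + \<alpha>))" by (auto simp: algebra_simps)
    have "z powr - (2 + \<alpha>) \<le> r powr - (2 + \<alpha>)"
      using z that r \<alpha>_pos by (intro powr_mono2') auto
    then have "(1 + \<alpha>) * z powr - (2 + \<alpha>) \<le> 2 * r powr - (2 + \<alpha>)"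
      using \<alpha>_pos \<alpha>_less by (intro mult_mono) auto
    then have "(y - x) * ((1 + \<alpha>) * z powr - (2 + \<alpha>)) \<le> (y - x) * (2 * r powr - (2 + \<alpha>))"
      using that by (intro mult_left_mono) auto
    then show ?thesis using z by (simp add: algebra_simps)
  qed
  have mono: "y powr - (1 + \<alpha>) \<le> x powr - (1 + \<alpha>)" if "r \<le> x" "x < y" for x y
    using that r \<alpha>_pos by (intro powr_mono2') auto
  have "\<bar>K u - K v\<bar> \<le> 2 * r powr - (2 + \<alpha>) * \<bar>\<bar>u\<bar> - \<bar>v\<bar>\<bar>"
  proof (cases "\<bar>u\<bar>" "\<bar>v\<bar>" rule: linorder_cases)
    case less
    have "\<bar>K u - K v\<bar> = K u - K v" "\<bar>\<bar>u\<bar> - \<bar>v\<bar>\<bar> = \<bar>v\<bar> - \<bar>u\<bar>"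
      using mono[OF u less] less by (simp_all add: K_def)
    then show ?thesis using main[OF u less] unfolding K_def by metis
  next
    case greater
    have "\<bar>K u - K v\<bar> = K v - K u" "\<bar>\<bar>u\<bar> - \<bar>v\<bar>\<bar> = \<bar>u\<bar> - \<bar>v\<bar>"
      using mono[OF v greater] greater by (simp_all add: K_def)
    then show ?thesis using main[OF v greater] unfolding K_def by metis
  qed (simp add: K_def)
  also have "\<dots> \<le> 2 * r powr - (2 + \<alpha>) * \<bar>u - v\<bar>"
    by (intro mult_left_mono) auto
  finally show ?thesis .
qed

text \<open>A combination of atoms is a single second difference, so at distance more than \<open>w\<close> from all
  centres it equals the same combination of the kernel \<open>K\<close>, with one and the same shift in all terms. The common
  shift is what lets cancellation between the terms pass from \<open>K\<close> to atoms.\<close>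

lemma atom_combination_mvt:
  assumes w: "w > 0" and sep: "\<And>j. j \<in> J \<Longrightarrow> \<bar>x - y j\<bar> > w"
  shows "\<exists>\<xi>. \<bar>\<xi>\<bar> < w \<and> (\<Sum>j\<in>J. l j * atom w (x - y j)) = (\<Sum>j\<in>J. l j * K (x - y j + \<xi>))"
proof -
  define b where "b = 1 - \<alpha>"
  define c where "c = \<alpha> * (1 - \<alpha>)"
  have c: "c > 0" using normalizer_pos by (simp add: c_def)
  define g where "g v = (\<Sum>j\<in>J. - l j * \<bar>x - y j + v\<bar> powr b)" for v
  define g' where "g' v = (\<Sum>j\<in>J. - l j * (b * (sgn (x - y j + v) * \<bar>x - y j + v\<bar> powr (b - 1))))" for v
  define g'' where "g'' v = (\<Sum>j\<in>J. - l j * (b * ((b - 1) * \<bar>x - y j + v\<bar> powr (b - 1 - 1))))" for v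
  have nz: "x - y j + v \<noteq> 0" if "\<bar>v\<bar> \<le> w" "j \<in> J" for v j
    using sep[OF that(2)] that(1) by auto
  have d1: "(g has_real_derivative g' v) (at v)" if "\<bar>v\<bar> \<le> w" for v
    unfolding g_def g'_def
  proof (intro DERIV_sum DERIV_cmult)
    fix j assume "j \<in> J"
    then show "((\<lambda>v. \<bar>x - y j + v\<bar> powr b) has_real_derivative
        b * (sgn (x - y j + v) * \<bar>x - y j + v\<bar> powr (b - 1))) (at v)"
      using DERIV_shift[of "\<lambda>x. \<bar>x\<bar> powr b" _ v "x - y j"]
        has_real_derivative_abs_powr[OF nz[OF that], of j b] by (simp add: add.commute)
  qed
  have d2: "(g' has_real_derivative g'' v) (at v)" if "\<bar>v\<bar> \<le> w" for v
    unfolding g'_def g''_def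
  proof (intro DERIV_sum DERIV_cmult)
    fix j assume "j \<in> J"
    then show "((\<lambda>v. sgn (x - y j + v) * \<bar>x - y j + v\<bar> powr (b - 1)) has_real_derivative
        (b - 1) * \<bar>x - y j + v\<bar> powr (b - 1 - 1)) (at v)"
      using DERIV_shift[of "\<lambda>x. sgn x * \<bar>x\<bar> powr (b - 1)" _ v "x - y j"]
        has_real_derivative_sgn_abs_powr[OF nz[OF that], of j "b - 1"] by (simp add: add.commute)
  qed
  obtain \<xi> where \<xi>: "\<bar>\<xi>\<bar> < w" "g w + g (- w) - 2 * g 0 = w\<^sup>2 * g'' \<xi>"
    using second_difference_mvt[OF w d1 d2] by blast
  have "(\<Sum>j\<in>J. l j * atom w (x - y j)) = (g w + g (- w) - 2 * g 0) / (c * w\<^sup>2)"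
    unfolding g_def atom_def c_def[symmetric] unfolding b_def[symmetric] sum_distrib_left sum_divide_distrib
      sum_subtractf[symmetric] sum.distrib[symmetric]
    by (rule sum.cong) (auto simp: add_divide_distrib diff_divide_distrib algebra_simps)
  also have "\<dots> = g'' \<xi> / c" using \<xi>(2) w by simp
  also have "\<dots> = (\<Sum>j\<in>J. l j * K (x - y j + \<xi>))"
    unfolding g''_def K_def sum_divide_distrib
  proof (rule sum.cong)
    fix j assume "j \<in> J"
    have e: "b - 1 - 1 = - (1 + \<alpha>)" and f: "- (b * (b - 1)) = c" by (auto simp: b_def c_def algebra_simps)
    have "- l j * (b * ((b - 1) * \<bar>x - y j + \<xi>\<bar> powr (b - 1 - 1)))
      = c * (l j * \<bar>x - y j + \<xi>\<bar> powr (- (1 + \<alpha>)))"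
      unfolding f[symmetric] e by simp
    then show "- l j * (b * ((b - 1) * \<bar>x - y j + \<xi>\<bar> powr (b - 1 - 1))) / c
        = l j * \<bar>x - y j + \<xi>\<bar> powr - (1 + \<alpha>)" using c by simp
  qed simp
  finally show ?thesis using \<xi>(1) by blast
qed

lemma atom_mvt:
  assumes "w > 0" "\<bar>x\<bar> > w"
  shows "\<exists>\<xi>. \<bar>\<xi>\<bar> < w \<and> atom w x = K (x + \<xi>)"
  using atom_combination_mvt[of w "{()}" x "\<lambda>_. 0" "\<lambda>_. 1"] assms by simp

text \<open>The constant that comes out of estimating the four terms of the numerator of an atom one by one.\<close>

definition atom_const where "atom_const = 4 / (\<alpha> * (1 - \<alpha>))"

lemma atom_const_pos: "atom_const > 0" using normalizer_pos by (simp add: atom_const_def)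

lemma atom_const_ge: "atom_const \<ge> 4"
proof -
  have "\<alpha> * (1 - \<alpha>) \<le> 1" using \<alpha>_pos \<alpha>_less by (intro mult_le_one) auto
  then show ?thesis unfolding atom_const_def using normalizer_pos by (simp add: field_simps)
qed

lemma atom_holder:
  assumes w: "w > 0"
  shows "\<bar>atom w x - atom w y\<bar> \<le> atom_const * w powr -2 * \<bar>x - y\<bar> powr (1 - \<alpha>)"
proof -
  have d: "\<bar>\<bar>u\<bar> powr (1 - \<alpha>) - \<bar>v\<bar> powr (1 - \<alpha>)\<bar> \<le> e powr (1 - \<alpha>)" if "\<bar>u - v\<bar> = e" for u v e
    unfolding that[symmetric] by (rule abs_powr_diff_le) (use \<alpha>_pos \<alpha>_less in auto)
  have pos: "\<alpha> * (1 - \<alpha>) * w\<^sup>2 > 0" using normalizer_pos w by simp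
  have "\<bar>atom w x - atom w y\<bar> = \<bar>2 * (\<bar>x\<bar> powr (1 - \<alpha>) - \<bar>y\<bar> powr (1 - \<alpha>))
     - (\<bar>x - w\<bar> powr (1 - \<alpha>) - \<bar>y - w\<bar> powr (1 - \<alpha>))
     - (\<bar>x + w\<bar> powr (1 - \<alpha>) - \<bar>y + w\<bar> powr (1 - \<alpha>))\<bar> / (\<alpha> * (1 - \<alpha>) * w\<^sup>2)"
    unfolding atom_def diff_divide_distrib[symmetric] abs_divide abs_of_pos[OF pos]
    by (simp add: algebra_simps)
  also have "\<dots> \<le> (4 * \<bar>x - y\<bar> powr (1 - \<alpha>)) / (\<alpha> * (1 - \<alpha>) * w\<^sup>2)"
  proof (rule divide_right_mono[OF _ less_imp_le[OF pos]])
    have tri: "\<bar>2 * p - q - r\<bar> \<le> 4 * e" if "\<bar>p\<bar> \<le> e" "\<bar>q\<bar> \<le> e" "\<bar>r\<bar> \<le> e" for p q r e :: real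
      using that by linarith
    show "\<bar>2 * (\<bar>x\<bar> powr (1 - \<alpha>) - \<bar>y\<bar> powr (1 - \<alpha>))
     - (\<bar>x - w\<bar> powr (1 - \<alpha>) - \<bar>y - w\<bar> powr (1 - \<alpha>))
     - (\<bar>x + w\<bar> powr (1 - \<alpha>) - \<bar>y + w\<bar> powr (1 - \<alpha>))\<bar> \<le> 4 * \<bar>x - y\<bar> powr (1 - \<alpha>)"
      by (rule tri[OF d d d]) simp_all
  qed
  also have "\<dots> = atom_const * w powr -2 * \<bar>x - y\<bar> powr (1 - \<alpha>)"
    unfolding atom_const_def powr_minus using w by (simp add: divide_simps powr_numeral)
  finally show ?thesis .
qed

lemma atom_le_width:
  assumes w: "w > 0"
  shows "\<bar>atom w x\<bar> \<le> atom_const * w powr - (1 + \<alpha>)"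
proof -
  have d: "\<bar>\<bar>u\<bar> powr (1 - \<alpha>) - \<bar>v\<bar> powr (1 - \<alpha>)\<bar> \<le> e powr (1 - \<alpha>)" if "\<bar>u - v\<bar> = e" for u v e
    unfolding that[symmetric] by (rule abs_powr_diff_le) (use \<alpha>_pos \<alpha>_less in auto)
  have pos: "\<alpha> * (1 - \<alpha>) * w\<^sup>2 > 0" using normalizer_pos w by simp
  have "\<bar>atom w x\<bar> = \<bar>(\<bar>x\<bar> powr (1 - \<alpha>) - \<bar>x - w\<bar> powr (1 - \<alpha>))
     + (\<bar>x\<bar> powr (1 - \<alpha>) - \<bar>x + w\<bar> powr (1 - \<alpha>))\<bar> / (\<alpha> * (1 - \<alpha>) * w\<^sup>2)"
    unfolding atom_def abs_divide abs_of_pos[OF pos] by (simp add: algebra_simps)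
  also have "\<dots> \<le> (4 * w powr (1 - \<alpha>)) / (\<alpha> * (1 - \<alpha>) * w\<^sup>2)"
  proof (rule divide_right_mono[OF _ less_imp_le[OF pos]])
    have tri: "\<bar>p + q\<bar> \<le> 4 * e" if "\<bar>p\<bar> \<le> e" "\<bar>q\<bar> \<le> e" for p q e :: real
      using that by linarith
    show "\<bar>(\<bar>x\<bar> powr (1 - \<alpha>) - \<bar>x - w\<bar> powr (1 - \<alpha>))
     + (\<bar>x\<bar> powr (1 - \<alpha>) - \<bar>x + w\<bar> powr (1 - \<alpha>))\<bar> \<le> 4 * w powr (1 - \<alpha>)"
      by (rule tri[OF d d]) (use w in simp_all)
  qed
  also have "\<dots> = atom_const * (w powr (1 - \<alpha>) * w powr -2)"
    unfolding atom_const_def powr_minus using w by (simp add: divide_simps powr_numeral)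
  also have "w powr (1 - \<alpha>) * w powr -2 = w powr - (1 + \<alpha>)"
    using w by (simp add: powr_add[symmetric])
  finally show ?thesis .
qed

text \<open>Close to the centre the bound by the width is used, further out the mean value form.\<close>

lemma atom_le:
  assumes w: "w > 0" and x: "x \<noteq> 0"
  shows "\<bar>atom w x\<bar> \<le> 4 * atom_const * K x"
proof (cases "\<bar>x\<bar> > 2 * w")
  case True
  then obtain \<xi> where \<xi>: "\<bar>\<xi>\<bar> < w" "atom w x = K (x + \<xi>)" using atom_mvt[of w x] w by auto
  have "\<bar>x\<bar> / 2 \<le> \<bar>x + \<xi>\<bar>" using \<xi>(1) True abs_triangle_ineq4[of "x + \<xi>" \<xi>] by simp
  then have "K (x + \<xi>) \<le> (\<bar>x\<bar> / 2) powr - (1 + \<alpha>)"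
    unfolding K_def using True w \<alpha>_pos by (intro powr_mono2') auto
  also have "\<dots> = 2 powr (1 + \<alpha>) * K x"
    unfolding K_def by (rule divide_powr_minus) auto
  also have "\<dots> \<le> 2 powr 2 * K x"
    using \<alpha>_less by (intro mult_right_mono K_nonneg powr_mono) auto
  also have "\<dots> \<le> (4 * atom_const) * K x"
    using atom_const_ge by (intro mult_right_mono K_nonneg) auto
  finally show ?thesis using \<xi> K_nonneg[of "x + \<xi>"] by simp
next
  case False
  have "\<bar>atom w x\<bar> \<le> atom_const * w powr - (1 + \<alpha>)" by (rule atom_le_width[OF w])
  also have "\<dots> \<le> atom_const * (\<bar>x\<bar> / 2) powr - (1 + \<alpha>)"
    using False x w atom_const_pos \<alpha>_pos by (intro mult_left_mono powr_mono2') auto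
  also have "(\<bar>x\<bar> / 2) powr - (1 + \<alpha>) = 2 powr (1 + \<alpha>) * K x"
    unfolding K_def by (rule divide_powr_minus) auto
  also have "atom_const * (2 powr (1 + \<alpha>) * K x) \<le> atom_const * (2 powr 2 * K x)"
    using \<alpha>_less atom_const_pos by (intro mult_left_mono mult_right_mono K_nonneg powr_mono) auto
  finally show ?thesis by simp
qed

text \<open>One rewrites \<open>|x|^(-(1+\<alpha>))\<close> as \<open>|x|^(1-\<alpha>) |x|^(-2)\<close>. The error
  estimates for atoms are stated with inverse squares of the distance to the centre: their \<open>p\<close>-th powers are integrable near
  the centre for \<open>p \<le> 1/4\<close>, and a positive power of the small parameter is left over.\<close>

lemma K_le_shift:
  assumes "w > 0" "\<bar>x\<bar> \<le> 2 * w" "x \<noteq> 0"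
  shows "K x \<le> 2 * (w powr (1 - \<alpha>) * \<bar>x\<bar> powr -2)"
proof -
  have "K x = \<bar>x\<bar> powr (1 - \<alpha>) * \<bar>x\<bar> powr -2"
    unfolding K_def using assms by (simp add: powr_add[symmetric])
  also have "\<dots> \<le> (2 * w) powr (1 - \<alpha>) * \<bar>x\<bar> powr -2"
    using assms \<alpha>_less by (intro mult_right_mono powr_mono2) auto
  also have "(2 * w) powr (1 - \<alpha>) \<le> 2 * w powr (1 - \<alpha>)"
    using assms \<alpha>_pos powr_mono[of "1 - \<alpha>" 1 "2::real"] by (auto simp: powr_mult intro!: mult_right_mono)
  finally show ?thesis by (simp add: mult_right_mono mult.assoc)
qed

text \<open>The factor \<open>w^(1-\<alpha>)\<close> makes the replacement of \<open>K\<close> by atoms harmless in the \<open>p\<close>-th power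
  integrals once the width is small.\<close>

lemma atom_minus_K_le:
  assumes w: "w > 0" and x: "x \<noteq> 0"
  shows "\<bar>atom w x - K x\<bar> \<le> 10 * atom_const * w powr (1 - \<alpha>) * \<bar>x\<bar> powr -2"
proof (cases "\<bar>x\<bar> > 2 * w")
  case True
  then obtain \<xi> where \<xi>: "\<bar>\<xi>\<bar> < w" "atom w x = K (x + \<xi>)" using atom_mvt[of w x] w by auto
  have "\<bar>x\<bar> / 2 \<le> \<bar>x + \<xi>\<bar>" using \<xi>(1) True abs_triangle_ineq4[of "x + \<xi>" \<xi>] by simp
  then have "\<bar>K (x + \<xi>) - K x\<bar> \<le> 2 * (\<bar>x\<bar> / 2) powr - (2 + \<alpha>) * \<bar>x + \<xi> - x\<bar>"
    using x by (intro K_diff_le) auto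
  also have "\<dots> \<le> 2 * (\<bar>x\<bar> / 2) powr - (2 + \<alpha>) * w"
    using \<xi> by (intro mult_left_mono) auto
  also have "(\<bar>x\<bar> / 2) powr - (2 + \<alpha>) = (\<bar>x\<bar> / 2) powr - \<alpha> * (\<bar>x\<bar> / 2) powr -2"
    unfolding powr_add[symmetric] by (simp add: algebra_simps)
  also have "\<dots> \<le> w powr - \<alpha> * (\<bar>x\<bar> / 2) powr -2"
    using True w \<alpha>_pos by (intro mult_right_mono powr_mono2') auto
  also have "(\<bar>x\<bar> / 2) powr -2 = 4 * \<bar>x\<bar> powr -2"
    by (simp add: powr_minus powr_divide powr_numeral field_simps)
  also have "2 * (w powr - \<alpha> * (4 * \<bar>x\<bar> powr -2)) * w = 8 * (w powr 1 * w powr - \<alpha>) * \<bar>x\<bar> powr -2"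
    using w by simp
  also have "w powr 1 * w powr - \<alpha> = w powr (1 - \<alpha>)"
    unfolding powr_add[symmetric] by simp
  also have "8 * w powr (1 - \<alpha>) * \<bar>x\<bar> powr - 2 \<le> 10 * atom_const * w powr (1 - \<alpha>) * \<bar>x\<bar> powr -2"
    using atom_const_ge by (intro mult_right_mono) auto
  finally show ?thesis using \<xi> w by (simp add: mult_right_mono)
next
  case False
  have "\<bar>atom w x - K x\<bar> \<le> (4 * atom_const + 1) * K x"
    using atom_le[OF assms] K_nonneg[of x] by (simp add: algebra_simps)
  also have "\<dots> \<le> (5 * atom_const) * K x" using atom_const_ge by (intro mult_right_mono K_nonneg) auto
  also have "\<dots> \<le> (5 * atom_const) * (2 * (w powr (1 - \<alpha>) * \<bar>x\<bar> powr -2))"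
    using K_le_shift[of w x] False x w atom_const_pos by (intro mult_left_mono) auto
  finally show ?thesis by (simp add: mult.assoc)
qed

text \<open>The bound does not involve the width: at distances comparable to \<open>w\<close> or less the crude
  Hoelder estimate of an atom is already good enough. This is why the modulus of continuity of the profile in
  the \<open>p\<close>-th mean will be uniform in the width.\<close>

lemma atom_translate_le:
  assumes w: "w > 0" and x: "x \<noteq> 0" and xh: "x + h \<noteq> 0"
  shows "\<bar>atom w (x + h) - atom w x\<bar> \<le>
     128 * atom_const * \<bar>h\<bar> powr (1 - \<alpha>) * (\<bar>x\<bar> powr -2 + \<bar>x + h\<bar> powr -2)"
proof -
  \<comment> \<open>If \<open>h\<close> is at most half of \<open>|x|\<close>, one of the two inverse squares suffices; otherwise both
    values are estimated separately.\<close>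
  have more: "\<bar>atom w (x + h) - atom w x\<bar> \<le> 128 * atom_const * \<bar>h\<bar> powr (1 - \<alpha>) * \<bar>x\<bar> powr -2"
    if "2 * \<bar>h\<bar> \<le> \<bar>x\<bar>"
  proof (cases "\<bar>x\<bar> > 4 * w")
    case True
    have "\<exists>\<xi>. \<bar>\<xi>\<bar> < w \<and> (\<Sum>j\<in>{True, False}. (if j then 1 else -1) * atom w (x - (if j then - h else 0)))
      = (\<Sum>j\<in>{True, False}. (if j then 1 else -1) * K (x - (if j then - h else 0) + \<xi>))"
      by (rule atom_combination_mvt) (use w that True in \<open>auto split: if_splits\<close>)
    then obtain \<xi> where \<xi>: "\<bar>\<xi>\<bar> < w" "atom w (x + h) - atom w x = K (x + h + \<xi>) - K (x + \<xi>)"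
      by auto
    have "\<bar>x\<bar> \<le> \<bar>x + \<xi>\<bar> + \<bar>\<xi>\<bar>" "\<bar>x\<bar> \<le> \<bar>x + h + \<xi>\<bar> + \<bar>h\<bar> + \<bar>\<xi>\<bar>" by linarith+
    then have "\<bar>x\<bar> / 4 \<le> \<bar>x + \<xi>\<bar>" "\<bar>x\<bar> / 4 \<le> \<bar>x + h + \<xi>\<bar>" using \<xi>(1) True that abs_ge_zero[of x] by linarith+
    then have "\<bar>K (x + h + \<xi>) - K (x + \<xi>)\<bar> \<le> 2 * (\<bar>x\<bar> / 4) powr - (2 + \<alpha>) * \<bar>x + h + \<xi> - (x + \<xi>)\<bar>"
      using x by (intro K_diff_le) auto
    also have "\<dots> = 2 * 4 powr (2 + \<alpha>) * (\<bar>h\<bar> * \<bar>x\<bar> powr - (2 + \<alpha>))"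
      by (subst divide_powr_minus) auto
    also have "\<dots> \<le> 2 * 64 * (\<bar>h\<bar> powr (1 - \<alpha>) * \<bar>x\<bar> powr -2)"
    proof (rule mult_mono)
      show "2 * (4::real) powr (2 + \<alpha>) \<le> 2 * 64"
        using powr_mono[of "2 + \<alpha>" 3 "4::real"] \<alpha>_less by (simp add: powr_numeral)
      show "\<bar>h\<bar> * \<bar>x\<bar> powr - (2 + \<alpha>) \<le> \<bar>h\<bar> powr (1 - \<alpha>) * \<bar>x\<bar> powr -2"
      proof (cases "h = 0")
        case False
        have "\<bar>h\<bar> * \<bar>x\<bar> powr - (2 + \<alpha>) = (\<bar>h\<bar> powr (1 - \<alpha>) * \<bar>h\<bar> powr \<alpha>) * (\<bar>x\<bar> powr - \<alpha> * \<bar>x\<bar> powr - 2)"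
          using False x unfolding powr_add[symmetric] by (simp add: algebra_simps)
        also have "\<dots> \<le> (\<bar>h\<bar> powr (1 - \<alpha>) * \<bar>x\<bar> powr \<alpha>) * (\<bar>x\<bar> powr - \<alpha> * \<bar>x\<bar> powr - 2)"
          using that \<alpha>_pos by (intro mult_right_mono mult_left_mono powr_mono2) auto
        also have "\<dots> = \<bar>h\<bar> powr (1 - \<alpha>) * \<bar>x\<bar> powr -2"
          using x by (simp add: powr_minus field_simps)
        finally show ?thesis .
      qed simp
    qed auto
    also have "\<dots> = 128 * \<bar>h\<bar> powr (1 - \<alpha>) * \<bar>x\<bar> powr -2" by simp
    also have "\<dots> \<le> (128 * atom_const) * \<bar>h\<bar> powr (1 - \<alpha>) * \<bar>x\<bar> powr -2"
      using atom_const_ge by (intro mult_right_mono) auto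
    finally show ?thesis using \<xi> by simp
  next
    case False
    have "\<bar>atom w (x + h) - atom w x\<bar> \<le> atom_const * w powr -2 * \<bar>h\<bar> powr (1 - \<alpha>)"
      using atom_holder[OF w, of "x + h" x] by simp
    also have "\<dots> \<le> atom_const * (\<bar>x\<bar> / 4) powr -2 * \<bar>h\<bar> powr (1 - \<alpha>)"
      using False w x atom_const_pos by (intro mult_right_mono mult_left_mono powr_mono2') auto
    also have "\<dots> = 16 * atom_const * (\<bar>h\<bar> powr (1 - \<alpha>) * \<bar>x\<bar> powr -2)"
      by (simp add: powr_minus powr_divide powr_numeral field_simps)
    also have "\<dots> \<le> 128 * atom_const * (\<bar>h\<bar> powr (1 - \<alpha>) * \<bar>x\<bar> powr -2)"
      using atom_const_pos by (intro mult_right_mono) auto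
    finally show ?thesis by simp
  qed
  show ?thesis
  proof (cases "2 * \<bar>h\<bar> \<le> \<bar>x\<bar>")
    case True
    have "128 * atom_const * \<bar>h\<bar> powr (1 - \<alpha>) * \<bar>x\<bar> powr -2 \<le> 
       128 * atom_const * \<bar>h\<bar> powr (1 - \<alpha>) * (\<bar>x\<bar> powr -2 + \<bar>x + h\<bar> powr -2)"
      using atom_const_pos by (intro mult_left_mono) auto
    then show ?thesis using more[OF True] by linarith
  next
    case False
    have h: "\<bar>h\<bar> > 0" using False by auto
    have b: "\<bar>atom w y\<bar> \<le> 128 * atom_const * \<bar>h\<bar> powr (1 - \<alpha>) * \<bar>y\<bar> powr -2" if "y \<noteq> 0" "\<bar>y\<bar> \<le> 2 * (2 * \<bar>h\<bar>)" for y
    proof -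
      have "\<bar>atom w y\<bar> \<le> 4 * atom_const * K y" by (rule atom_le[OF w that(1)])
      also have "\<dots> \<le> 4 * atom_const * (2 * ((2 * \<bar>h\<bar>) powr (1 - \<alpha>) * \<bar>y\<bar> powr -2))"
        using that h atom_const_pos by (intro mult_left_mono K_le_shift) auto
      also have "\<dots> = (8 * atom_const * (2 powr (1 - \<alpha>))) * (\<bar>h\<bar> powr (1 - \<alpha>) * \<bar>y\<bar> powr -2)"
        by (simp add: powr_mult)
      also have "\<dots> \<le> (128 * atom_const) * (\<bar>h\<bar> powr (1 - \<alpha>) * \<bar>y\<bar> powr -2)"
        using powr_mono[of "1 - \<alpha>" 1 "2::real"] \<alpha>_pos atom_const_pos by (intro mult_right_mono) auto
      finally show ?thesis by simp
    qed
    show ?thesis using b[OF x] b[OF xh] False by (simp add: algebra_simps) linarith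
  qed
qed

end

section \<open>The logarithmic integral and the choice of the exponent\<close>

lemma continuous_x_ln_abs: "continuous_on A (\<lambda>y::real. y * ln \<bar>y\<bar>)"
proof -
  have "isCont (\<lambda>y::real. y * ln \<bar>y\<bar>) x" for x
  proof (cases "x = 0")
    case True
    have "((\<lambda>y::real. y * ln \<bar>y\<bar>) \<longlongrightarrow> 0) (at_right 0)" by real_asymp
    moreover have "((\<lambda>y::real. y * ln \<bar>y\<bar>) \<longlongrightarrow> 0) (at_left 0)" by real_asymp
    ultimately show ?thesis using True by (auto simp: isCont_def filterlim_split_at)
  qed (auto intro!: continuous_intros)
  then show ?thesis by (intro continuous_at_imp_continuous_on) auto
qed

lemma DERIV_x_ln_abs:
  assumes "y \<noteq> (0::real)"
  shows "((\<lambda>y. y * ln \<bar>y\<bar>) has_real_derivative ln \<bar>y\<bar> + 1) (at y)"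
proof -
  have "((\<lambda>y. ln \<bar>y\<bar>) has_real_derivative 1 / y) (at y)"
  proof (cases "y > 0")
    case True
    have "(ln has_real_derivative 1 / y) (at y)" using True by (auto intro!: derivative_eq_intros)
    then show ?thesis
      by (rule has_field_derivative_transform_within_open[of _ _ _ "{0<..}"]) (use True in auto)
  next
    case False
    then have y: "y < 0" using assms by auto
    have "((\<lambda>y. ln (- y)) has_real_derivative 1 / y) (at y)"
      using y by (auto intro!: derivative_eq_intros simp: field_simps)
    then show ?thesis
      by (rule has_field_derivative_transform_within_open[of _ _ _ "{..<0}"]) (use y in auto)
  qed
  then have "((\<lambda>y. y * ln \<bar>y\<bar>) has_real_derivative 1 * ln \<bar>y\<bar> + (1 / y) * y) (at y)"
    by (intro DERIV_mult DERIV_ident)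
  then show ?thesis using assms by simp
qed

text \<open>The borderline case \<open>s = 2\<close>, where \<open>1 - z^(-2) = (z + 1) (z - 1) / z^2\<close> splits the logarithm
  into three elementary ones. The primitive tends to 0 at infinity, so the integral over the half-line is zero.\<close>

lemma has_integral_ln_model:
  assumes Z: "Z > (1::real)"
  defines "A \<equiv> \<lambda>y::real. (y + 1) * ln \<bar>y + 1\<bar> + (y - 1) * ln \<bar>y - 1\<bar> - 2 * (y * ln \<bar>y\<bar>)"
  shows "((\<lambda>z. ln \<bar>1 - z powr -2\<bar>) has_integral A Z) {0..Z}"
proof -
  have "((\<lambda>z. ln \<bar>1 - z powr -2\<bar>) has_integral A Z - A 0) {0..Z}"
  proof (rule fundamental_theorem_of_calculus_interior_strong[of "{0, 1}"])
    have c: "continuous_on B (\<lambda>y::real. (y + c) * ln \<bar>y + c\<bar>)" for B c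
      by (rule continuous_on_compose2[OF continuous_x_ln_abs[of UNIV]]) (auto intro!: continuous_intros)
    show "continuous_on {0..Z} A"
      using c[of _ 1] c[of _ "-1"] c[of _ 0] unfolding A_def
      by (intro continuous_on_diff continuous_on_add continuous_on_mult_left) simp_all
  next
    fix x assume x: "x \<in> {0<..<Z} - {0, 1}"
    have d: "((\<lambda>y. (y + c) * ln \<bar>y + c\<bar>) has_real_derivative ln \<bar>x + c\<bar> + 1) (at x)"
      if "x + c \<noteq> 0" for c
      using DERIV_x_ln_abs[OF that] DERIV_shift[of "\<lambda>y. y * ln \<bar>y\<bar>" "ln \<bar>x + c\<bar> + 1" x c] by simp
    have "(A has_real_derivative (ln \<bar>x + 1\<bar> + 1) + (ln \<bar>x - 1\<bar> + 1) - 2 * (ln \<bar>x\<bar> + 1)) (at x)"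
      unfolding A_def using d[of 1] d[of "-1"] d[of 0] x by (intro DERIV_diff DERIV_add DERIV_cmult) auto
    also have "(ln \<bar>x + 1\<bar> + 1) + (ln \<bar>x - 1\<bar> + 1) - 2 * (ln \<bar>x\<bar> + 1) = ln (\<bar>x + 1\<bar> * \<bar>x - 1\<bar> / \<bar>x\<bar>^2)"
      using x by (simp add: ln_mult ln_div ln_realpow)
    also have "\<bar>x + 1\<bar> * \<bar>x - 1\<bar> / \<bar>x\<bar>^2 = \<bar>1 - x powr -2\<bar>"
    proof -
      have "1 - x powr -2 = (x + 1) * (x - 1) / x^2"
        using x by (simp add: powr_minus powr_numeral field_simps power2_eq_square)
      then show ?thesis by (simp add: abs_mult abs_divide)
    qed
    finally show "(A has_vector_derivative ln \<bar>1 - x powr -2\<bar>) (at x)"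
      by (simp add: has_real_derivative_iff_has_vector_derivative)
  qed (use Z in auto)
  then show ?thesis by (simp add: A_def)
qed

lemma has_integral_abs_powr:
  fixes a b c e :: real
  assumes "a \<le> b" "e > -1"
  shows "((\<lambda>z. \<bar>z - c\<bar> powr e) has_integral
     (sgn (b - c) * \<bar>b - c\<bar> powr (e + 1) - sgn (a - c) * \<bar>a - c\<bar> powr (e + 1)) / (e + 1)) {a..b}"
proof -
  define A where "A z = (sgn (z - c) * \<bar>z - c\<bar> powr (e + 1)) / (e + 1)" for z :: real
  have "((\<lambda>z. \<bar>z - c\<bar> powr e) has_integral A b - A a) {a..b}"
  proof (rule fundamental_theorem_of_calculus_interior_strong[of "{c}"])
    have eq: "A z = (if z \<in> {..c} then - ((c - z) powr (e + 1)) else (z - c) powr (e + 1)) / (e + 1)" for z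
      unfolding A_def by (auto simp: sgn_if)
    have "continuous_on ({..c} \<union> {c..}) (\<lambda>z. if z \<in> {..c} then - ((c - z) powr (e + 1)) else (z - c) powr (e + 1))"
      by (rule continuous_on_If) (use assms in \<open>auto intro!: continuous_intros continuous_on_powr'\<close>)
    then show "continuous_on {a..b} A"
      unfolding eq by (intro continuous_on_divide continuous_on_const)
        (use assms in \<open>auto elim!: continuous_on_subset\<close>)
  next
    fix x :: real assume x: "x \<in> {a<..<b} - {c}"
    have "((\<lambda>z. sgn z * \<bar>z\<bar> powr (e + 1)) has_real_derivative (e + 1) * \<bar>x - c\<bar> powr (e + 1 - 1)) (at (x - c))"
      using has_real_derivative_sgn_abs_powr[of "x - c" "e + 1"] x by simp
    then have "((\<lambda>z. sgn (z - c) * \<bar>z - c\<bar> powr (e + 1)) has_real_derivative (e + 1) * \<bar>x - c\<bar> powr (e + 1 - 1)) (at x)"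
      using DERIV_shift[of "\<lambda>z. sgn z * \<bar>z\<bar> powr (e + 1)" "(e + 1) * \<bar>x - c\<bar> powr (e + 1 - 1)" x "-c"] by simp
    from DERIV_cdivide[OF this, of "e + 1"] show "(A has_vector_derivative \<bar>x - c\<bar> powr e) (at x)"
      using assms by (simp add: A_def[abs_def] has_real_derivative_iff_has_vector_derivative)
  qed (use assms in auto)
  then show ?thesis by (simp add: A_def diff_divide_distrib)
qed

text \<open>Taylor expansion of \<open>exp (p ln x)\<close> in \<open>p\<close>. The square of the logarithm in the
  remainder is absorbed by \<open>exp (|ln x| / 4)\<close>, and \<open>p \<le> 1/4\<close> keeps the other exponential below the same bound.\<close>

lemma powr_le_quadratic:
  fixes x p :: real
  assumes x: "x > 0" and p: "0 < p" "p \<le> 1/4"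
  shows "x powr p \<le> 1 + p * ln x + 16 * p\<^sup>2 * (x powr (1/2) + x powr (-1/2))"
proof -
  define u where "u = ln x"
  obtain t where t: "\<bar>t\<bar> \<le> \<bar>p * u\<bar>" "exp (p * u) = (\<Sum>m<2. (p * u) ^ m / fact m) + exp t / fact 2 * (p * u)^2"
    using Maclaurin_exp_le[of "p * u" 2] by blast
  have eq: "exp (p * u) = 1 + p * u + exp t / 2 * (p * u)\<^sup>2"
    using t(2) by (simp add: numeral_2_eq_2)
  have "\<bar>p * u\<bar> \<le> \<bar>u\<bar> / 4" using p mult_right_mono[of p "1/4" "\<bar>u\<bar>"] by (simp add: abs_mult)
  then have e1: "exp t \<le> exp (\<bar>u\<bar> / 4)" using t(1) by simp
  have "(\<bar>u\<bar> / 4)^2 / 2 \<le> exp (\<bar>u\<bar> / 4)"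
    using exp_ge_one_plus_x_over_n_power_n[of 1 0] exp_lower_Taylor_quadratic[of "\<bar>u\<bar> / 4"] by (simp add: field_simps) 
  then have e2: "u\<^sup>2 \<le> 32 * exp (\<bar>u\<bar> / 4)" by (simp add: power2_eq_square field_simps)
  have "exp t / 2 * (p * u)\<^sup>2 \<le> exp (\<bar>u\<bar> / 4) / 2 * (p\<^sup>2 * (32 * exp (\<bar>u\<bar> / 4)))"
    unfolding power_mult_distrib using e1 e2 by (intro mult_mono) auto
  also have "\<dots> = 16 * p\<^sup>2 * exp (\<bar>u\<bar> / 4 + \<bar>u\<bar> / 4)" unfolding exp_add by simp
  also have "\<dots> \<le> 16 * p\<^sup>2 * (exp (u / 2) + exp (- u / 2))"
    by (intro mult_left_mono) (cases "u \<ge> 0"; simp)+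
  finally show ?thesis using eq x by (simp add: powr_def u_def mult.commute)
qed

text \<open>The singularity of negative powers of \<open>1 - z^(-s)\<close> at \<open>z = 1\<close> is no
  worse than that of negative powers of \<open>z - 1\<close>.\<close>

lemma abs_one_minus_powr_ge:
  fixes z s :: real
  assumes "z > 0" "s \<ge> 1"
  shows "\<bar>1 - z powr - s\<bar> \<ge> \<bar>z - 1\<bar> / max 1 z"
proof (cases "z \<le> 1")
  case True
  have "z powr -1 \<le> z powr - s" using assms True by (intro powr_mono') auto
  moreover have "1 / z - 1 \<ge> 1 - z" using assms True
    using sum_squares_bound[of z 1] by (simp add: field_simps power2_eq_square)
  ultimately have "z powr - s - 1 \<ge> 1 - z" using assms by (simp add: powr_minus_divide)
  then show ?thesis using True by (simp add: max_def)
next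
  case False
  have "z powr - s \<le> z powr -1" using assms False by (intro powr_mono) auto
  then have "1 - z powr -s \<ge> (z - 1) / z" using assms by (simp add: powr_minus_divide field_simps)
  then show ?thesis using False by (simp add: max_def)
qed

lemma nn_integral_le_of_has_integral:
  fixes f h :: "real \<Rightarrow> real"
  assumes "(h has_integral I) S" "finite N" "\<And>x. x \<in> S - N \<Longrightarrow> 0 \<le> f x \<and> f x \<le> h x"
  shows "(\<integral>\<^sup>+x. ennreal (f x) * indicator S x \<partial>lborel) \<le> ennreal I"
proof -
  define h2 where "h2 x = (if x \<in> N then 0 else h x)" for x
  have 1: "(h2 has_integral I) S"
    by (rule has_integral_spike_finite[OF assms(2) _ assms(1)]) (auto simp: h2_def)
  have 2: "h2 x \<ge> 0" if "x \<in> S" for x using assms(3)[of x] that by (auto simp: h2_def)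
  have "(\<integral>\<^sup>+x. ennreal (f x) * indicator S x \<partial>lborel) \<le> (\<integral>\<^sup>+x. ennreal (h2 x) * indicator S x \<partial>lborel)"
  proof (rule nn_integral_mono_AE)
    have "AE x in lborel. x \<notin> N"
      using assms(2) by (intro AE_not_in finite_imp_null_set_lborel)
    then show "AE x in lborel. ennreal (f x) * indicator S x \<le> ennreal (h2 x) * indicator S x"
    proof eventually_elim
      case (elim x)
      then show ?case using assms(3)[of x] by (cases "x \<in> S") (auto simp: h2_def intro: ennreal_leI)
    qed
  qed
  also have "\<dots> = ennreal I" by (rule nn_integral_has_integral_lebesgue'[OF 2 1])
  finally show ?thesis .
qed

text \<open>To first order in \<open>p\<close> the integral is \<open>Z\<close> plus \<open>p\<close> times the integral of \<open>ln |1 - z^(-s)|\<close>.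
  The latter is less than the integral for \<open>s = 2\<close>, which tends to 0 as \<open>Z\<close> grows, by a fixed amount that is gained
  on \<open>[2, 3]\<close>.\<close>

lemma exists_exponent_integral_less:
  fixes s :: real
  assumes s: "1 < s" "s < 2"
  shows "\<exists>p Z g. 0 < p \<and> p \<le> 1/4 \<and> Z \<ge> 1 \<and> g > 0 \<and>
    (\<integral>\<^sup>+z. ennreal (\<bar>1 - z powr - s\<bar> powr p) * indicator {0..Z} z \<partial>lborel) \<le> ennreal (Z - g)"
proof -
  \<comment> \<open>A lower bound for \<open>z^(-s) - z^(-2) = z^(-2) (z^(2-s) - 1)\<close> on \<open>[2, 3]\<close>.\<close>
  define d where "d = (2 powr (2 - s) - 1) / 9"
  have d: "d > 0" unfolding d_def using s by simp
  define A where "A y = (y + 1) * ln \<bar>y + 1\<bar> + (y - 1) * ln \<bar>y - 1\<bar> - 2 * (y * ln \<bar>y\<bar>)" for y :: real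
  have "(A \<longlongrightarrow> 0) at_top" unfolding A_def by real_asymp
  then have "eventually (\<lambda>Z. A Z < d / 2) at_top" using d by (intro order_tendstoD) auto
  then have "eventually (\<lambda>Z. A Z < d / 2 \<and> Z \<ge> 4) at_top"
    using eventually_ge_at_top[of 4] by eventually_elim auto
  then obtain Z where Z: "A Z < d / 2" "Z \<ge> 4" by (auto simp: eventually_at_top_linorder)
  \<comment> \<open>The integral of the coefficient of \<open>p^2\<close> in the majorant \<open>h\<close> below.\<close>
  define C where "C = 16 * (Z + (Z powr (- s / 2 + 1) / (- s / 2 + 1)) + Z powr (1/2) * (2 * (Z - 1) powr (1/2) + 2))"
  have C: "C \<ge> 0" unfolding C_def using Z s by (auto intro!: add_nonneg_nonneg)
  define p where "p = min (1/4) (d / (4 * (C + 1)))"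
  have p: "0 < p" "p \<le> 1/4" "p * C \<le> d / 4"
  proof -
    show "0 < p" unfolding p_def using d C by auto
    show "p \<le> 1/4" unfolding p_def by (rule min.cobounded1)
    have "p * C \<le> (d / (4 * (C + 1))) * C" unfolding p_def using C by (intro mult_right_mono) auto
    also have "\<dots> \<le> d / 4" using C d by (simp add: field_simps)
    finally show "p * C \<le> d / 4" .
  qed
  define h where "h z = 1 + p * (ln \<bar>1 - z powr -2\<bar> - (if z \<in> {2..3} then d else 0))
      + p\<^sup>2 * (16 * (1 + z powr (- s / 2) + Z powr (1/2) * \<bar>z - 1\<bar> powr (-1/2)))" for z
  have hi: "(h has_integral (Z + p * (A Z - d) + p\<^sup>2 * C)) {0..Z}"
  proof -
    have "((\<lambda>z. if z \<in> {2..3} then d else 0) has_integral d) {0..Z}"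
    proof -
      have "((\<lambda>z. d) has_integral (3 - 2) *\<^sub>R d) {2..3::real}"
        using has_integral_const_real[of d 2 3] by simp
      then show ?thesis using Z by (subst has_integral_restrict) auto
    qed
    moreover have "((\<lambda>z::real. 1::real) has_integral Z) {0..Z}"
      using has_integral_const_real[of "1::real" 0 Z] Z by simp
    moreover have "((\<lambda>z. z powr (- s / 2)) has_integral Z powr (- s / 2 + 1) / (- s / 2 + 1)) {0..Z}"
      using s Z by (intro has_integral_powr_from_0) auto
    moreover have "((\<lambda>z. ln \<bar>1 - z powr -2\<bar>) has_integral A Z) {0..Z}"
      unfolding A_def using Z by (intro has_integral_ln_model) auto
    moreover have "((\<lambda>z. \<bar>z - 1\<bar> powr (-1/2)) has_integral 2 * (Z - 1) powr (1/2) + 2) {0..Z}"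
      using has_integral_abs_powr[of 0 Z "-1/2" 1] Z by (simp add: add.commute mult.commute)
    ultimately show ?thesis unfolding h_def C_def
      by (intro has_integral_add has_integral_mult_right has_integral_diff)
  qed
  have hb: "0 \<le> \<bar>1 - z powr - s\<bar> powr p \<and> \<bar>1 - z powr - s\<bar> powr p \<le> h z" if z: "z \<in> {0..Z} - {0, 1}" for z
  proof -
    define x where "x = \<bar>1 - z powr - s\<bar>"
    have x0: "x > 0" unfolding x_def using z s powr_eq_one_iff_gen[of z "-s"] by auto
    have low: "x \<ge> \<bar>z - 1\<bar> / Z"
    proof -
      have "\<bar>z - 1\<bar> / Z \<le> \<bar>z - 1\<bar> / max 1 z" using z Z by (intro divide_left_mono) auto
      also have "\<dots> \<le> x" unfolding x_def using z s by (intro abs_one_minus_powr_ge) auto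
      finally show ?thesis .
    qed
    have "x powr (-1/2) \<le> (\<bar>z - 1\<bar> / Z) powr (-1/2)"
      using low z Z by (intro powr_mono2') auto
    also have "\<dots> = Z powr (1/2) * \<bar>z - 1\<bar> powr (-1/2)"
      using Z by (simp add: powr_divide powr_minus field_simps)
    finally have b1: "x powr (-1/2) \<le> Z powr (1/2) * \<bar>z - 1\<bar> powr (-1/2)" .
    have "x \<le> 1 + z powr - s" unfolding x_def by (auto simp: abs_if)
    then have "x powr (1/2) \<le> (1 + z powr - s) powr (1/2)" using x0 by (intro powr_mono2) auto
    also have "\<dots> \<le> 1 powr (1/2) + (z powr - s) powr (1/2)" by (intro powr_subadditive) auto
    also have "\<dots> = 1 + z powr (- s / 2)" by (simp add: powr_powr)
    finally have b2: "x powr (1/2) \<le> 1 + z powr (- s / 2)" .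
    \<comment> \<open>Passing from \<open>s\<close> to 2 does not decrease \<open>|1 - z^(-s)|\<close>, on either side of \<open>z = 1\<close>; on
      \<open>[2, 3]\<close> the logarithm increases by at least \<open>d\<close>.\<close>
    have b3: "ln x \<le> ln \<bar>1 - z powr -2\<bar> - (if z \<in> {2..3} then d else 0)"
    proof (cases "z \<in> {2..3}")
      case True
      have a: "1 - z powr - s < 1" "1 - z powr - 2 \<le> 1" using True by auto
      have gap: "z powr - s - z powr -2 \<ge> d"
      proof -
        have "z powr - s - z powr -2 = z powr -2 * (z powr (2 - s) - 1)"
          using True by (simp add: algebra_simps powr_add[symmetric])
        also have "\<dots> \<ge> (1/9) * (2 powr (2 - s) - 1)"
        proof (rule mult_mono)
          have "3 powr -2 \<le> z powr -2" using True by (intro powr_mono2') auto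
          then show "1/9 \<le> z powr -2" by (simp add: powr_minus powr_numeral)
          show "2 powr (2 - s) - 1 \<le> z powr (2 - s) - 1" using True s by (auto intro!: powr_mono2)
        qed (use d in \<open>auto simp: d_def\<close>)
        finally show ?thesis by (simp add: d_def)
      qed
      have pos: "1 - z powr - s > 0" using True s powr_less_one[of z "-s"] by auto
      have pos2: "1 - z powr -2 > 0" using gap d pos by linarith
      have "ln (1 - z powr - s) - ln (1 - z powr -2) \<le> ((1 - z powr - s) - (1 - z powr -2)) / (1 - z powr -2)"
        using pos pos2 by (rule ln_diff_le)
      also have "\<dots> \<le> ((1 - z powr - s) - (1 - z powr -2)) / 1"
        using pos2 gap d by (intro divide_left_mono_neg) auto
      also have "\<dots> \<le> - d" using gap by simp
      finally show ?thesis using True pos pos2 by (simp add: x_def)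
    next
      case False
      have "x \<le> \<bar>1 - z powr -2\<bar>"
      proof (cases "z < 1")
        case True
        then have "z powr - s \<le> z powr -2" "1 \<le> z powr - s"
          using z s powr_mono'[of "-2" "-s" z] powr_mono'[of "-s" 0 z] by auto
        then show ?thesis unfolding x_def by simp
      next
        case False
        then have "z powr -2 \<le> z powr - s" "z powr - s \<le> 1"
          using z s powr_mono[of "-2" "-s" z] powr_mono[of "-s" 0 z] by auto
        then show ?thesis unfolding x_def by simp
      qed
      then show ?thesis using False x0 by (simp only: if_False diff_zero) (simp add: ln_mono)
    qed
    have "x powr p \<le> 1 + p * ln x + 16 * p\<^sup>2 * (x powr (1/2) + x powr (-1/2))"
      by (rule powr_le_quadratic[OF x0 p(1,2)])
    also have "\<dots> \<le> 1 + p * (ln \<bar>1 - z powr -2\<bar> - (if z \<in> {2..3} then d else 0))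
      + 16 * p\<^sup>2 * ((1 + z powr (- s / 2)) + Z powr (1/2) * \<bar>z - 1\<bar> powr (-1/2))"
      using b1 b2 b3 p by (intro add_mono mult_left_mono) auto
    also have "\<dots> = h z" unfolding h_def by simp
    finally show ?thesis unfolding x_def by simp
  qed
  have "(\<integral>\<^sup>+z. ennreal (\<bar>1 - z powr - s\<bar> powr p) * indicator {0..Z} z \<partial>lborel) \<le> ennreal (Z + p * (A Z - d) + p\<^sup>2 * C)"
    by (rule nn_integral_le_of_has_integral[OF hi, of "{0,1}"]) (use hb in auto)
  also have "\<dots> \<le> ennreal (Z - p * d / 4)"
  proof (rule ennreal_leI)
    have "p * (A Z - d) \<le> p * (- d / 2)" using Z p by (intro mult_left_mono) auto
    moreover have "p\<^sup>2 * C \<le> p * (d / 4)"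
      using p mult_left_mono[of "p * C" "d / 4" p] by (simp add: power2_eq_square mult.assoc)
    ultimately show "Z + p * (A Z - d) + p\<^sup>2 * C \<le> Z - p * d / 4" by simp
  qed
  finally show ?thesis using p Z d by (intro exI[of _ p] exI[of _ Z] exI[of _ "p * d / 4"]) auto
qed

section \<open>Integrals of small powers of singular sums\<close>

text \<open>For \<open>p \<le> 1/4\<close> the function \<open>|x|^(-2p)\<close> is integrable near 0, and \<open>p\<close>-th powers are
  subadditive, so the singularities can be integrated one at a time.\<close>

lemma nn_integral_near_points:
  fixes p :: real and t b :: "'i \<Rightarrow> real" and g :: "real \<Rightarrow> real"
  assumes p: "0 < p" "p \<le> 1/4" and I: "finite I"
    and b: "\<And>i. i \<in> I \<Longrightarrow> \<bar>b i\<bar> \<le> 2" and t: "\<And>i. i \<in> I \<Longrightarrow> t i \<ge> 0"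
    and g: "\<And>x. \<bar>x\<bar> \<le> 4 \<Longrightarrow> x \<notin> b ` I \<Longrightarrow> \<bar>g x\<bar> \<le> (\<Sum>i\<in>I. t i * \<bar>x - b i\<bar> powr -2)"
  shows "(\<integral>\<^sup>+x. ennreal (\<bar>g x\<bar> powr p) * indicator {-4..4} x \<partial>lborel)
    \<le> ennreal (24 * (\<Sum>i\<in>I. t i powr p))"
proof -
  have one: "(\<integral>\<^sup>+x. ennreal (\<bar>x - c\<bar> powr (-2 * p)) * indicator {-4..4} x \<partial>lborel) \<le> ennreal 24"
    if "\<bar>c\<bar> \<le> 2" for c
  proof -
    let ?I = "(sgn (4 - c) * \<bar>4 - c\<bar> powr (-2 * p + 1) - sgn (-4 - c) * \<bar>-4 - c\<bar> powr (-2 * p + 1)) / (-2 * p + 1)"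
    have "((\<lambda>x. \<bar>x - c\<bar> powr (-2 * p)) has_integral ?I) {-4..4}"
      by (rule has_integral_abs_powr) (use p in auto)
    then have "(\<integral>\<^sup>+x. ennreal (\<bar>x - c\<bar> powr (-2 * p)) * indicator {-4..4} x \<partial>lborel) \<le> ennreal ?I"
      by (rule nn_integral_le_of_has_integral[where N = "{}"]) auto
    also have "?I \<le> 24"
    proof -
      have e: "0 < 1 - 2 * p" "1 - 2 * p \<le> 1" "1/2 \<le> 1 - 2 * p" using p by auto
      have 1: "(u::real) powr (1 - 2 * p) \<le> 6" if "1 \<le> u" "u \<le> 6" for u
        using powr_mono[OF e(2) that(1)] that by simp
      have "\<bar>4 - c\<bar> powr (-2 * p + 1) \<le> 6" "\<bar>-4 - c\<bar> powr (-2 * p + 1) \<le> 6"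
        using 1[of "\<bar>4 - c\<bar>"] 1[of "\<bar>-4 - c\<bar>"] that by (auto simp: add.commute)
      moreover have "sgn (4 - c) = 1" "sgn (-4 - c) = -1" using that by auto
      ultimately have "?I \<le> 12 / (-2 * p + 1)" using e by (intro divide_right_mono) auto
      also have "\<dots> \<le> 12 / (1/2)" using e by (intro divide_left_mono) auto
      finally show ?thesis by simp
    qed
    finally show ?thesis by (simp add: ennreal_leI)
  qed
  have "(\<integral>\<^sup>+x. ennreal (\<bar>g x\<bar> powr p) * indicator {-4..4} x \<partial>lborel)
    \<le> (\<integral>\<^sup>+x. (\<Sum>i\<in>I. ennreal (t i powr p) * (ennreal (\<bar>x - b i\<bar> powr (-2 * p)) * indicator {-4..4} x)) \<partial>lborel)"
  proof (rule nn_integral_mono_AE)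
    have "AE x in lborel. x \<notin> b ` I"
      using I by (intro AE_not_in finite_imp_null_set_lborel) auto
    then show "AE x in lborel. ennreal (\<bar>g x\<bar> powr p) * indicator {-4..4} x
      \<le> (\<Sum>i\<in>I. ennreal (t i powr p) * (ennreal (\<bar>x - b i\<bar> powr (-2 * p)) * indicator {-4..4} x))"
    proof eventually_elim
      case (elim x)
      show ?case
      proof (cases "x \<in> {-4..4}")
        case True
        then have "\<bar>g x\<bar> \<le> (\<Sum>i\<in>I. t i * \<bar>x - b i\<bar> powr -2)" using g elim by auto
        then have "\<bar>g x\<bar> powr p \<le> \<bar>\<Sum>i\<in>I. t i * \<bar>x - b i\<bar> powr -2\<bar> powr p"
          using p by (intro powr_mono2) auto
        also have "\<dots> \<le> (\<Sum>i\<in>I. \<bar>t i * \<bar>x - b i\<bar> powr -2\<bar> powr p)"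
          using p by (intro abs_sum_powr_le) auto
        also have "\<dots> = (\<Sum>i\<in>I. t i powr p * \<bar>x - b i\<bar> powr (-2 * p))"
          by (rule sum.cong) (auto simp: abs_mult powr_mult powr_powr t)
        finally show ?thesis using True by (simp add: ennreal_mult'[symmetric] sum_nonneg)
      qed simp
    qed
  qed
  also have "\<dots> = (\<Sum>i\<in>I. ennreal (t i powr p) * (\<integral>\<^sup>+x. ennreal (\<bar>x - b i\<bar> powr (-2 * p)) * indicator {-4..4} x \<partial>lborel))"
    by (subst nn_integral_sum) (auto intro!: sum.cong nn_integral_cmult)
  also have "\<dots> \<le> (\<Sum>i\<in>I. ennreal (t i powr p) * ennreal 24)"
    using b by (intro sum_mono mult_left_mono one) auto
  also have "\<dots> = ennreal (24 * (\<Sum>i\<in>I. t i powr p))"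
    by (simp add: ennreal_mult'[symmetric] sum_distrib_left mult.commute sum_nonneg del: ennreal_numeral)
  finally show ?thesis .
qed

lemma nn_integral_far_inverse_square:
  "(\<integral>\<^sup>+x. ennreal (\<bar>x\<bar> powr -2) * indicator (- {-4..4}) x \<partial>lborel) \<le> ennreal 1"
proof -
  have half: "(\<integral>\<^sup>+x. ennreal (x powr -2) * indicator {4..} x \<partial>lborel) \<le> ennreal (1/2)"
  proof -
    have "((\<lambda>x::real. x powr -2) has_integral -(4 powr (-2+1)) / (-2+1)) {4..}"
      by (rule has_integral_powr_to_inf) auto
    then have "(\<integral>\<^sup>+x. ennreal (x powr -2) * indicator {4..} x \<partial>lborel) \<le> ennreal (-(4 powr (-2+1)) / (-2+1))"
      by (rule nn_integral_le_of_has_integral[where N = "{}"]) auto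
    also have "-(4 powr (-2+1)) / (-2+1) \<le> (1/2 :: real)" by (simp add: powr_minus)
    finally show ?thesis by (simp add: ennreal_leI)
  qed
  have "(\<integral>\<^sup>+x. ennreal (\<bar>x\<bar> powr -2) * indicator (- {-4..4}) x \<partial>lborel)
    \<le> (\<integral>\<^sup>+x. ennreal (x powr -2) * indicator {4..} x + ennreal ((-x) powr -2) * indicator {4..} (-x) \<partial>lborel)"
    by (rule nn_integral_mono) (auto simp: indicator_def)
  also have "\<dots> = (\<integral>\<^sup>+x. ennreal (x powr -2) * indicator {4..} x \<partial>lborel)
     + (\<integral>\<^sup>+x. ennreal ((-x) powr -2) * indicator {4..} (-x) \<partial>lborel)"
    by (rule nn_integral_add) auto
  also have "(\<integral>\<^sup>+x. ennreal ((-x) powr -2) * indicator {4..} (-x) \<partial>lborel) = (\<integral>\<^sup>+x. ennreal (x powr -2) * indicator {4..} x \<partial>lborel)"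
    using nn_integral_real_affine[of "\<lambda>x. ennreal (x powr -2) * indicator {4..} x" "-1" 0] by simp
  also have "(\<integral>\<^sup>+x. ennreal (x powr -2) * indicator {4..} x \<partial>lborel) + (\<integral>\<^sup>+x. ennreal (x powr -2) * indicator {4..} x \<partial>lborel)
     \<le> ennreal (1/2) + ennreal (1/2)" by (intro add_mono half)
  also have "\<dots> = ennreal 1" by (subst ennreal_plus[symmetric]) auto
  finally show ?thesis .
qed

lemma nn_integral_far:
  fixes p M T :: real and g :: "real \<Rightarrow> real"
  assumes p: "0 < p" "2 \<le> M * p" "0 \<le> T"
    and g: "\<And>x. \<bar>x\<bar> > 4 \<Longrightarrow> \<bar>g x\<bar> \<le> T * \<bar>x\<bar> powr - M"
  shows "(\<integral>\<^sup>+x. ennreal (\<bar>g x\<bar> powr p) * indicator (- {-4..4}) x \<partial>lborel) \<le> ennreal (T powr p)"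
proof -
  have "(\<integral>\<^sup>+x. ennreal (\<bar>g x\<bar> powr p) * indicator (- {-4..4}) x \<partial>lborel)
    \<le> (\<integral>\<^sup>+x. ennreal (T powr p) * (ennreal (\<bar>x\<bar> powr -2) * indicator (- {-4..4}) x) \<partial>lborel)"
  proof (rule nn_integral_mono)
    fix x :: real
    show "ennreal (\<bar>g x\<bar> powr p) * indicator (- {-4..4}) x
      \<le> ennreal (T powr p) * (ennreal (\<bar>x\<bar> powr -2) * indicator (- {-4..4}) x)"
    proof (cases "\<bar>x\<bar> > 4")
      case True
      have "\<bar>g x\<bar> powr p \<le> (T * \<bar>x\<bar> powr - M) powr p" using p g[OF True] by (intro powr_mono2) auto
      also have "\<dots> = T powr p * \<bar>x\<bar> powr - (M * p)" using p by (simp add: powr_mult powr_powr)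
      also have "\<dots> \<le> T powr p * \<bar>x\<bar> powr -2" using p True by (intro mult_left_mono powr_mono) auto
      finally show ?thesis by (auto simp: indicator_def ennreal_mult'[symmetric])
    qed (auto simp: indicator_def)
  qed
  also have "\<dots> = ennreal (T powr p) * (\<integral>\<^sup>+x. ennreal (\<bar>x\<bar> powr -2) * indicator (- {-4..4}) x \<partial>lborel)"
    by (rule nn_integral_cmult) auto
  also have "\<dots> \<le> ennreal (T powr p) * ennreal 1"
    by (intro mult_left_mono nn_integral_far_inverse_square) auto
  finally show ?thesis by simp
qed

section \<open>Cancellation of moments\<close>

text \<open>By induction on \<open>m\<close>: if the present nodes fail to represent the next moment at some point \<open>d\<close>,
  then \<open>d\<close> is added as a node, and the error at \<open>y\<close> is removed with the coefficient \<open>E y / E d\<close>. In terms of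
  measures, a point mass at \<open>y\<close> is replaced by masses at fixed nodes without changing the first \<open>m\<close> moments.\<close>

lemma exists_bounded_interpolation:
  "\<exists>(n::nat) e l B. (\<forall>i<n. 0 \<le> e i \<and> e i \<le> (1::real)) \<and> B \<ge> 0 \<and>
     (\<forall>i<n. \<forall>y\<in>{0..1}. \<bar>l i y\<bar> \<le> B) \<and> (\<forall>k<m. \<forall>y\<in>{0..1}. y ^ k = (\<Sum>i<n. l i y * e i ^ k))"
proof (induction m)
  case 0
  show ?case by (rule exI[of _ 0]) auto
next
  case (Suc m)
  then obtain n :: nat and e :: "nat \<Rightarrow> real" and l B where
    e: "\<And>i. i < n \<Longrightarrow> 0 \<le> e i \<and> e i \<le> 1" and B: "B \<ge> 0"
    and l: "\<And>i y. i < n \<Longrightarrow> y \<in> {0..1} \<Longrightarrow> \<bar>l i y\<bar> \<le> B"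
    and rep: "\<And>k y. k < m \<Longrightarrow> y \<in> {0..1} \<Longrightarrow> y ^ k = (\<Sum>i<n. l i y * e i ^ k)"
    by blast
  define E where "E y = y ^ m - (\<Sum>i<n. l i y * e i ^ m)" for y
  show ?case
  proof (cases "\<forall>y\<in>{0..1}. E y = 0")
    case True
    then have "y ^ k = (\<Sum>i<n. l i y * e i ^ k)" if "k < Suc m" "y \<in> {0..1}" for k y
      using rep[of k y] that unfolding E_def by (cases "k = m") auto
    then show ?thesis using e B l by blast
  next
    case False
    then obtain d where d: "d \<in> {0..1}" "E d \<noteq> 0" by auto
    define r where "r y = E y / E d" for y
    define e' where "e' = e(n := d)"
    define l' where "l' i y = (if i = n then r y else l i y - r y * l i d)" for i y
    have Eb: "\<bar>E y\<bar> \<le> 1 + real n * B" if y: "y \<in> {0..1}" for y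
    proof -
      have "\<bar>\<Sum>i<n. l i y * e i ^ m\<bar> \<le> (\<Sum>i<n. B)"
      proof (rule order_trans[OF sum_abs sum_mono])
        fix i assume "i \<in> {..<n}"
        then have "\<bar>l i y\<bar> * \<bar>e i ^ m\<bar> \<le> B * 1"
          using l[of i y] e[of i] y B by (intro mult_mono) (auto simp: power_le_one)
        then show "\<bar>l i y * e i ^ m\<bar> \<le> B" by (simp add: abs_mult)
      qed
      moreover have "\<bar>y ^ m\<bar> \<le> 1" using y by (auto simp: power_le_one)
      ultimately show ?thesis unfolding E_def by simp
    qed
    define r0 where "r0 = (1 + real n * B) / \<bar>E d\<bar>"
    have r0: "r0 \<ge> 0" unfolding r0_def using B by auto
    have rb: "\<bar>r y\<bar> \<le> r0" if "y \<in> {0..1}" for y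
      using Eb[OF that] d unfolding r_def r0_def abs_divide by (intro divide_right_mono) auto
    have "\<bar>l' i y\<bar> \<le> r0 + (B + r0 * B)" if "i < Suc n" "y \<in> {0..1}" for i y
    proof (cases "i = n")
      case True
      then show ?thesis using rb[OF that(2)] B r0 by (simp add: l'_def add_increasing2)
    next
      case False
      then have i: "i < n" using that by simp
      have "\<bar>l i y - r y * l i d\<bar> \<le> \<bar>l i y\<bar> + \<bar>r y\<bar> * \<bar>l i d\<bar>" unfolding abs_mult[symmetric] by (rule abs_triangle_ineq4)
      also have "\<dots> \<le> B + r0 * B" using l[OF i] that d rb r0 by (intro add_mono mult_mono) auto
      finally show ?thesis using False r0 by (simp add: l'_def)
    qed
    moreover have "y ^ k = (\<Sum>i<Suc n. l' i y * e' i ^ k)" if "k < Suc m" "y \<in> {0..1}" for k y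
    proof -
      have "(\<Sum>i<Suc n. l' i y * e' i ^ k) = (\<Sum>i<n. (l i y - r y * l i d) * e i ^ k) + r y * d ^ k"
        by (simp add: l'_def e'_def)
      also have "(\<Sum>i<n. (l i y - r y * l i d) * e i ^ k) = (\<Sum>i<n. l i y * e i ^ k) - r y * (\<Sum>i<n. l i d * e i ^ k)"
        by (simp add: algebra_simps sum_subtractf sum_distrib_left)
      also have "\<dots> + r y * d ^ k = y ^ k"
      proof (cases "k = m")
        case True
        have "(\<Sum>i<n. l i y * e i ^ m) = y ^ m - E y" "(\<Sum>i<n. l i d * e i ^ m) = d ^ m - E d"
          by (auto simp: E_def)
        then have "(\<Sum>i<n. l i y * e i ^ k) - r y * (\<Sum>i<n. l i d * e i ^ k) + r y * d ^ k
            = y ^ m - E y + r y * E d" unfolding True by (simp only:) (simp add: algebra_simps)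
        also have "r y * E d = E y" using d by (simp add: r_def)
        finally show ?thesis using True by simp
      next
        case False
        then show ?thesis using rep[of k y] rep[of k d] that d by simp
      qed
      finally show ?thesis by simp
    qed
    moreover have "0 \<le> e' i \<and> e' i \<le> 1" if "i < Suc n" for i
      using e[of i] d that by (auto simp: e'_def)
    moreover have "r0 + (B + r0 * B) \<ge> 0" using r0 B by auto
    ultimately show ?thesis by blast
  qed
qed

text \<open>The tail of the binomial series, compared with its value at \<open>|z| = 1/2\<close>.\<close>

lemma binomial_remainder:
  fixes a :: real
  shows "\<exists>C\<ge>0. \<forall>z. \<bar>z\<bar> \<le> 1/2 \<longrightarrow> \<bar>(1 + z) powr a - (\<Sum>k<m. (a gchoose k) * z ^ k)\<bar> \<le> C * \<bar>z\<bar> ^ m"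
proof -
  have "summable (\<lambda>n. (a gchoose n) * (3/4) ^ n)"
    using gen_binomial_real[of "3/4" a] by (auto simp: sums_iff)
  then have "summable (\<lambda>n. norm ((a gchoose n) * (1/2) ^ n))"
    by (rule powser_insidea) auto
  then have s: "summable (\<lambda>n. \<bar>a gchoose (n + m)\<bar> * (1/2) ^ (n + m))"
    by (intro summable_ignore_initial_segment) (simp add: abs_mult power_abs)
  define C where "C = 2 ^ m * (\<Sum>n. \<bar>a gchoose (n + m)\<bar> * (1/2) ^ (n + m))"
  have C: "C \<ge> 0" unfolding C_def using s by (intro mult_nonneg_nonneg suminf_nonneg) auto
  have "\<bar>(1 + z) powr a - (\<Sum>k<m. (a gchoose k) * z ^ k)\<bar> \<le> C * \<bar>z\<bar> ^ m" if z: "\<bar>z\<bar> \<le> 1/2" for z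
  proof -
    have "(\<lambda>n. (a gchoose n) * z ^ n) sums (1 + z) powr a" using z by (intro gen_binomial_real) auto
    then have sm: "(\<lambda>n. (a gchoose (n + m)) * z ^ (n + m)) sums ((1 + z) powr a - (\<Sum>k<m. (a gchoose k) * z ^ k))"
      by (rule sums_split_initial_segment)
    have s2: "summable (\<lambda>n. 2 ^ m * (\<bar>a gchoose (n + m)\<bar> * (1/2) ^ (n + m)) * \<bar>z\<bar> ^ m)"
      using s by (intro summable_mult summable_mult2)
    have "\<bar>(1 + z) powr a - (\<Sum>k<m. (a gchoose k) * z ^ k)\<bar> = norm (\<Sum>n. (a gchoose (n + m)) * z ^ (n + m))"
      using sm by (simp add: sums_iff)
    also have "\<dots> \<le> (\<Sum>n. 2 ^ m * (\<bar>a gchoose (n + m)\<bar> * (1/2) ^ (n + m)) * \<bar>z\<bar> ^ m)"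
    proof (rule norm_suminf_le[OF _ s2])
      fix n
      have "\<bar>z\<bar> ^ n \<le> (1/2) ^ n" using z by (intro power_mono) auto
      then have "\<bar>a gchoose (n + m)\<bar> * (\<bar>z\<bar> ^ n * \<bar>z\<bar> ^ m) \<le> \<bar>a gchoose (n + m)\<bar> * ((1/2) ^ n * \<bar>z\<bar> ^ m)"
        by (intro mult_left_mono mult_right_mono) auto
      then show "norm ((a gchoose (n + m)) * z ^ (n + m)) \<le> 2 ^ m * (\<bar>a gchoose (n + m)\<bar> * (1/2) ^ (n + m)) * \<bar>z\<bar> ^ m"
        by (simp add: abs_mult power_abs power_add power_one_over field_simps)
    qed
    also have "\<dots> = C * \<bar>z\<bar> ^ m"
      unfolding C_def using s by (simp add: suminf_mult suminf_mult2[symmetric] summable_mult)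
    finally show ?thesis .
  qed
  then show ?thesis using C by blast
qed

context riesz_order begin

lemma K_scale:
  assumes "c > 0"
  shows "K (c * x) = c powr - (1 + \<alpha>) * K x"
  unfolding K_def using assms by (simp add: abs_mult powr_mult)

text \<open>Expand \<open>K (x - y) = |x|^(-(1+\<alpha>)) (1 - y/x)^(-(1+\<alpha>))\<close> in powers of \<open>y / x\<close>. The terms of
  order less than \<open>m\<close> involve only moments below \<open>m\<close> and cancel; the remainder is \<open>O (|x|^(-m))\<close>
  relative to the first factor.\<close>

lemma K_interpolation_error:
  fixes n m :: nat
  assumes e: "\<And>i. i < n \<Longrightarrow> 0 \<le> e i \<and> e i \<le> (1::real)" and B: "B \<ge> 0"
    and l: "\<And>i y. i < n \<Longrightarrow> y \<in> {0..1} \<Longrightarrow> \<bar>l i y\<bar> \<le> B"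
    and rep: "\<And>k y. k < m \<Longrightarrow> y \<in> {0..1} \<Longrightarrow> y ^ k = (\<Sum>i<n. l i y * e i ^ k)"
  shows "\<exists>C\<ge>0. \<forall>y\<in>{0..1}. \<forall>x. \<bar>x\<bar> \<ge> 2 \<longrightarrow>
    \<bar>K (x - y) - (\<Sum>i<n. l i y * K (x - e i))\<bar> \<le> C * \<bar>x\<bar> powr - (1 + \<alpha> + real m)"
proof -
  obtain C where C: "C \<ge> 0"
    "\<And>z. \<bar>z\<bar> \<le> 1/2 \<Longrightarrow> \<bar>(1 + z) powr - (1 + \<alpha>) - (\<Sum>k<m. (- (1 + \<alpha>) gchoose k) * z ^ k)\<bar> \<le> C * \<bar>z\<bar> ^ m"
    using binomial_remainder[of "- (1 + \<alpha>)" m] by auto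
  have "\<bar>K (x - y) - (\<Sum>i<n. l i y * K (x - e i))\<bar> \<le> (C * (1 + real n * B)) * \<bar>x\<bar> powr - (1 + \<alpha> + real m)"
    if y: "y \<in> {0..1}" and x: "\<bar>x\<bar> \<ge> 2" for x y
  proof -
    define T where "T u = \<bar>x\<bar> powr - (1 + \<alpha>) * (\<Sum>k<m. (- (1 + \<alpha>) gchoose k) * (- u / x) ^ k)" for u
    have rem: "\<bar>K (x - u) - T u\<bar> \<le> C * \<bar>x\<bar> powr - (1 + \<alpha> + real m)" if u: "u \<in> {0..1}" for u
    proof -
      have z: "\<bar>- u / x\<bar> \<le> 1/2" using u x by (auto simp: abs_divide field_simps)
      have "x \<noteq> 0" using x by auto
      then have "x - u = x * (1 + - u / x)" by (simp add: right_diff_distrib)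
      then have "K (x - u) = \<bar>x * (1 + - u / x)\<bar> powr - (1 + \<alpha>)"
        unfolding K_def by metis
      also have "\<bar>x * (1 + - u / x)\<bar> = \<bar>x\<bar> * (1 + - u / x)"
      proof -
        have "0 \<le> 1 + - u / x" using z unfolding abs_le_iff by linarith
        then show ?thesis unfolding abs_mult by (simp only: abs_of_nonneg)
      qed
      also have "(\<bar>x\<bar> * (1 + - u / x)) powr - (1 + \<alpha>) = \<bar>x\<bar> powr - (1 + \<alpha>) * (1 + - u / x) powr - (1 + \<alpha>)"
        by (rule powr_mult)
      finally have "\<bar>K (x - u) - T u\<bar> = \<bar>x\<bar> powr - (1 + \<alpha>) *
         \<bar>(1 + - u / x) powr - (1 + \<alpha>) - (\<Sum>k<m. (- (1 + \<alpha>) gchoose k) * (- u / x) ^ k)\<bar>"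
        unfolding T_def by (simp add: right_diff_distrib[symmetric] abs_mult)
      also have "\<dots> \<le> \<bar>x\<bar> powr - (1 + \<alpha>) * (C * \<bar>- u / x\<bar> ^ m)"
        by (intro mult_left_mono C(2) z) auto
      also have "\<dots> \<le> \<bar>x\<bar> powr - (1 + \<alpha>) * (C * (1 / \<bar>x\<bar>) ^ m)"
        using u C(1) x by (intro mult_left_mono power_mono) (auto simp: abs_divide divide_right_mono)
      also have "(1 / \<bar>x\<bar>) ^ m = \<bar>x\<bar> powr - real m"
        using x by (simp add: powr_minus powr_realpow power_one_over field_simps)
      also have "\<bar>x\<bar> powr - (1 + \<alpha>) * (C * \<bar>x\<bar> powr - real m) = C * \<bar>x\<bar> powr - (1 + \<alpha> + real m)"
        using x by (simp add: powr_add[symmetric] algebra_simps)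
      finally show ?thesis .
    qed
    have Trep: "T y = (\<Sum>i<n. l i y * T (e i))"
    proof -
      define v where "v = - 1 / x"
      have pw: "(- u / x) ^ k = v ^ k * u ^ k" for u k
        unfolding power_mult_distrib[symmetric] v_def by simp
      have "(\<Sum>i<n. l i y * T (e i)) = (\<Sum>i<n. \<Sum>k<m. \<bar>x\<bar> powr - (1 + \<alpha>) * ((- (1 + \<alpha>) gchoose k) * v ^ k) * (l i y * e i ^ k))"
        unfolding T_def sum_distrib_left pw by (intro sum.cong refl) (simp only: mult_ac)
      also have "\<dots> = (\<Sum>k<m. \<Sum>i<n. \<bar>x\<bar> powr - (1 + \<alpha>) * ((- (1 + \<alpha>) gchoose k) * v ^ k) * (l i y * e i ^ k))"
        by (rule sum.swap)
      also have "\<dots> = (\<Sum>k<m. \<bar>x\<bar> powr - (1 + \<alpha>) * ((- (1 + \<alpha>) gchoose k) * v ^ k) * y ^ k)"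
        by (rule sum.cong) (auto simp: rep[OF _ y] sum_distrib_left)
      also have "\<dots> = T y"
        unfolding T_def sum_distrib_left pw by (intro sum.cong refl) (simp only: mult_ac)
      finally show ?thesis by simp
    qed
    define P where "P = C * \<bar>x\<bar> powr - (1 + \<alpha> + real m)"
    have P: "P \<ge> 0" unfolding P_def using C by auto
    have "K (x - y) - (\<Sum>i<n. l i y * K (x - e i)) = (K (x - y) - T y) - (\<Sum>i<n. l i y * (K (x - e i) - T (e i)))"
      unfolding Trep by (simp add: algebra_simps sum_subtractf)
    also have "\<bar>\<dots>\<bar> \<le> \<bar>K (x - y) - T y\<bar> + \<bar>\<Sum>i<n. l i y * (K (x - e i) - T (e i))\<bar>"
      by (rule abs_triangle_ineq4)
    also have "\<bar>\<Sum>i<n. l i y * (K (x - e i) - T (e i))\<bar> \<le> (\<Sum>i<n. B * P)"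
    proof (rule order_trans[OF sum_abs sum_mono])
      fix i assume "i \<in> {..<n}"
      then show "\<bar>l i y * (K (x - e i) - T (e i))\<bar> \<le> B * P"
        using l[of i y] rem[of "e i"] e[of i] y B unfolding abs_mult P_def by (intro mult_mono) auto
    qed
    also have "\<bar>K (x - y) - T y\<bar> \<le> P" using rem[OF y] by (simp add: P_def)
    finally show ?thesis unfolding P_def by (simp add: algebra_simps)
  qed
  moreover have "C * (1 + real n * B) \<ge> 0" using C B by auto
  ultimately show ?thesis by blast
qed

text \<open>By \<open>atom_combination_mvt\<close> the difference is the corresponding difference for \<open>K\<close> at a nearby
  point, so the estimate carries over with a constant that does not depend on the width.\<close>

lemma atom_interpolation_error:
  fixes n m :: nat
  assumes "\<And>i. i < n \<Longrightarrow> 0 \<le> e i \<and> e i \<le> (1::real)" and "B \<ge> 0"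
    and "\<And>i y. i < n \<Longrightarrow> y \<in> {0..1} \<Longrightarrow> \<bar>l i y\<bar> \<le> B"
    and "\<And>k y. k < m \<Longrightarrow> y \<in> {0..1} \<Longrightarrow> y ^ k = (\<Sum>i<n. l i y * e i ^ k)"
  shows "\<exists>C\<ge>0. \<forall>y\<in>{0..1}. \<forall>w\<in>{0<..1}. \<forall>x. \<bar>x\<bar> \<ge> 3 \<longrightarrow>
    \<bar>atom w (x - y) - (\<Sum>i<n. l i y * atom w (x - e i))\<bar> \<le> C * \<bar>x\<bar> powr - (1 + \<alpha> + real m)"
proof -
  obtain C where C: "C \<ge> 0" "\<And>y x. y \<in> {0..1} \<Longrightarrow> \<bar>x\<bar> \<ge> 2 \<Longrightarrow>
    \<bar>K (x - y) - (\<Sum>i<n. l i y * K (x - e i))\<bar> \<le> C * \<bar>x\<bar> powr - (1 + \<alpha> + real m)"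
    using K_interpolation_error[OF assms] by blast
  have "\<bar>atom w (x - y) - (\<Sum>i<n. l i y * atom w (x - e i))\<bar> \<le> (C * 2 powr (1 + \<alpha> + real m)) * \<bar>x\<bar> powr - (1 + \<alpha> + real m)"
    if y: "y \<in> {0..1}" and w: "w \<in> {0<..1}" and x: "\<bar>x\<bar> \<ge> 3" for x y w
  proof -
    \<comment> \<open>The point \<open>y\<close> and the nodes are combined into one family, with \<open>y\<close> as its last member.\<close>
    define Y where "Y j = (if j < n then e j else y)" for j
    define L where "L j = (if j < n then - l j y else 1)" for j
    have "\<exists>\<xi>. \<bar>\<xi>\<bar> < w \<and> (\<Sum>j\<in>{..<Suc n}. L j * atom w (x - Y j)) = (\<Sum>j\<in>{..<Suc n}. L j * K (x - Y j + \<xi>))"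
    proof (rule atom_combination_mvt)
      fix j assume "j \<in> {..<Suc n}"
      have "0 \<le> Y j \<and> Y j \<le> 1" using y assms(1) by (auto simp: Y_def)
      then show "\<bar>x - Y j\<bar> > w" using x w by auto
    qed (use w in auto)
    then obtain \<xi> where \<xi>: "\<bar>\<xi>\<bar> < w"
      "(\<Sum>j<Suc n. L j * atom w (x - Y j)) = (\<Sum>j<Suc n. L j * K (x - Y j + \<xi>))" by blast
    have "atom w (x - y) - (\<Sum>i<n. l i y * atom w (x - e i)) = (\<Sum>j<Suc n. L j * atom w (x - Y j))"
      by (simp add: L_def Y_def sum_negf)
    also have "\<dots> = K ((x + \<xi>) - y) - (\<Sum>i<n. l i y * K ((x + \<xi>) - e i))"
      unfolding \<xi>(2) by (simp add: L_def Y_def sum_negf algebra_simps)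
    also have "\<bar>\<dots>\<bar> \<le> C * \<bar>x + \<xi>\<bar> powr - (1 + \<alpha> + real m)"
      using x \<xi> w by (intro C y) auto
    also have "\<dots> \<le> C * (\<bar>x\<bar> / 2) powr - (1 + \<alpha> + real m)"
    proof (intro mult_left_mono powr_mono2')
      have "\<bar>x\<bar> \<le> \<bar>x + \<xi>\<bar> + \<bar>\<xi>\<bar>" by linarith
      then show "\<bar>x\<bar> / 2 \<le> \<bar>x + \<xi>\<bar>" using x \<xi>(1) w by simp
    qed (use x C \<alpha>_pos in auto)
    also have "(\<bar>x\<bar> / 2) powr - (1 + \<alpha> + real m) = 2 powr (1 + \<alpha> + real m) * \<bar>x\<bar> powr - (1 + \<alpha> + real m)"
      by (rule divide_powr_minus) auto
    finally show ?thesis by simp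
  qed
  moreover have "C * 2 powr (1 + \<alpha> + real m) \<ge> 0" using C by auto
  ultimately show ?thesis by blast
qed

end

section \<open>The size of the charge in a cell\<close>

lemma nn_integral_even_le:
  fixes f :: "real \<Rightarrow> ennreal"
  assumes [measurable]: "f \<in> borel_measurable borel" and "\<And>x. f (- x) = f x"
  shows "(\<integral>\<^sup>+x. f x * indicator {-Y..Y} x \<partial>lborel) \<le> 2 * (\<integral>\<^sup>+x. f x * indicator {0..Y} x \<partial>lborel)"
proof -
  have "(\<integral>\<^sup>+x. f x * indicator {-Y..Y} x \<partial>lborel)
     \<le> (\<integral>\<^sup>+x. f x * indicator {0..Y} x + f (- x) * indicator {0..Y} (- x) \<partial>lborel)"
    by (rule nn_integral_mono) (auto simp: indicator_def assms(2))
  also have "\<dots> = (\<integral>\<^sup>+x. f x * indicator {0..Y} x \<partial>lborel) + (\<integral>\<^sup>+x. f (- x) * indicator {0..Y} (- x) \<partial>lborel)"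
    by (rule nn_integral_add) auto
  also have "(\<integral>\<^sup>+x. f (- x) * indicator {0..Y} (- x) \<partial>lborel) = (\<integral>\<^sup>+x. f x * indicator {0..Y} x \<partial>lborel)"
    using nn_integral_real_affine[of "\<lambda>x. f x * indicator {0..Y} x" "-1" 0] by simp
  finally show ?thesis by (simp add: mult_2)
qed

text \<open>The function \<open>1 - (R / |y|)^s\<close> on the unit cell is \<open>1 - |z|^(-s)\<close> on a cell of length \<open>1 / R\<close>, on which
  the gain in the integral is a fixed amount. Scaled back, the gain is of order \<open>R\<close>, while the
  additional term, which will account for the charges in the other cells, is of order \<open>R^s\<close>. As \<open>s > 1\<close>, a
  small \<open>R\<close> leaves a net gain.\<close>

lemma exists_radius_cell_integral:
  fixes s p Z g S :: real
  assumes s: "1 < s" and p: "0 < p" "p \<le> 1/4" and Z: "Z \<ge> 1" and g: "g > 0" and S: "S \<ge> 0"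
    and small: "(\<integral>\<^sup>+z. ennreal (\<bar>1 - z powr - s\<bar> powr p) * indicator {0..Z} z \<partial>lborel) \<le> ennreal (Z - g)"
  shows "\<exists>R g'. 0 < R \<and> R \<le> 1 \<and> 0 < g' \<and> g' \<le> 1 \<and>
    (\<integral>\<^sup>+y. ennreal (\<bar>1 - R powr s * \<bar>y\<bar> powr - s\<bar> powr p + R powr s * S * \<bar>1 - R powr s * \<bar>y\<bar> powr - s\<bar> powr (p - 1))
        * indicator {-1/2..1/2} y \<partial>lborel) \<le> ennreal (1 - g')"
proof -
  \<comment> \<open>The difference \<open>Z - g\<close> is made nonnegative, because negative reals become 0 as extended
    nonnegative ones.\<close>
  define g0 where "g0 = min g Z"
  have g0: "g0 > 0" "g0 \<le> Z" using g Z by (auto simp: g0_def)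
  have small0: "(\<integral>\<^sup>+z. ennreal (\<bar>1 - z powr - s\<bar> powr p) * indicator {0..Z} z \<partial>lborel) \<le> ennreal (Z - g0)"
    by (rule order_trans[OF small]) (auto simp: g0_def intro: ennreal_leI)
  define Q where "Q = S * (4 / p + 2)"
  have Q: "Q \<ge> 0" unfolding Q_def using S p by auto
  define R where "R = min (1 / (4 * Z)) ((g0 / (Q + 1)) powr (1 / (s - 1)))"
  have R: "0 < R" "R \<le> 1 / (4 * Z)" "R powr (s - 1) * Q \<le> g0"
  proof -
    show "0 < R" "R \<le> 1 / (4 * Z)" unfolding R_def using g0 Q Z by auto
    have "R powr (s - 1) \<le> ((g0 / (Q + 1)) powr (1 / (s - 1))) powr (s - 1)"
      using \<open>0 < R\<close> s by (intro powr_mono2) (auto simp: R_def)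
    also have "\<dots> = g0 / (Q + 1)" using s g0 Q by (simp add: powr_powr)
    finally have "R powr (s - 1) * Q \<le> g0 / (Q + 1) * Q" using Q by (intro mult_right_mono)
    also have "\<dots> \<le> g0" using Q g0 by (simp add: field_simps)
    finally show "R powr (s - 1) * Q \<le> g0" .
  qed
  have "1 / (4 * Z) \<le> 1 / (4 * 1)" using Z by (intro divide_left_mono) auto
  then have R1: "R \<le> 1/4" using R(2) by simp
  \<comment> \<open>The half-length of the rescaled cell.\<close>
  define Y where "Y = 1 / (2 * R)"
  have "Z * (2 * R) \<le> Z * (2 * (1 / (4 * Z)))" using R(2) Z by (intro mult_left_mono) auto
  also have "\<dots> \<le> 1" using Z by simp
  finally have RZ: "Z * (2 * R) \<le> 1" .
  have Y: "Y \<ge> Z" "Y \<ge> 2" "2 * R * Y = 1"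
  proof -
    show "Y \<ge> Z" unfolding Y_def using R(1) RZ by (subst pos_le_divide_eq) auto
    show "Y \<ge> 2" unfolding Y_def using R(1) R1 by (subst pos_le_divide_eq) auto
    show "2 * R * Y = 1" unfolding Y_def using R(1) by simp
  qed
  define c where "c = R powr s * S"
  have c: "c \<ge> 0" using S by (simp add: c_def)
  define f where "f z = \<bar>1 - \<bar>z\<bar> powr - s\<bar>" for z :: real
  have fm [measurable]: "f \<in> borel_measurable borel" unfolding f_def by measurable
  have I1: "(\<integral>\<^sup>+z. ennreal (f z powr p) * indicator {0..Y} z \<partial>lborel) \<le> ennreal (Y - g0)"
  proof -
    have "(\<integral>\<^sup>+z. ennreal (f z powr p) * indicator {0..Y} z \<partial>lborel)
      \<le> (\<integral>\<^sup>+z. ennreal (\<bar>1 - z powr - s\<bar> powr p) * indicator {0..Z} z + indicator {Z..Y} z \<partial>lborel)"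
    proof (rule nn_integral_mono)
      fix z :: real
      show "ennreal (f z powr p) * indicator {0..Y} z
        \<le> ennreal (\<bar>1 - z powr - s\<bar> powr p) * indicator {0..Z} z + indicator {Z..Y} z"
      proof (cases "z \<in> {0..Z}")
        case False
        show ?thesis
        proof (cases "z \<in> {Z..Y}")
          case True
          have "z powr - s \<le> 1" using True Z s powr_mono[of "-s" 0 z] by auto
          then have "f z powr p \<le> 1 powr p" unfolding f_def using True Z p by (intro powr_mono2) auto
          then show ?thesis using True False Z by (auto simp: indicator_def)
        qed (use False Z in \<open>auto simp: indicator_def\<close>)
      qed (auto simp: indicator_def f_def)
    qed
    also have "\<dots> = (\<integral>\<^sup>+z. ennreal (\<bar>1 - z powr - s\<bar> powr p) * indicator {0..Z} z \<partial>lborel) + (\<integral>\<^sup>+z. indicator {Z..Y} z \<partial>lborel)"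
      by (rule nn_integral_add) auto
    also have "\<dots> \<le> ennreal (Z - g0) + ennreal (Y - Z)"
      using Y by (intro add_mono small0) auto
    also have "\<dots> = ennreal (Y - g0)" using g0 Y by (subst ennreal_plus[symmetric]) auto
    finally show ?thesis .
  qed
  have I2: "(\<integral>\<^sup>+z. ennreal (f z powr (p - 1)) * indicator {0..Y} z \<partial>lborel) \<le> ennreal (4 / p + 2 * Y)"
  proof -
    define h where "h z = 2 * (if z \<in> {0..2} then \<bar>z - 1\<bar> powr (p - 1) else 0) + 2" for z :: real
    have "((\<lambda>z. \<bar>z - 1\<bar> powr (p - 1)) has_integral (2 / p)) {0..2}"
      using has_integral_abs_powr[of 0 2 "p - 1" 1] p by simp
    then have "((\<lambda>z. if z \<in> {0..2} then \<bar>z - 1\<bar> powr (p - 1) else 0) has_integral (2 / p)) {0..Y}"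
      using Y by (subst has_integral_restrict) auto
    moreover have "((\<lambda>z::real. 2::real) has_integral 2 * Y) {0..Y}"
      using has_integral_const_real[of "2::real" 0 Y] Y by (simp add: mult.commute)
    ultimately have "(h has_integral (2 * (2 / p) + 2 * Y)) {0..Y}"
      unfolding h_def by (intro has_integral_add has_integral_mult_right)
    then have "(\<integral>\<^sup>+z. ennreal (f z powr (p - 1)) * indicator {0..Y} z \<partial>lborel) \<le> ennreal (2 * (2 / p) + 2 * Y)"
    proof (rule nn_integral_le_of_has_integral[where N = "{0, 1}"])
      fix z assume z: "z \<in> {0..Y} - {0, 1}"
      have low: "\<bar>z - 1\<bar> / max 1 z \<le> f z"
        unfolding f_def using z s abs_one_minus_powr_ge[of z s] by auto
      have "f z powr (p - 1) \<le> h z"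
      proof (cases "z \<le> 2")
        case True
        have "\<bar>z - 1\<bar> / 2 \<le> \<bar>z - 1\<bar> / max 1 z" using True z by (intro divide_left_mono) auto
        then have "\<bar>z - 1\<bar> / 2 \<le> f z" using low by (rule order_trans)
        then have "f z powr - (1 - p) \<le> (\<bar>z - 1\<bar> / 2) powr - (1 - p)"
          using z p by (intro powr_mono2') auto
        also have "\<dots> = 2 powr (1 - p) * \<bar>z - 1\<bar> powr - (1 - p)" by (rule divide_powr_minus) auto
        also have "\<dots> \<le> 2 * \<bar>z - 1\<bar> powr - (1 - p)"
          using p powr_mono[of "1 - p" 1 "2::real"] by (intro mult_right_mono) auto
        finally show ?thesis using True z by (simp add: h_def)
      next
        case False
        have "1/2 \<le> \<bar>z - 1\<bar> / max 1 z" using False by (auto simp: field_simps max_def)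
        then have "1/2 \<le> f z" using low by (rule order_trans)
        then have "f z powr - (1 - p) \<le> (1/2) powr - (1 - p)" using p by (intro powr_mono2') auto
        also have "\<dots> = 2 powr (1 - p)" using divide_powr_minus[of 1 2 "1 - p"] by simp
        also have "\<dots> \<le> 2" using p powr_mono[of "1 - p" 1 "2::real"] by simp
        finally show ?thesis using False by (simp add: h_def)
      qed
      then show "0 \<le> f z powr (p - 1) \<and> f z powr (p - 1) \<le> h z" by simp
    qed simp
    then show ?thesis by simp
  qed
  define H where "H z = ennreal (f z powr p + c * f z powr (p - 1))" for z
  have Hm [measurable]: "H \<in> borel_measurable borel" unfolding H_def by measurable
  have I3: "(\<integral>\<^sup>+z. H z * indicator {0..Y} z \<partial>lborel) \<le> ennreal (Y - g0 + c * (4 / p + 2 * Y))"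
  proof -
    have "(\<integral>\<^sup>+z. H z * indicator {0..Y} z \<partial>lborel) =
       (\<integral>\<^sup>+z. ennreal (f z powr p) * indicator {0..Y} z + ennreal c * (ennreal (f z powr (p - 1)) * indicator {0..Y} z) \<partial>lborel)"
      unfolding H_def using c
      by (intro nn_integral_cong) (auto simp: ennreal_mult indicator_def)
    also have "\<dots> = (\<integral>\<^sup>+z. ennreal (f z powr p) * indicator {0..Y} z \<partial>lborel)
       + ennreal c * (\<integral>\<^sup>+z. ennreal (f z powr (p - 1)) * indicator {0..Y} z \<partial>lborel)"
      by (subst nn_integral_add) (auto simp: nn_integral_cmult)
    also have "\<dots> \<le> ennreal (Y - g0) + ennreal c * ennreal (4 / p + 2 * Y)"
      by (intro add_mono I1 mult_left_mono I2) auto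
    also have "\<dots> = ennreal (Y - g0 + c * (4 / p + 2 * Y))"
      using c p Y g0 by (subst ennreal_plus) (auto simp: ennreal_mult)
    finally show ?thesis .
  qed
  have "(\<integral>\<^sup>+y. ennreal (\<bar>1 - R powr s * \<bar>y\<bar> powr - s\<bar> powr p + R powr s * S * \<bar>1 - R powr s * \<bar>y\<bar> powr - s\<bar> powr (p - 1))
        * indicator {-1/2..1/2} y \<partial>lborel)
      = ennreal R * (\<integral>\<^sup>+z. H z * indicator {-Y..Y} z \<partial>lborel)"
  proof (subst nn_integral_real_affine[where c = R and t = 0])
    have "ennreal (\<bar>1 - R powr s * \<bar>0 + R * z\<bar> powr - s\<bar> powr p + R powr s * S * \<bar>1 - R powr s * \<bar>0 + R * z\<bar> powr - s\<bar> powr (p - 1))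
      * indicator {-1/2..1/2} (0 + R * z) = H z * indicator {-Y..Y} z" for z
    proof -
      have "R powr s * \<bar>0 + R * z\<bar> powr - s = \<bar>z\<bar> powr - s"
        using R(1) by (simp add: abs_mult powr_mult powr_minus field_simps)
      moreover have "indicator {-1/2..1/2} (0 + R * z) = (indicator {-Y..Y} z :: ennreal)"
        using R(1) unfolding Y_def by (auto simp: indicator_def field_simps)
      ultimately show ?thesis by (simp add: H_def f_def c_def)
    qed
    then show "ennreal \<bar>R\<bar> * (\<integral>\<^sup>+x. ennreal (\<bar>1 - R powr s * \<bar>0 + R * x\<bar> powr - s\<bar> powr p + R powr s * S * \<bar>1 - R powr s * \<bar>0 + R * x\<bar> powr - s\<bar> powr (p - 1))
      * indicator {-1/2..1/2} (0 + R * x) \<partial>lborel) = ennreal R * (\<integral>\<^sup>+z. H z * indicator {-Y..Y} z \<partial>lborel)"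
      using R(1) by simp
  qed (use R in auto)
  also have "\<dots> \<le> ennreal R * (2 * ennreal (Y - g0 + c * (4 / p + 2 * Y)))"
    by (intro mult_left_mono order_trans[OF nn_integral_even_le] mult_left_mono[OF I3])
       (auto simp: H_def f_def)
  also have "\<dots> = ennreal (R * (2 * (Y - g0 + c * (4 / p + 2 * Y))))"
  proof -
    have *: "ennreal R * (2 * ennreal V) = ennreal (R * (2 * V))" if "V \<ge> 0" for V
      using R(1) that by (simp add: ennreal_mult)
    have "Y - g0 + c * (4 / p + 2 * Y) \<ge> 0" using c p Y g0 by simp
    then show ?thesis by (rule *)
  qed
  also have "\<dots> \<le> ennreal (1 - R * g0)"
  proof (rule ennreal_leI)
    have "R * (2 * (Y - g0 + c * (4 / p + 2 * Y))) = 1 - 2 * R * g0 + c * (8 * R / p + 2)"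
      using Y(3) by (simp add: algebra_simps)
    also have "c * (8 * R / p + 2) \<le> c * (4 / p + 2)"
      using c R1 p by (intro mult_left_mono add_right_mono divide_right_mono) auto
    also have "c * (4 / p + 2) = R * (R powr (s - 1) * Q)"
    proof -
      have "R powr s = R powr 1 * R powr (s - 1)" unfolding powr_add[symmetric] by simp
      then show ?thesis unfolding c_def Q_def using R(1) by simp
    qed
    also have "\<dots> \<le> R * g0" using R by (intro mult_left_mono) auto
    finally show "R * (2 * (Y - g0 + c * (4 / p + 2 * Y))) \<le> 1 - R * g0" by (simp add: algebra_simps)
  qed
  finally have fin: "(\<integral>\<^sup>+y. ennreal (\<bar>1 - R powr s * \<bar>y\<bar> powr - s\<bar> powr p + R powr s * S * \<bar>1 - R powr s * \<bar>y\<bar> powr - s\<bar> powr (p - 1))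
        * indicator {-1/2..1/2} y \<partial>lborel) \<le> ennreal (1 - R * g0)" .
  have "R * g0 \<le> 1 / (4 * Z) * Z" using R g0 Z by (intro mult_mono) auto
  then have "R * g0 \<le> 1" using Z by simp
  then show ?thesis using fin R(1) R1 g0 by (intro exI[of _ R] exI[of _ "R * g0"]) auto
qed

section \<open>Clusters of atoms\<close>

text \<open>Bernoulli's inequality: \<open>(1 + t)^p \<le> 1 + t\<close>. The perturbation \<open>\<rho>\<close> enters linearly, so that
  a bounded perturbation can be integrated against \<open>|a|^(p-1)\<close>.\<close>

lemma abs_diff_powr_le_add:
  fixes a \<rho> p :: real
  assumes "0 < p" "p \<le> 1" "a \<noteq> 0" "\<rho> \<ge> 0"
  shows "\<bar>a - \<rho>\<bar> powr p \<le> \<bar>a\<bar> powr p + \<rho> * \<bar>a\<bar> powr (p - 1)"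
proof -
  define t where "t = \<rho> / \<bar>a\<bar>"
  have t: "t \<ge> 0" "\<rho> = \<bar>a\<bar> * t" using assms by (auto simp: t_def)
  have "\<bar>a - \<rho>\<bar> \<le> \<bar>a\<bar> + \<rho>" using assms(4) by linarith
  then have "\<bar>a - \<rho>\<bar> \<le> \<bar>a\<bar> * (1 + t)" using t(2) by (simp add: distrib_left)
  then have "\<bar>a - \<rho>\<bar> powr p \<le> (\<bar>a\<bar> * (1 + t)) powr p"
    using assms by (intro powr_mono2) auto
  also have "\<dots> = \<bar>a\<bar> powr p * (1 + t) powr p" by (rule powr_mult)
  also have "\<dots> \<le> \<bar>a\<bar> powr p * (1 + t)"
    using powr_mono[of p 1 "1 + t"] assms t by (intro mult_left_mono) auto
  also have "\<dots> = \<bar>a\<bar> powr p + t * (\<bar>a\<bar> powr p)" by (simp add: algebra_simps)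
  also have "\<bar>a\<bar> powr p = \<bar>a\<bar> powr 1 * \<bar>a\<bar> powr (p - 1)" unfolding powr_add[symmetric] by simp
  also have "t * (\<bar>a\<bar> powr 1 * \<bar>a\<bar> powr (p - 1)) = \<rho> * \<bar>a\<bar> powr (p - 1)" using t(2) by simp
  finally show ?thesis using assms by (simp add: powr_diff)
qed

context riesz_order begin

lemma K_measurable [measurable]: "K \<in> borel_measurable borel"
  unfolding K_def by measurable

lemma atom_measurable [measurable]: "atom w \<in> borel_measurable borel"
  unfolding atom_def by measurable

lemma K_le_inverse_square:
  assumes "u \<noteq> 0" "\<bar>u\<bar> \<le> 6"
  shows "K u \<le> 6 * \<bar>u\<bar> powr -2"
proof -
  have "K u = \<bar>u\<bar> powr (1 - \<alpha>) * \<bar>u\<bar> powr -2"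
    unfolding K_def powr_add[symmetric] by simp
  also have "\<bar>u\<bar> powr (1 - \<alpha>) \<le> 6 powr (1 - \<alpha>)" using assms \<alpha>_less by (intro powr_mono2) auto
  also have "(6::real) powr (1 - \<alpha>) \<le> 6" using \<alpha>_pos powr_mono[of "1 - \<alpha>" 1 "6::real"] by simp
  finally show ?thesis by (simp add: mult_right_mono)
qed

definition cluster :: "nat \<Rightarrow> (nat \<Rightarrow> real) \<Rightarrow> (nat \<Rightarrow> real) \<Rightarrow> real \<Rightarrow> real \<Rightarrow> real" where
  "cluster n c b w x = (\<Sum>i<n. c i * atom w (x - b i))"

lemma cluster_measurable [measurable]: "cluster n c b w \<in> borel_measurable borel"
  unfolding cluster_def[abs_def] by measurable

text \<open>Uniformity in the width is the point of both estimates. Near the centres, the modulus of continuity in the \<open>p\<close>-th mean comes from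
  \<open>atom_translate_le\<close>. Far away, smallness in \<open>h\<close> and decay in \<open>x\<close> are available separately, and their geometric mean has both; this
  halves the exponents, whence \<open>M p \<ge> 4\<close> and not only \<open>M p \<ge> 2\<close>.\<close>

lemma cluster_bounds:
  fixes n :: nat and c b :: "nat \<Rightarrow> real"
  assumes b: "\<And>i. i < n \<Longrightarrow> 0 \<le> b i \<and> b i \<le> 1"
    and p: "0 < p" "p \<le> 1/4" and M: "M * p \<ge> 4" and T: "T \<ge> 0"
    and far: "\<And>w x. w \<in> {0<..1} \<Longrightarrow> \<bar>x\<bar> \<ge> 3 \<Longrightarrow> \<bar>cluster n c b w x\<bar> \<le> T * \<bar>x\<bar> powr - M"
  shows "\<exists>C>0. \<forall>w\<in>{0<..1}.
     (\<forall>h. \<bar>h\<bar> \<le> 1 \<longrightarrow> (\<integral>\<^sup>+x. ennreal (\<bar>cluster n c b w (x + h) - cluster n c b w x\<bar> powr p) \<partial>lborel)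
        \<le> ennreal (C * \<bar>h\<bar> powr ((1 - \<alpha>) * p / 2))) \<and>
     (\<forall>x. \<bar>cluster n c b w x\<bar> \<le> C * w powr -2 / (1 + x\<^sup>2))"
proof -
  have Mge: "M \<ge> 2"
  proof (rule ccontr)
    assume "\<not> M \<ge> 2"
    then have "M * p \<le> 2 * p" using p by (intro mult_right_mono) auto
    then show False using M p by linarith
  qed
  define A where "A = (\<Sum>i<n. \<bar>c i\<bar>)"
  have A: "A \<ge> 0" unfolding A_def by (intro sum_nonneg) auto
  define d where "d h = \<bar>h\<bar> powr (1 - \<alpha>)" for h :: real
  define C1 where "C1 = 24 * (2 * (\<Sum>i<n. (\<bar>c i\<bar> * (128 * atom_const)) powr p))"
  define C2 where "C2 = (256 * atom_const * A * (2 * T * 2 powr M)) powr (p / 2)"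
  define C3 where "C3 = 17 * (A * atom_const) + 2 * T"
  define C where "C = C1 + C2 + C3 + 1"
  have C0: "C1 \<ge> 0" "C2 \<ge> 0" "C3 \<ge> 0" unfolding C1_def C2_def C3_def using A T atom_const_pos
    by (auto intro!: sum_nonneg)
  have P3: "\<bar>cluster n c b w x\<bar> \<le> C * w powr -2 / (1 + x\<^sup>2)" if w: "w \<in> {0<..1}" for w x
  proof -
    have w1: "1 \<le> w powr -2" using powr_mono2'[of "-2" w 1] w by auto
    have "\<bar>cluster n c b w x\<bar> \<le> C3 * w powr -2 / (1 + x\<^sup>2)"
    proof (cases "\<bar>x\<bar> \<le> 4")
      case True
      have "\<bar>cluster n c b w x\<bar> \<le> (\<Sum>i<n. \<bar>c i\<bar> * (atom_const * w powr -2))"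
        unfolding cluster_def
      proof (rule order_trans[OF sum_abs sum_mono])
        fix i
        have "\<bar>atom w (x - b i)\<bar> \<le> atom_const * w powr - (1 + \<alpha>)" using w by (intro atom_le_width) auto
        also have "\<dots> \<le> atom_const * w powr -2" using w \<alpha>_less atom_const_pos by (intro mult_left_mono powr_mono') auto
        finally show "\<bar>c i * atom w (x - b i)\<bar> \<le> \<bar>c i\<bar> * (atom_const * w powr -2)"
          unfolding abs_mult by (intro mult_left_mono) auto
      qed
      also have "\<dots> = A * atom_const * w powr -2" unfolding A_def by (simp add: sum_distrib_right mult.assoc)
      also have "\<dots> \<le> A * atom_const * w powr -2 * (17 / (1 + x\<^sup>2))"
      proof -
        have "x\<^sup>2 \<le> 4\<^sup>2" using True by (intro abs_le_square_iff[THEN iffD1]) auto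
        then have "1 \<le> 17 / (1 + x\<^sup>2)" by (simp add: field_simps add_pos_nonneg)
        then show ?thesis using A atom_const_pos mult_left_mono[of 1 "17 / (1 + x\<^sup>2)" "A * atom_const * w powr -2"] by simp
      qed
      also have "\<dots> \<le> C3 * w powr -2 / (1 + x\<^sup>2)"
        unfolding C3_def using T by (simp add: field_simps add_pos_nonneg)
      finally show ?thesis .
    next
      case False
      have "\<bar>cluster n c b w x\<bar> \<le> T * \<bar>x\<bar> powr - M" using False w by (intro far) auto
      also have "\<dots> \<le> T * \<bar>x\<bar> powr -2" using False Mge T by (intro mult_left_mono powr_mono) auto
      also have "\<bar>x\<bar> powr -2 = 1 / x\<^sup>2" using False by (simp add: powr_minus powr_numeral field_simps)
      also have "1 / x\<^sup>2 \<le> 2 / (1 + x\<^sup>2)"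
      proof -
        have "1\<^sup>2 \<le> x\<^sup>2" using False by (intro abs_le_square_iff[THEN iffD1]) auto
        then show ?thesis using False by (simp add: field_simps add_pos_nonneg)
      qed
      also have "T * (2 / (1 + x\<^sup>2)) \<le> C3 * (1 / (1 + x\<^sup>2))"
        unfolding C3_def using T A atom_const_pos by (simp add: field_simps add_pos_nonneg)
      also have "\<dots> \<le> C3 * (w powr -2 / (1 + x\<^sup>2))"
        using w1 C0 by (intro mult_left_mono divide_right_mono) auto
      finally show ?thesis using T by (simp add: mult_left_mono)
    qed
    also have "\<dots> \<le> C * w powr -2 / (1 + x\<^sup>2)"
      unfolding C_def using C0 by (intro divide_right_mono mult_right_mono) auto
    finally show ?thesis .
  qed
  have P2: "(\<integral>\<^sup>+x. ennreal (\<bar>cluster n c b w (x + h) - cluster n c b w x\<bar> powr p) \<partial>lborel)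
        \<le> ennreal (C * \<bar>h\<bar> powr ((1 - \<alpha>) * p / 2))" if w: "w \<in> {0<..1}" and h: "\<bar>h\<bar> \<le> 1" for w h
  proof -
    define D where "D x = cluster n c b w (x + h) - cluster n c b w x" for x
    have Dm [measurable]: "D \<in> borel_measurable borel" unfolding D_def by measurable
    have pw: "\<bar>D x\<bar> \<le> (\<Sum>i<n. \<bar>c i\<bar> * (128 * atom_const) * d h * (\<bar>x - b i\<bar> powr -2 + \<bar>x + h - b i\<bar> powr -2))"
      if "\<And>i. i < n \<Longrightarrow> x \<noteq> b i \<and> x + h \<noteq> b i" for x
    proof -
      have "\<bar>D x\<bar> = \<bar>\<Sum>i<n. c i * (atom w ((x - b i) + h) - atom w (x - b i))\<bar>"
        unfolding D_def cluster_def by (simp add: algebra_simps sum_subtractf)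
      also have "\<dots> \<le> (\<Sum>i<n. \<bar>c i\<bar> * (128 * atom_const) * d h * (\<bar>x - b i\<bar> powr -2 + \<bar>x + h - b i\<bar> powr -2))"
      proof (rule order_trans[OF sum_abs sum_mono])
        fix i assume "i \<in> {..<n}"
        then have "x - b i \<noteq> 0" "x - b i + h \<noteq> 0" using that[of i] by auto
        then have "\<bar>atom w ((x - b i) + h) - atom w (x - b i)\<bar> \<le>
            128 * atom_const * \<bar>h\<bar> powr (1 - \<alpha>) * (\<bar>x - b i\<bar> powr -2 + \<bar>x - b i + h\<bar> powr -2)"
          using w by (intro atom_translate_le) auto
        from mult_left_mono[OF this, of "\<bar>c i\<bar>"]
        show "\<bar>c i * (atom w ((x - b i) + h) - atom w (x - b i))\<bar> \<le>
            \<bar>c i\<bar> * (128 * atom_const) * d h * (\<bar>x - b i\<bar> powr -2 + \<bar>x + h - b i\<bar> powr -2)"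
          unfolding abs_mult d_def by (simp add: algebra_simps)
      qed
      finally show ?thesis .
    qed
    \<comment> \<open>The singularities of the difference are the centres and the centres shifted by \<open>- h\<close>.\<close>
    define I where "I = {..<n} \<times> (UNIV :: bool set)"
    have cart: "(\<Sum>j\<in>I. F j) = (\<Sum>i<n. F (i, True) + F (i, False))" for F :: "nat \<times> bool \<Rightarrow> real"
      unfolding I_def sum.cartesian_product' UNIV_bool by (simp add: add.commute)
    define bb where "bb = (\<lambda>(i, f). if f then b i else b i - h)"
    define tt where "tt = (\<lambda>(i::nat, f::bool). \<bar>c i\<bar> * (128 * atom_const) * d h)"
    have near: "(\<integral>\<^sup>+x. ennreal (\<bar>D x\<bar> powr p) * indicator {-4..4} x \<partial>lborel) \<le> ennreal (24 * (\<Sum>j\<in>I. tt j powr p))"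
    proof (rule nn_integral_near_points[OF p, of I bb tt])
      show "finite I" by (simp add: I_def)
      show "\<bar>bb j\<bar> \<le> 2" if "j \<in> I" for j
        using b[of "fst j"] that h by (auto simp: I_def bb_def split: prod.splits)
      show "tt j \<ge> 0" if "j \<in> I" for j using atom_const_pos by (auto simp: tt_def d_def split: prod.splits)
      fix x :: real assume x: "x \<notin> bb ` I"
      have "x \<noteq> b i \<and> x + h \<noteq> b i" if "i < n" for i
      proof -
        have "(i, True) \<in> I" "(i, False) \<in> I" using that by (auto simp: I_def)
        then have "x \<noteq> bb (i, True)" "x \<noteq> bb (i, False)" using x by blast+
        then show ?thesis by (auto simp: bb_def)
      qed
      from pw[OF this] show "\<bar>D x\<bar> \<le> (\<Sum>j\<in>I. tt j * \<bar>x - bb j\<bar> powr -2)"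
        unfolding cart by (simp add: tt_def bb_def algebra_simps)
    qed
    also have "24 * (\<Sum>j\<in>I. tt j powr p) = C1 * \<bar>h\<bar> powr ((1 - \<alpha>) * p)"
    proof -
      have "(\<Sum>j\<in>I. tt j powr p) = (\<Sum>i<n. 2 * (\<bar>c i\<bar> * (128 * atom_const) * d h) powr p)"
        unfolding cart by (simp add: tt_def)
      also have "\<dots> = (\<Sum>i<n. 2 * ((\<bar>c i\<bar> * (128 * atom_const)) powr p * \<bar>h\<bar> powr ((1 - \<alpha>) * p)))"
        unfolding d_def by (simp add: powr_mult powr_powr)
      finally show ?thesis unfolding C1_def by (simp add: sum_distrib_left sum_distrib_right mult.assoc)
    qed
    also have "\<dots> \<le> C1 * \<bar>h\<bar> powr ((1 - \<alpha>) * p / 2)"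
      using C0 h p \<alpha>_less by (intro mult_left_mono powr_mono') (auto simp: field_simps)
    finally have near': "(\<integral>\<^sup>+x. ennreal (\<bar>D x\<bar> powr p) * indicator {-4..4} x \<partial>lborel)
       \<le> ennreal (C1 * \<bar>h\<bar> powr ((1 - \<alpha>) * p / 2))" by (simp add: ennreal_leI)
    define T2 where "T2 = (256 * atom_const * A * (2 * T * 2 powr M)) powr (1/2) * (d h) powr (1/2)"
    have far': "(\<integral>\<^sup>+x. ennreal (\<bar>D x\<bar> powr p) * indicator (- {-4..4}) x \<partial>lborel) \<le> ennreal (T2 powr p)"
    proof (rule nn_integral_far[OF p(1)])
      show "2 \<le> M / 2 * p" using M by simp
      show "0 \<le> T2" by (simp add: T2_def)
      fix x :: real assume x: "\<bar>x\<bar> > 4"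
      have ne: "\<bar>x - b i\<bar> \<ge> 1" "\<bar>x + h - b i\<bar> \<ge> 1" if "i < n" for i
        using b[OF that] x h by linarith+
      have "\<bar>D x\<bar> \<le> (\<Sum>i<n. \<bar>c i\<bar> * (128 * atom_const) * d h * (\<bar>x - b i\<bar> powr -2 + \<bar>x + h - b i\<bar> powr -2))"
        using ne by (intro pw) fastforce
      also have "\<dots> \<le> (\<Sum>i<n. \<bar>c i\<bar> * (128 * atom_const) * d h * 2)"
      proof (intro sum_mono mult_left_mono)
        fix i assume "i \<in> {..<n}"
        then have "\<bar>x - b i\<bar> powr -2 \<le> 1" "\<bar>x + h - b i\<bar> powr -2 \<le> 1"
          using powr_mono2'[of "-2" 1] ne[of i] by (auto simp: powr_one_eq_one)
        then show "\<bar>x - b i\<bar> powr -2 + \<bar>x + h - b i\<bar> powr -2 \<le> 2" by simp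
      qed (use atom_const_pos in \<open>auto simp: d_def\<close>)
      also have "\<dots> = 256 * atom_const * A * d h" unfolding A_def by (simp add: sum_distrib_left sum_distrib_right mult_ac)
      finally have b1: "\<bar>D x\<bar> \<le> 256 * atom_const * A * d h" .
      have "\<bar>D x\<bar> \<le> \<bar>cluster n c b w (x + h)\<bar> + \<bar>cluster n c b w x\<bar>" unfolding D_def by (rule abs_triangle_ineq4)
      also have "\<dots> \<le> T * \<bar>x + h\<bar> powr - M + T * \<bar>x\<bar> powr - M" using x h by (intro add_mono far w) auto
      also have "\<dots> \<le> T * (\<bar>x\<bar> / 2) powr - M + T * (\<bar>x\<bar> / 2) powr - M"
      proof (intro add_mono mult_left_mono powr_mono2' T)
        have "\<bar>x\<bar> \<le> \<bar>x + h\<bar> + \<bar>h\<bar>" by linarith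
        then show "\<bar>x\<bar> / 2 \<le> \<bar>x + h\<bar>" using x h by simp
      qed (use x Mge in auto)
      also have "\<dots> = (2 * T * 2 powr M) * \<bar>x\<bar> powr - M" by (subst divide_powr_minus; simp)+
      finally have b2: "\<bar>D x\<bar> \<le> (2 * T * 2 powr M) * \<bar>x\<bar> powr - M" .
      have "\<bar>D x\<bar> = \<bar>D x\<bar> powr (1/2) * \<bar>D x\<bar> powr (1/2)" unfolding powr_add[symmetric] by simp
      also have "\<dots> \<le> (256 * atom_const * A * d h) powr (1/2) * ((2 * T * 2 powr M) * \<bar>x\<bar> powr - M) powr (1/2)"
        using b1 b2 by (intro mult_mono powr_mono2) auto
      also have "\<dots> = T2 * \<bar>x\<bar> powr - (M / 2)"
      proof -
        have "(E1 * u) powr (1/2) * (E2 * \<bar>x\<bar> powr - M) powr (1/2)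
          = (E1 * E2) powr (1/2) * u powr (1/2) * \<bar>x\<bar> powr - (M / 2)" for E1 E2 u
          by (simp add: powr_mult powr_powr)
        then show ?thesis unfolding T2_def .
      qed
      finally show "\<bar>D x\<bar> \<le> T2 * \<bar>x\<bar> powr - (M / 2)" .
    qed
    have T2: "T2 powr p = C2 * \<bar>h\<bar> powr ((1 - \<alpha>) * p / 2)"
      unfolding T2_def C2_def d_def by (simp add: powr_mult powr_powr)
    have "(\<integral>\<^sup>+x. ennreal (\<bar>D x\<bar> powr p) \<partial>lborel) =
       (\<integral>\<^sup>+x. ennreal (\<bar>D x\<bar> powr p) * indicator {-4..4} x + ennreal (\<bar>D x\<bar> powr p) * indicator (- {-4..4}) x \<partial>lborel)"
      by (intro nn_integral_cong) (auto simp: indicator_def)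
    also have "\<dots> = (\<integral>\<^sup>+x. ennreal (\<bar>D x\<bar> powr p) * indicator {-4..4} x \<partial>lborel)
      + (\<integral>\<^sup>+x. ennreal (\<bar>D x\<bar> powr p) * indicator (- {-4..4}) x \<partial>lborel)"
      by (rule nn_integral_add) auto
    also have "\<dots> \<le> ennreal (C1 * \<bar>h\<bar> powr ((1 - \<alpha>) * p / 2)) + ennreal (C2 * \<bar>h\<bar> powr ((1 - \<alpha>) * p / 2))"
      using near' far' unfolding T2 by (rule add_mono)
    also have "\<dots> = ennreal ((C1 + C2) * \<bar>h\<bar> powr ((1 - \<alpha>) * p / 2))"
      using C0 by (subst ennreal_plus[symmetric]) (auto simp: algebra_simps)
    also have "\<dots> \<le> ennreal (C * \<bar>h\<bar> powr ((1 - \<alpha>) * p / 2))"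
      unfolding C_def using C0 by (intro ennreal_leI mult_right_mono) auto
    finally show ?thesis unfolding D_def .
  qed
  have "C > 0" unfolding C_def using C0 by linarith
  with P2 P3 show ?thesis by blast
qed

end

section \<open>Charges at the centres of a fine grid\<close>

lemma sum_le_suminf_two_sided:
  fixes a :: "nat \<Rightarrow> real"
  assumes a: "summable a" "\<And>i. a i \<ge> 0" and k: "k < N"
    and f: "\<And>j. j < k \<Longrightarrow> f j \<le> a (k - 1 - j)" "\<And>j. k < j \<Longrightarrow> j < N \<Longrightarrow> f j \<le> a (j - k - 1)"
  shows "(\<Sum>j\<in>{..<N} - {k}. f j) \<le> 2 * suminf a"
proof -
  have eq: "{..<N} - {k} = {..<k} \<union> {Suc k..<N}" using k by auto
  have "(\<Sum>j\<in>{..<N} - {k}. f j) = (\<Sum>j<k. f j) + (\<Sum>j\<in>{Suc k..<N}. f j)"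
    unfolding eq by (rule sum.union_disjoint) auto
  also have "(\<Sum>j<k. f j) \<le> (\<Sum>j<k. a (k - Suc j))" using f(1) by (intro sum_mono) simp
  also have "\<dots> = (\<Sum>j<k. a j)" by (rule sum.nat_diff_reindex)
  also have "\<dots> \<le> suminf a" using a by (intro sum_le_suminf) auto
  also have "(\<Sum>j\<in>{Suc k..<N}. f j) \<le> (\<Sum>j\<in>{Suc k..<N}. a (j - Suc k))" using f(2) by (intro sum_mono) auto
  also have "\<dots> = (\<Sum>j\<in>{..<N - Suc k}. a j)"
    by (rule sum.reindex_bij_witness[of _ "\<lambda>j. j + Suc k" "\<lambda>j. j - Suc k"]) auto
  also have "\<dots> \<le> suminf a" using a by (intro sum_le_suminf) auto
  finally show ?thesis by simp
qed

context riesz_order begin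

lemma summable_half_shift:
  fixes e :: real
  assumes "e > 1"
  shows "summable (\<lambda>i. ((real i + 1) / 2) powr - e)"
proof -
  have "summable (\<lambda>i. real i powr - e)" using assms by (simp add: summable_real_powr_iff)
  then have "summable (\<lambda>i. 2 powr e * real (Suc i) powr - e)"
    by (intro summable_mult) (subst summable_Suc_iff)
  also have "(\<lambda>i. 2 powr e * real (Suc i) powr - e) = (\<lambda>i. ((real i + 1) / 2) powr - e)"
    by (subst divide_powr_minus) (auto simp: add.commute)
  finally show ?thesis .
qed

text \<open>Point charges at the centres of the \<open>N\<close> cells of \<open>[0, 1)\<close>; the factor is such that, seen on the scale of a cell, each
  charge is \<open>(R / |y|)^(1+\<alpha>)\<close>.\<close>

definition main_part :: "real \<Rightarrow> nat \<Rightarrow> real \<Rightarrow> real" where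
  "main_part R N x = (R / real N) powr (1 + \<alpha>) * (\<Sum>k<N. K (x - (real k + 1/2) / real N))"

lemma main_part_measurable [measurable]: "main_part R N \<in> borel_measurable borel"
  unfolding main_part_def[abs_def]
  by (intro borel_measurable_times borel_measurable_const borel_measurable_sum
      measurable_compose[OF _ K_measurable]) auto

text \<open>The same charges on the scale of a cell.\<close>

lemma main_part_scaled:
  assumes "N > 0" "R > 0"
  shows "main_part R N x = R powr (1 + \<alpha>) * (\<Sum>k<N. K (real N * x - real k - 1/2))"
proof -
  have "K (real N * x - real k - 1/2) = real N powr - (1 + \<alpha>) * K (x - (real k + 1/2) / real N)" for k
  proof -
    have "real N * x - real k - 1/2 = real N * (x - (real k + 1/2) / real N)"
      using assms by (simp add: field_simps)
    then show ?thesis using assms by (simp only: K_scale of_nat_0_less_iff)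
  qed
  moreover have "(R / real N) powr e = R powr e * real N powr - e" for e
    unfolding powr_divide by (simp only: powr_minus divide_inverse)
  ultimately show ?thesis unfolding main_part_def
    by (simp only: sum_distrib_left[symmetric] mult.assoc)
qed

text \<open>In the cell number \<open>k\<close>, with \<open>y\<close> the scaled position relative to its centre, the charge of the cell itself gives \<open>1 - (R / |y|)^(1+\<alpha>)\<close>. The
  others lie at scaled distances at least \<open>1/2, 1, 3/2, \<dots>\<close> on either side and add up to at most \<open>R^(1+\<alpha>) S\<close>, for which
  \<open>abs_diff_powr_le_add\<close> is made.\<close>

lemma nn_integral_main_part_cell:
  assumes N: "N > 0" and R: "R > 0" and p: "0 < p" "p \<le> 1"
    and S: "S = 2 * suminf (\<lambda>i. ((real i + 1) / 2) powr - (1 + \<alpha>))"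
  shows "(\<integral>\<^sup>+x. ennreal (\<bar>1 - main_part R N x\<bar> powr p) * indicator {0..<1} x \<partial>lborel)
    \<le> (\<integral>\<^sup>+y. ennreal (\<bar>1 - R powr (1 + \<alpha>) * \<bar>y\<bar> powr - (1 + \<alpha>)\<bar> powr p
         + R powr (1 + \<alpha>) * S * \<bar>1 - R powr (1 + \<alpha>) * \<bar>y\<bar> powr - (1 + \<alpha>)\<bar> powr (p - 1))
         * indicator {-1/2..1/2} y \<partial>lborel)" (is "?L \<le> ?I")
proof -
  define f where "f x = ennreal (\<bar>1 - main_part R N x\<bar> powr p)" for x
  have fm [measurable]: "f \<in> borel_measurable borel" unfolding f_def by measurable
  have N0: "real N > 0" using N by simp
  have cell: "(\<integral>\<^sup>+x. f x * indicator {real k / real N..<(real k + 1) / real N} x \<partial>lborel) \<le> ennreal (1 / real N) * ?I"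
    if k: "k < N" for k
  proof -
    have "(\<integral>\<^sup>+x. f x * indicator {real k / real N..<(real k + 1) / real N} x \<partial>lborel)
      = ennreal (1 / real N) * (\<integral>\<^sup>+y. f ((real k + 1/2) / real N + (1 / real N) * y)
          * indicator {real k / real N..<(real k + 1) / real N} ((real k + 1/2) / real N + (1 / real N) * y) \<partial>lborel)"
      using N0 by (subst nn_integral_real_affine[where c = "1 / real N" and t = "(real k + 1/2) / real N"]) auto
    also have "\<dots> \<le> ennreal (1 / real N) * ?I"
    proof (intro mult_left_mono nn_integral_mono_AE)
      have "AE y in lborel. y \<notin> {R, - R}" by (intro AE_not_in finite_imp_null_set_lborel) auto
      then show "AE y in lborel. f ((real k + 1/2) / real N + (1 / real N) * y)
          * indicator {real k / real N..<(real k + 1) / real N} ((real k + 1/2) / real N + (1 / real N) * y)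
        \<le> ennreal (\<bar>1 - R powr (1 + \<alpha>) * \<bar>y\<bar> powr - (1 + \<alpha>)\<bar> powr p
         + R powr (1 + \<alpha>) * S * \<bar>1 - R powr (1 + \<alpha>) * \<bar>y\<bar> powr - (1 + \<alpha>)\<bar> powr (p - 1))
         * indicator {-1/2..1/2} y"
      proof eventually_elim
        case (elim y)
        let ?x = "(real k + 1/2) / real N + (1 / real N) * y"
        show ?case
        proof (cases "?x \<in> {real k / real N..<(real k + 1) / real N}")
          case True
          have xe: "?x = (real k + 1/2 + y) / real N" by (simp add: add_divide_distrib)
          have y: "- 1/2 \<le> y" "y < 1/2"
            using True N0 unfolding xe by (auto simp: divide_le_cancel divide_less_cancel)
          define \<rho> where "\<rho> = R powr (1 + \<alpha>) * (\<Sum>j\<in>{..<N} - {k}. K (y + real k - real j))"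
          have rho: "0 \<le> \<rho>" "\<rho> \<le> R powr (1 + \<alpha>) * S"
          proof -
            show "0 \<le> \<rho>" unfolding \<rho>_def by (intro mult_nonneg_nonneg sum_nonneg K_nonneg) auto
            have "(\<Sum>j\<in>{..<N} - {k}. K (y + real k - real j)) \<le> S"
              unfolding S
            proof (rule sum_le_suminf_two_sided[OF summable_half_shift _ k])
              have Kle: "K u \<le> v powr - (1 + \<alpha>)" if "v > 0" "\<bar>u\<bar> \<ge> v" for u v
                unfolding K_def using that \<alpha>_pos by (intro powr_mono2') auto
              fix j
              show "K (y + real k - real j) \<le> ((real (k - 1 - j) + 1) / 2) powr - (1 + \<alpha>)" if "j < k"
                using that y by (intro Kle) (auto simp: of_nat_diff)
              show "K (y + real k - real j) \<le> ((real (j - k - 1) + 1) / 2) powr - (1 + \<alpha>)" if "k < j"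
                using that y by (intro Kle) (auto simp: of_nat_diff)
            qed (use \<alpha>_pos in auto)
            then show "\<rho> \<le> R powr (1 + \<alpha>) * S" unfolding \<rho>_def by (intro mult_left_mono) auto
          qed
          define a where "a = 1 - R powr (1 + \<alpha>) * \<bar>y\<bar> powr - (1 + \<alpha>)"
          have "1 - main_part R N ?x = a - \<rho>"
          proof -
            have eq: "real N * ?x - real j - 1/2 = y + real k - real j" for j
              using N0 unfolding xe by simp
            then have "main_part R N ?x = R powr (1 + \<alpha>) * (\<Sum>j<N. K (y + real k - real j))"
              by (simp only: main_part_scaled[OF N R] eq)
            also have "(\<Sum>j<N. K (y + real k - real j)) = K y + (\<Sum>j\<in>{..<N} - {k}. K (y + real k - real j))"
              using k by (subst sum.remove[of _ k]) auto
            finally show ?thesis unfolding a_def \<rho>_def by (simp add: K_def algebra_simps)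
          qed
          moreover have "a \<noteq> 0"
          proof
            assume "a = 0"
            then have e: "R powr (1 + \<alpha>) * \<bar>y\<bar> powr - (1 + \<alpha>) = 1" by (simp add: a_def)
            then have "y \<noteq> 0" by auto
            then have "\<bar>y\<bar> powr - (1 + \<alpha>) * \<bar>y\<bar> powr (1 + \<alpha>) = 1"
              by (simp only: powr_add[symmetric]) simp
            then have "R powr (1 + \<alpha>) = \<bar>y\<bar> powr (1 + \<alpha>)"
              using e by (metis mult.assoc mult.right_neutral mult_1)
            then have "(R powr (1 + \<alpha>)) powr (1 / (1 + \<alpha>)) = (\<bar>y\<bar> powr (1 + \<alpha>)) powr (1 / (1 + \<alpha>))"
              by (rule arg_cong)
            then have "R = \<bar>y\<bar>" using R \<alpha>_pos unfolding powr_powr by simp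
            then show False using elim by auto
          qed
          ultimately have "\<bar>1 - main_part R N ?x\<bar> powr p \<le> \<bar>a\<bar> powr p + \<rho> * \<bar>a\<bar> powr (p - 1)"
            using abs_diff_powr_le_add[OF p, of a \<rho>] rho by simp
          also have "\<dots> \<le> \<bar>a\<bar> powr p + R powr (1 + \<alpha>) * S * \<bar>a\<bar> powr (p - 1)"
            using rho by (intro add_left_mono mult_right_mono) auto
          finally show ?thesis unfolding f_def a_def using y True by (simp add: ennreal_leI)
        qed simp
      qed
    qed simp
    finally show ?thesis .
  qed
  have "?L \<le> (\<integral>\<^sup>+x. (\<Sum>k<N. f x * indicator {real k / real N..<(real k + 1) / real N} x) \<partial>lborel)"
  proof (rule nn_integral_mono)
    fix x :: real
    show "ennreal (\<bar>1 - main_part R N x\<bar> powr p) * indicator {0..<1} x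
       \<le> (\<Sum>k<N. f x * indicator {real k / real N..<(real k + 1) / real N} x)"
    proof (cases "x \<in> {0..<1}")
      case True
      define k where "k = nat \<lfloor>real N * x\<rfloor>"
      have k: "real k \<le> real N * x" "real N * x < real k + 1" using True N0 by (auto simp: k_def)
      have "real N * x < real N * 1" using True N0 by (intro mult_strict_left_mono) auto
      then have "real k < real N" using k by linarith
      then have kN: "k < N" by simp
      have "x \<in> {real k / real N..<(real k + 1) / real N}" using k N0 by (simp add: field_simps)
      then have "f x * indicator {0..<1} x = f x * indicator {real k / real N..<(real k + 1) / real N} x"
        using True by simp
      also have "\<dots> \<le> (\<Sum>k<N. f x * indicator {real k / real N..<(real k + 1) / real N} x)"
        using kN by (intro member_le_sum) auto
      finally show ?thesis by (simp add: f_def)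
    qed simp
  qed
  also have "\<dots> = (\<Sum>k<N. \<integral>\<^sup>+x. f x * indicator {real k / real N..<(real k + 1) / real N} x \<partial>lborel)"
    by (rule nn_integral_sum) auto
  also have "\<dots> \<le> (\<Sum>k<N. ennreal (1 / real N) * ?I)" by (intro sum_mono cell) auto
  also have "\<dots> = ennreal (real N * (1 / real N)) * ?I"
    by (subst ennreal_mult) (auto simp: ennreal_of_nat_eq_real_of_nat mult.assoc)
  also have "\<dots> = ?I" using N0 by simp
  finally show ?thesis .
qed

text \<open>At distance \<open>t\<close> from \<open>[0, 1)\<close> the kernel is split as \<open>|u|^(-\<alpha>/2) |u|^(-(1+\<alpha>/2))\<close>. The first
  factor is at most \<open>(N t)^(-\<alpha>/2)\<close>, the second is still summable over the charges. Hence the grid has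
  a negligible effect outside \<open>[0, 1)\<close> as \<open>N\<close> grows.\<close>

lemma main_part_outside:
  assumes N: "N > 0" and R: "0 < R" "R \<le> 1" and x: "x \<notin> {0..<1}" "x \<noteq> 1" "\<bar>x\<bar> \<le> 4"
    and S: "S = suminf (\<lambda>i. ((real i + 1) / 2) powr - (1 + \<alpha> / 2))"
  shows "\<bar>main_part R N x\<bar> \<le> 36 * S * real N powr - (\<alpha> / 2) * (\<bar>x\<bar> powr -2 + \<bar>x - 1\<bar> powr -2)"
proof -
  define a where "a i = ((real i + 1) / 2) powr - (1 + \<alpha> / 2)" for i :: nat
  have as: "summable a" unfolding a_def using \<alpha>_pos by (intro summable_half_shift) auto
  have S': "S = suminf a" unfolding S a_def ..
  have a0: "a i \<ge> 0" for i by (simp add: a_def)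
  have S0: "S \<ge> 0" unfolding S' using as by (intro suminf_nonneg) (auto simp: a_def)
  have K1: "K u \<le> t powr - (\<alpha> / 2) * a i" if "t > 0" "\<bar>u\<bar> \<ge> t + (real i + 1/2)" for u t i
  proof -
    have u0: "\<bar>u\<bar> > 0" using that by linarith
    have "K u = \<bar>u\<bar> powr - (\<alpha> / 2) * \<bar>u\<bar> powr - (1 + \<alpha> / 2)"
      unfolding K_def powr_add[symmetric] by (simp add: algebra_simps)
    also have "\<dots> \<le> t powr - (\<alpha> / 2) * ((real i + 1) / 2) powr - (1 + \<alpha> / 2)"
      using that \<alpha>_pos by (intro mult_mono powr_mono2') auto
    finally show ?thesis by (simp add: a_def)
  qed
  have total: "(\<Sum>k<N. K (real N * x - real k - 1/2)) \<le> (real N * t) powr - (\<alpha> / 2) * S"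
    if t: "t > 0" "t = - x \<or> t = x - 1" for t
  proof -
    have Nt: "real N * t > 0" using N t by simp
    show ?thesis
    proof (cases "t = - x")
      case True
      have "(\<Sum>k<N. K (real N * x - real k - 1/2)) \<le> (\<Sum>k<N. (real N * t) powr - (\<alpha> / 2) * a k)"
        using Nt True by (intro sum_mono K1) auto
      also have "\<dots> = (real N * t) powr - (\<alpha> / 2) * (\<Sum>k<N. a k)" by (simp add: sum_distrib_left)
      also have "\<dots> \<le> (real N * t) powr - (\<alpha> / 2) * S"
        unfolding S' using a0 by (intro mult_left_mono sum_le_suminf[OF as]) auto
      finally show ?thesis .
    next
      case False
      then have tx: "x = t + 1" using t by auto
      have "(\<Sum>k<N. K (real N * x - real k - 1/2)) \<le> (\<Sum>k<N. (real N * t) powr - (\<alpha> / 2) * a (N - Suc k))"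
        using Nt unfolding tx by (intro sum_mono K1) (auto simp: of_nat_diff algebra_simps)
      also have "\<dots> = (real N * t) powr - (\<alpha> / 2) * (\<Sum>k<N. a (N - Suc k))" by (simp add: sum_distrib_left)
      also have "(\<Sum>k<N. a (N - Suc k)) = (\<Sum>k<N. a k)" by (rule sum.nat_diff_reindex)
      also have "(real N * t) powr - (\<alpha> / 2) * (\<Sum>k<N. a k) \<le> (real N * t) powr - (\<alpha> / 2) * S"
        unfolding S' using a0 by (intro mult_left_mono sum_le_suminf[OF as]) auto
      finally show ?thesis .
    qed
  qed
  have sq: "t powr - (\<alpha> / 2) \<le> 36 * t powr -2" if "t > 0" "t \<le> 6" for t :: real
  proof -
    have "t powr - (\<alpha> / 2) = t powr (2 - \<alpha> / 2) * t powr -2" unfolding powr_add[symmetric] by simp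
    also have "\<dots> \<le> 6 powr (2 - \<alpha> / 2) * t powr -2"
      using that \<alpha>_less by (intro mult_right_mono powr_mono2) auto
    also have "\<dots> \<le> 6 powr 2 * t powr -2" using \<alpha>_pos by (intro mult_right_mono powr_mono) auto
    finally show ?thesis by (simp add: powr_numeral)
  qed
  define t where "t = (if x < 0 then - x else x - 1)"
  have t: "t > 0" "t = - x \<or> t = x - 1" "t \<le> 6" using x by (auto simp: t_def)
  have sn: "0 \<le> (\<Sum>k<N. K (real N * x - real k - 1/2))" by (intro sum_nonneg K_nonneg)
  have "\<bar>main_part R N x\<bar> = R powr (1 + \<alpha>) * (\<Sum>k<N. K (real N * x - real k - 1/2))"
    unfolding main_part_scaled[OF N R(1)] using sn by simp
  also have "\<dots> \<le> 1 * (\<Sum>k<N. K (real N * x - real k - 1/2))"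
    using R \<alpha>_pos sn powr_mono2[of "1 + \<alpha>" R 1] by (intro mult_right_mono) auto
  also have "\<dots> \<le> (real N * t) powr - (\<alpha> / 2) * S" using total[OF t(1,2)] by simp
  also have "\<dots> = real N powr - (\<alpha> / 2) * t powr - (\<alpha> / 2) * S" by (simp add: powr_mult)
  also have "\<dots> \<le> real N powr - (\<alpha> / 2) * (36 * t powr -2) * S"
    using t S0 by (intro mult_right_mono mult_left_mono sq) auto
  also have "t powr -2 \<le> \<bar>x\<bar> powr -2 + \<bar>x - 1\<bar> powr -2"
    using t by (cases "x < 0") (auto simp: t_def)
  finally show ?thesis using S0 by (simp add: algebra_simps mult_right_mono)
qed

end

section \<open>The profile\<close>

context riesz_order begin

text \<open>The first \<open>N\<close> atoms of the profile are the negative charges at the centres of the cells, the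
  remaining ones compensate their moments at the interpolation nodes. Correspondingly for \<open>fill_point\<close>.\<close>

definition fill_coeff :: "real \<Rightarrow> nat \<Rightarrow> (nat \<Rightarrow> real \<Rightarrow> real) \<Rightarrow> nat \<Rightarrow> real" where
  "fill_coeff R N l i = (R / real N) powr (1 + \<alpha>) *
     (if i < N then - 1 else (\<Sum>k<N. l (i - N) ((real k + 1/2) / real N)))"

definition fill_point :: "nat \<Rightarrow> (nat \<Rightarrow> real) \<Rightarrow> nat \<Rightarrow> real" where
  "fill_point N e i = (if i < N then (real i + 1/2) / real N else e (i - N))"

lemma sum_lessThan_add: "(\<Sum>i<N + (n::nat). F i) = (\<Sum>i<N. F i) + (\<Sum>i<n. F (N + i))" for F :: "nat \<Rightarrow> real"
proof (induction n)
  case (Suc n)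
  then show ?case by (simp add: add.assoc)
qed simp

lemma cluster_fill:
  "cluster (N + n) (fill_coeff R N l) (fill_point N e) w x =
     - ((R / real N) powr (1 + \<alpha>) * (\<Sum>k<N. atom w (x - (real k + 1/2) / real N)))
     + (\<Sum>i<n. (R / real N) powr (1 + \<alpha>) * (\<Sum>k<N. l i ((real k + 1/2) / real N)) * atom w (x - e i))"
  unfolding cluster_def sum_lessThan_add
  by (simp add: fill_coeff_def fill_point_def sum_distrib_left sum_negf)

text \<open>Grouped by charges, every charge appears together with its own compensation, which shows the
  decay at infinity; \<open>cluster_fill\<close> groups by atoms.\<close>

lemma cluster_fill_far:
  "cluster (N + n) (fill_coeff R N l) (fill_point N e) w x =
     - ((R / real N) powr (1 + \<alpha>) * (\<Sum>k<N. atom w (x - (real k + 1/2) / real N)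
         - (\<Sum>i<n. l i ((real k + 1/2) / real N) * atom w (x - e i))))"
proof -
  have "(\<Sum>k<N. \<Sum>i<n. l i ((real k + 1/2) / real N) * atom w (x - e i))
    = (\<Sum>i<n. (\<Sum>k<N. l i ((real k + 1/2) / real N)) * atom w (x - e i))"
    by (subst sum.swap) (simp add: sum_distrib_right)
  then show ?thesis unfolding cluster_fill
    by (simp add: sum_subtractf algebra_simps sum_distrib_left)
qed

lemma node_in_unit: "k < N \<Longrightarrow> (real k + 1/2) / real N \<in> {0..1}"
  by (auto simp: field_simps)

text \<open>The sum \<open>1_[0,1) + \<psi>\<close> is \<open>1 - main_part\<close> on the unit interval plus three errors: the charges
  are atoms instead of \<open>K\<close> (small with \<open>w\<close>, for fixed \<open>N\<close>), the compensating atoms, and the effect of the charges outside the unit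
  interval (both small with \<open>1 / N\<close>, the total compensating charge being \<open>O (N^(-\<alpha>))\<close>).\<close>

lemma nn_integral_cluster_fill_le:
  fixes n :: nat and e :: "nat \<Rightarrow> real" and l B M Ce S S2 R p
  assumes p: "0 < p" "p \<le> 1/4" and R: "0 < R" "R \<le> 1" and N: "N > 0"
    and e: "\<And>i. i < n \<Longrightarrow> 0 \<le> e i \<and> e i \<le> 1" and B: "B \<ge> 0"
    and l: "\<And>i y. i < n \<Longrightarrow> y \<in> {0..1} \<Longrightarrow> \<bar>l i y\<bar> \<le> B"
    and Ce: "Ce \<ge> 0" and M: "2 \<le> M * p"
    and err: "\<And>y w x. y \<in> {0..1} \<Longrightarrow> w \<in> {0<..1} \<Longrightarrow> \<bar>x\<bar> \<ge> 3 \<Longrightarrow>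
       \<bar>atom w (x - y) - (\<Sum>i<n. l i y * atom w (x - e i))\<bar> \<le> Ce * \<bar>x\<bar> powr - M"
    and S2: "S2 = suminf (\<lambda>i. ((real i + 1) / 2) powr - (1 + \<alpha> / 2))"
    and cell: "(\<integral>\<^sup>+x. ennreal (\<bar>1 - main_part R N x\<bar> powr p) * indicator {0..<1} x \<partial>lborel) \<le> ennreal (1 - g)"
    and g: "g \<le> 1"
    and w: "w \<in> {0<..1}"
  defines "\<psi> \<equiv> cluster (N + n) (fill_coeff R N l) (fill_point N e) w"
  shows "(\<integral>\<^sup>+x. ennreal (\<bar>indicator {0..<1} x + \<psi> x\<bar> powr p) \<partial>lborel) \<le>
      ennreal (1 - g + 24 * (real N * (10 * atom_const * w powr (1 - \<alpha>)) powr p)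
        + (24 * (real n * (24 * atom_const * B) powr p) + 48 * (36 * S2) powr p + Ce powr p) * real N powr - (\<alpha> * p / 2))"
    and "\<And>x. \<bar>x\<bar> \<ge> 3 \<Longrightarrow> \<bar>\<psi> x\<bar> \<le> Ce * real N powr - \<alpha> * \<bar>x\<bar> powr - M"
proof -
  define r where "r = (R / real N) powr (1 + \<alpha>)"
  have r: "0 \<le> r" "r \<le> 1" "r * real N \<le> real N powr - \<alpha>"
  proof -
    have N1: "real N \<ge> 1" using N by simp
    show "0 \<le> r" by (simp add: r_def)
    have rl: "r \<le> (1 / real N) powr (1 + \<alpha>)"
      unfolding r_def using R N \<alpha>_pos by (intro powr_mono2 divide_right_mono) auto
    also have "\<dots> \<le> 1 powr (1 + \<alpha>)" using N1 \<alpha>_pos by (intro powr_mono2) auto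
    finally show "r \<le> 1" by simp
    have "r * real N \<le> (1 / real N) powr (1 + \<alpha>) * real N" using rl by (intro mult_right_mono) auto
    also have "\<dots> = real N powr - \<alpha>"
    proof -
      have "(1 / real N) powr (1 + \<alpha>) = real N powr - (1 + \<alpha>)"
        using N by (simp only: powr_minus_divide powr_divide powr_one_eq_one)
      then have "(1 / real N) powr (1 + \<alpha>) * real N = real N powr - (1 + \<alpha>) * real N powr 1" using N by simp
      then show ?thesis by (simp only: powr_add[symmetric]) simp
    qed
    finally show "r * real N \<le> real N powr - \<alpha>" .
  qed
  have \<psi>m [measurable]: "\<psi> \<in> borel_measurable borel" unfolding \<psi>_def by (rule cluster_measurable)
  show far: "\<bar>\<psi> x\<bar> \<le> Ce * real N powr - \<alpha> * \<bar>x\<bar> powr - M" if x: "\<bar>x\<bar> \<ge> 3" for x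
  proof -
    have "\<bar>\<psi> x\<bar> = r * \<bar>\<Sum>k<N. atom w (x - (real k + 1/2) / real N)
         - (\<Sum>i<n. l i ((real k + 1/2) / real N) * atom w (x - e i))\<bar>"
      unfolding \<psi>_def cluster_fill_far r_def[symmetric] using r(1) by (simp add: abs_mult)
    also have "\<dots> \<le> r * (\<Sum>k<N. Ce * \<bar>x\<bar> powr - M)"
      using x w by (intro mult_left_mono r order_trans[OF sum_abs sum_mono] err node_in_unit) auto
    also have "\<dots> = (r * real N) * (Ce * \<bar>x\<bar> powr - M)" by simp
    also have "\<dots> \<le> real N powr - \<alpha> * (Ce * \<bar>x\<bar> powr - M)"
      using Ce by (intro mult_right_mono r) auto
    finally show ?thesis by (simp add: mult_ac)
  qed
  define G where "G x = indicator {0..<1} x + \<psi> x" for x :: real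
  have Gm [measurable]: "G \<in> borel_measurable borel" unfolding G_def by measurable
  define H where "H x = indicator {0..<1} x * (1 - main_part R N x)" for x :: real
  \<comment> \<open>\<open>A1\<close> is the error from atoms in place of \<open>K\<close>, \<open>A2\<close> the compensation, \<open>A3\<close> the part of the charges outside the unit interval.\<close>
  define A1 where "A1 x = - (\<Sum>k<N. r * (atom w (x - (real k + 1/2) / real N) - K (x - (real k + 1/2) / real N)))" for x
  define A2 where "A2 x = (\<Sum>i<n. r * (\<Sum>k<N. l i ((real k + 1/2) / real N)) * atom w (x - e i))" for x
  define A3 where "A3 x = - indicator (- {0..<1}) x * main_part R N x" for x :: real
  have [measurable]: "H \<in> borel_measurable borel" "A3 \<in> borel_measurable borel"
    unfolding H_def A3_def by measurable
  have [measurable]: "A1 \<in> borel_measurable borel" "A2 \<in> borel_measurable borel"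
    unfolding A1_def A2_def
    by (intro borel_measurable_times borel_measurable_const borel_measurable_sum borel_measurable_uminus borel_measurable_diff
      measurable_compose[OF _ K_measurable] measurable_compose[OF _ atom_measurable]; simp)+
  have split: "G x = H x + (A1 x + (A2 x + A3 x))" for x
  proof -
    have "\<psi> x = A1 x - main_part R N x + A2 x"
      unfolding \<psi>_def cluster_fill A1_def A2_def main_part_def r_def[symmetric]
      by (simp add: sum_subtractf sum_distrib_left right_diff_distrib)
    then show ?thesis unfolding G_def H_def A3_def by (cases "x \<in> {0..<1}") auto
  qed
  have sp: "\<bar>G x\<bar> powr p \<le> \<bar>H x\<bar> powr p + (\<bar>A1 x\<bar> powr p + (\<bar>A2 x\<bar> powr p + \<bar>A3 x\<bar> powr p))" for x
    unfolding split using p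
    by (intro order_trans[OF abs_add_powr_le] add_left_mono) auto
  have I1: "(\<integral>\<^sup>+x. ennreal (\<bar>A1 x\<bar> powr p) * indicator {-4..4} x \<partial>lborel)
     \<le> ennreal (24 * (\<Sum>k<N. (10 * atom_const * w powr (1 - \<alpha>)) powr p))"
  proof (rule nn_integral_near_points[OF p, of "{..<N}" "\<lambda>k. (real k + 1/2) / real N"])
    fix x :: real assume x: "x \<notin> (\<lambda>k. (real k + 1/2) / real N) ` {..<N}"
    show "\<bar>A1 x\<bar> \<le> (\<Sum>k<N. 10 * atom_const * w powr (1 - \<alpha>) * \<bar>x - (real k + 1/2) / real N\<bar> powr -2)"
      unfolding A1_def abs_minus_cancel
    proof (rule order_trans[OF sum_abs sum_mono])
      fix k assume k: "k \<in> {..<N}"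
      then have "x - (real k + 1/2) / real N \<noteq> 0" using x by auto
      then have "\<bar>atom w (x - (real k + 1/2) / real N) - K (x - (real k + 1/2) / real N)\<bar>
         \<le> 10 * atom_const * w powr (1 - \<alpha>) * \<bar>x - (real k + 1/2) / real N\<bar> powr -2"
        using w by (intro atom_minus_K_le) auto
      then have "r * \<bar>atom w (x - (real k + 1/2) / real N) - K (x - (real k + 1/2) / real N)\<bar>
         \<le> 1 * (10 * atom_const * w powr (1 - \<alpha>) * \<bar>x - (real k + 1/2) / real N\<bar> powr -2)"
        using r by (intro mult_mono) auto
      then show "\<bar>r * (atom w (x - (real k + 1/2) / real N) - K (x - (real k + 1/2) / real N))\<bar>
         \<le> 10 * atom_const * w powr (1 - \<alpha>) * \<bar>x - (real k + 1/2) / real N\<bar> powr -2"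
        using r by (simp add: abs_mult)
    qed
  next
    have *: "\<bar>u\<bar> \<le> 2" if "u \<in> {0..1}" for u :: real using that by auto
    show "\<bar>(real k + 1/2) / real N\<bar> \<le> 2" if "k \<in> {..<N}" for k
      using that by (intro * node_in_unit) auto
  qed (use atom_const_pos in auto)
  have I2: "(\<integral>\<^sup>+x. ennreal (\<bar>A2 x\<bar> powr p) * indicator {-4..4} x \<partial>lborel)
     \<le> ennreal (24 * (\<Sum>i<n. (24 * atom_const * B * real N powr - \<alpha>) powr p))"
  proof (rule nn_integral_near_points[OF p, of "{..<n}" e])
    fix x :: real assume x: "x \<notin> e ` {..<n}" "\<bar>x\<bar> \<le> 4"
    show "\<bar>A2 x\<bar> \<le> (\<Sum>i<n. 24 * atom_const * B * real N powr - \<alpha> * \<bar>x - e i\<bar> powr -2)"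
      unfolding A2_def
    proof (rule order_trans[OF sum_abs sum_mono])
      fix i assume i: "i \<in> {..<n}"
      have nz: "x - e i \<noteq> 0" using x i by auto
      have "\<bar>atom w (x - e i)\<bar> \<le> 4 * atom_const * K (x - e i)" using w nz by (intro atom_le) auto
      also have "\<dots> \<le> 4 * atom_const * (6 * \<bar>x - e i\<bar> powr -2)"
        using nz e[of i] i x atom_const_pos by (intro mult_left_mono K_le_inverse_square) auto
      finally have 1: "\<bar>atom w (x - e i)\<bar> \<le> 24 * atom_const * \<bar>x - e i\<bar> powr -2" by simp
      have "\<bar>\<Sum>k<N. l i ((real k + 1/2) / real N)\<bar> \<le> (\<Sum>k<N. B)"
        using i by (intro order_trans[OF sum_abs sum_mono] l node_in_unit) auto
      then have "r * \<bar>\<Sum>k<N. l i ((real k + 1/2) / real N)\<bar> \<le> r * (real N * B)"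
        using r by (intro mult_left_mono) auto
      also have "\<dots> \<le> real N powr - \<alpha> * B" unfolding mult.assoc[symmetric] using B by (intro mult_right_mono r)
      finally have 2: "r * \<bar>\<Sum>k<N. l i ((real k + 1/2) / real N)\<bar> \<le> real N powr - \<alpha> * B" .
      have "\<bar>r * (\<Sum>k<N. l i ((real k + 1/2) / real N)) * atom w (x - e i)\<bar>
         = (r * \<bar>\<Sum>k<N. l i ((real k + 1/2) / real N)\<bar>) * \<bar>atom w (x - e i)\<bar>"
        using r by (simp add: abs_mult)
      also have "\<dots> \<le> (real N powr - \<alpha> * B) * (24 * atom_const * \<bar>x - e i\<bar> powr -2)"
        using B r by (intro mult_mono 1 2) auto
      finally show "\<bar>r * (\<Sum>k<N. l i ((real k + 1/2) / real N)) * atom w (x - e i)\<bar>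
         \<le> 24 * atom_const * B * real N powr - \<alpha> * \<bar>x - e i\<bar> powr -2" by (simp add: mult_ac)
    qed
  next
    show "\<bar>e i\<bar> \<le> 2" if "i \<in> {..<n}" for i using e[of i] that by auto
  qed (use atom_const_pos B in auto)
  have S2nn: "S2 \<ge> 0" unfolding S2 using \<alpha>_pos by (intro suminf_nonneg summable_half_shift) auto
  have I3: "(\<integral>\<^sup>+x. ennreal (\<bar>A3 x\<bar> powr p) * indicator {-4..4} x \<partial>lborel)
     \<le> ennreal (24 * (\<Sum>f\<in>(UNIV::bool set). (36 * S2 * real N powr - (\<alpha> / 2)) powr p))"
  proof (rule nn_integral_near_points[OF p, of UNIV "\<lambda>f. if f then 1 else 0"])
    fix x :: real assume x: "x \<notin> (\<lambda>f. if f then 1 else 0) ` (UNIV :: bool set)" "\<bar>x\<bar> \<le> 4"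
    have "x \<noteq> 1" using x(1) by (auto simp: image_iff)
    show "\<bar>A3 x\<bar> \<le> (\<Sum>f\<in>UNIV. 36 * S2 * real N powr - (\<alpha> / 2) * \<bar>x - (if f then 1 else 0)\<bar> powr -2)"
    proof (cases "x \<in> {0..<1}")
      case True
      then show ?thesis using S2nn by (auto simp: A3_def intro!: sum_nonneg)
    next
      case False
      have "\<bar>main_part R N x\<bar> \<le> 36 * S2 * real N powr - (\<alpha> / 2) * (\<bar>x\<bar> powr -2 + \<bar>x - 1\<bar> powr -2)"
        by (rule main_part_outside[OF N R False \<open>x \<noteq> 1\<close> x(2) S2])
      then show ?thesis using False by (simp add: A3_def UNIV_bool algebra_simps)
    qed
  qed (use S2nn in auto)
  have I4: "(\<integral>\<^sup>+x. ennreal (\<bar>G x\<bar> powr p) * indicator (- {-4..4}) x \<partial>lborel) \<le> ennreal ((Ce * real N powr - \<alpha>) powr p)"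
  proof (rule nn_integral_far[OF p(1) M])
    show "\<bar>G x\<bar> \<le> Ce * real N powr - \<alpha> * \<bar>x\<bar> powr - M" if "\<bar>x\<bar> > 4" for x
      using far[of x] that by (auto simp: G_def indicator_def)
  qed (use Ce in auto)
  define i4 where "i4 = (\<lambda>x::real. indicator {-4..4} x :: ennreal)"
  have [measurable]: "i4 \<in> borel_measurable borel" unfolding i4_def by measurable
  have "(\<integral>\<^sup>+x. ennreal (\<bar>G x\<bar> powr p) \<partial>lborel) \<le>
     (\<integral>\<^sup>+x. ennreal (\<bar>1 - main_part R N x\<bar> powr p) * indicator {0..<1} x
       + (ennreal (\<bar>A1 x\<bar> powr p) * i4 x
       + (ennreal (\<bar>A2 x\<bar> powr p) * i4 x
       + (ennreal (\<bar>A3 x\<bar> powr p) * i4 x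
       + ennreal (\<bar>G x\<bar> powr p) * indicator (- {-4..4}) x))) \<partial>lborel)"
  proof (rule nn_integral_mono)
    fix x :: real
    show "ennreal (\<bar>G x\<bar> powr p) \<le> ennreal (\<bar>1 - main_part R N x\<bar> powr p) * indicator {0..<1} x
       + (ennreal (\<bar>A1 x\<bar> powr p) * i4 x
       + (ennreal (\<bar>A2 x\<bar> powr p) * i4 x
       + (ennreal (\<bar>A3 x\<bar> powr p) * i4 x
       + ennreal (\<bar>G x\<bar> powr p) * indicator (- {-4..4}) x)))"
    proof (cases "x \<in> {-4..4}")
      case True
      have "ennreal (\<bar>H x\<bar> powr p) \<le> ennreal (\<bar>1 - main_part R N x\<bar> powr p) * indicator {0..<1} x"
        by (auto simp: H_def indicator_def)
      moreover have "ennreal (\<bar>G x\<bar> powr p) \<le> ennreal (\<bar>H x\<bar> powr p) + (ennreal (\<bar>A1 x\<bar> powr p) + (ennreal (\<bar>A2 x\<bar> powr p) + ennreal (\<bar>A3 x\<bar> powr p)))"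
        using sp[of x] by (simp flip: ennreal_plus add: ennreal_leI)
      ultimately have "ennreal (\<bar>G x\<bar> powr p) \<le> ennreal (\<bar>1 - main_part R N x\<bar> powr p) * indicator {0..<1} x
        + (ennreal (\<bar>A1 x\<bar> powr p) + (ennreal (\<bar>A2 x\<bar> powr p) + ennreal (\<bar>A3 x\<bar> powr p)))"
        by (rule order_trans[OF _ add_right_mono, rotated])
      then show ?thesis using True by (simp add: i4_def)
    next
      case False
      then show ?thesis by (simp add: i4_def)
    qed
  qed
  also have "\<dots> = (\<integral>\<^sup>+x. ennreal (\<bar>1 - main_part R N x\<bar> powr p) * indicator {0..<1} x \<partial>lborel)
     + ((\<integral>\<^sup>+x. ennreal (\<bar>A1 x\<bar> powr p) * i4 x \<partial>lborel)
     + ((\<integral>\<^sup>+x. ennreal (\<bar>A2 x\<bar> powr p) * i4 x \<partial>lborel)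
     + ((\<integral>\<^sup>+x. ennreal (\<bar>A3 x\<bar> powr p) * i4 x \<partial>lborel)
     + (\<integral>\<^sup>+x. ennreal (\<bar>G x\<bar> powr p) * indicator (- {-4..4}) x \<partial>lborel))))"
    by (simp add: nn_integral_add)
  also have "\<dots> \<le> ennreal (1 - g) + (ennreal (24 * (\<Sum>k<N. (10 * atom_const * w powr (1 - \<alpha>)) powr p))
     + (ennreal (24 * (\<Sum>i<n. (24 * atom_const * B * real N powr - \<alpha>) powr p))
     + (ennreal (24 * (\<Sum>f\<in>(UNIV::bool set). (36 * S2 * real N powr - (\<alpha> / 2)) powr p))
     + ennreal ((Ce * real N powr - \<alpha>) powr p))))"
    unfolding i4_def by (intro add_mono cell I1 I2 I3 I4)
  also have "\<dots> = ennreal (1 - g + (24 * (\<Sum>k<N. (10 * atom_const * w powr (1 - \<alpha>)) powr p)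
     + (24 * (\<Sum>i<n. (24 * atom_const * B * real N powr - \<alpha>) powr p)
     + (24 * (\<Sum>f\<in>(UNIV::bool set). (36 * S2 * real N powr - (\<alpha> / 2)) powr p)
     + (Ce * real N powr - \<alpha>) powr p))))"
    using g by (simp only: ennreal_plus[symmetric] sum_nonneg powr_ge_zero add_nonneg_nonneg mult_nonneg_nonneg
       zero_le_numeral diff_ge_0_iff_ge)
  also have "\<dots> \<le> ennreal (1 - g + 24 * (real N * (10 * atom_const * w powr (1 - \<alpha>)) powr p)
        + (24 * (real n * (24 * atom_const * B) powr p) + 48 * (36 * S2) powr p + Ce powr p) * real N powr - (\<alpha> * p / 2))"
  proof (rule ennreal_leI)
    have "real N powr - (\<alpha> * p) \<le> real N powr - (\<alpha> * p / 2)"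
      using N \<alpha>_pos p by (intro powr_mono) auto
    then have b: "(u * real N powr - \<alpha>) powr p \<le> u powr p * real N powr - (\<alpha> * p / 2)" for u
      by (simp add: powr_mult powr_powr mult_left_mono)
    have "(36 * S2 * real N powr - (\<alpha> / 2)) powr p = (36 * S2) powr p * real N powr - (\<alpha> * p / 2)"
      by (simp add: powr_mult powr_powr)
    moreover have "(24 * atom_const * B * real N powr - \<alpha>) powr p \<le> (24 * atom_const * B) powr p * real N powr - (\<alpha> * p / 2)"
      by (rule b)
    then have "real n * (24 * atom_const * B * real N powr - \<alpha>) powr p \<le> real n * ((24 * atom_const * B) powr p * real N powr - (\<alpha> * p / 2))"
      by (intro mult_left_mono) auto
    moreover have "(Ce * real N powr - \<alpha>) powr p \<le> Ce powr p * real N powr - (\<alpha> * p / 2)" by (rule b)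
    ultimately show "1 - g + (24 * (\<Sum>k<N. (10 * atom_const * w powr (1 - \<alpha>)) powr p)
     + (24 * (\<Sum>i<n. (24 * atom_const * B * real N powr - \<alpha>) powr p)
     + (24 * (\<Sum>f\<in>(UNIV::bool set). (36 * S2 * real N powr - (\<alpha> / 2)) powr p)
     + (Ce * real N powr - \<alpha>) powr p))) \<le> 1 - g + 24 * (real N * (10 * atom_const * w powr (1 - \<alpha>)) powr p)
        + (24 * (real n * (24 * atom_const * B) powr p) + 48 * (36 * S2) powr p + Ce powr p) * real N powr - (\<alpha> * p / 2)"
      by (simp add: UNIV_bool algebra_simps)
  qed
  finally show "(\<integral>\<^sup>+x. ennreal (\<bar>indicator {0..<1} x + \<psi> x\<bar> powr p) \<partial>lborel) \<le>
      ennreal (1 - g + 24 * (real N * (10 * atom_const * w powr (1 - \<alpha>)) powr p)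
        + (24 * (real n * (24 * atom_const * B) powr p) + 48 * (36 * S2) powr p + Ce powr p) * real N powr - (\<alpha> * p / 2))"
    unfolding G_def .
qed

text \<open>The order of choices is: the exponent \<open>p\<close>, the size \<open>R\<close> of the charges, the number \<open>m\<close> of moments to be
  cancelled, with its nodes, then \<open>N\<close> large, then the widths small. The coefficients are fixed before the width, so that one combination serves
  for all small widths.\<close>

lemma exists_profile:
  "\<exists>p q w0 C \<gamma> n c b. 0 < p \<and> p \<le> 1/4 \<and> 0 < q \<and> q < 1 \<and> 0 < w0 \<and> w0 \<le> 1 \<and> 0 < C \<and> 0 < \<gamma> \<and>
    (\<forall>i<n. 0 \<le> b i \<and> b i \<le> 1) \<and>
    (\<forall>w\<in>{0<..w0}.
       (\<integral>\<^sup>+x. ennreal (\<bar>indicator {0..<1} x + cluster n c b w x\<bar> powr p) \<partial>lborel) \<le> ennreal q \<and>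
       (\<forall>h. \<bar>h\<bar> \<le> 1 \<longrightarrow> (\<integral>\<^sup>+x. ennreal (\<bar>cluster n c b w (x + h) - cluster n c b w x\<bar> powr p) \<partial>lborel)
          \<le> ennreal (C * \<bar>h\<bar> powr \<gamma>)) \<and>
       (\<forall>x. \<bar>cluster n c b w x\<bar> \<le> C * w powr -2 / (1 + x\<^sup>2)))"
proof -
  define s where "s = 1 + \<alpha>"
  have s: "1 < s" "s < 2" using \<alpha>_pos \<alpha>_less by (auto simp: s_def)
  obtain p Z g0 where p: "0 < p" "p \<le> 1/4" and Z: "Z \<ge> 1" "g0 > 0"
    "(\<integral>\<^sup>+z. ennreal (\<bar>1 - z powr - s\<bar> powr p) * indicator {0..Z} z \<partial>lborel) \<le> ennreal (Z - g0)"
    using exists_exponent_integral_less[OF s] by blast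
  define S where "S = 2 * suminf (\<lambda>i. ((real i + 1) / 2) powr - (1 + \<alpha>))"
  have S: "S \<ge> 0" unfolding S_def using \<alpha>_pos by (intro mult_nonneg_nonneg suminf_nonneg summable_half_shift) auto
  obtain R g where R: "0 < R" "R \<le> 1" and g: "0 < g" "g \<le> 1" and cell0:
    "(\<integral>\<^sup>+y. ennreal (\<bar>1 - R powr s * \<bar>y\<bar> powr - s\<bar> powr p + R powr s * S * \<bar>1 - R powr s * \<bar>y\<bar> powr - s\<bar> powr (p - 1))
        * indicator {-1/2..1/2} y \<partial>lborel) \<le> ennreal (1 - g)"
    using exists_radius_cell_integral[OF s(1) p Z(1,2) S Z(3)] by blast
  have cell: "(\<integral>\<^sup>+x. ennreal (\<bar>1 - main_part R N x\<bar> powr p) * indicator {0..<1} x \<partial>lborel) \<le> ennreal (1 - g)"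
    if "N > 0" for N
    using order_trans[OF nn_integral_main_part_cell[OF that R(1) p(1) _ S_def] cell0[unfolded s_def]] p by simp
  \<comment> \<open>The tails then decay like \<open>|x|^(-M)\<close> with \<open>M p \<ge> 4\<close>, as \<open>cluster_bounds\<close> requires.\<close>
  define m where "m = nat \<lceil>4 / p\<rceil>"
  have m: "real m * p \<ge> 4"
  proof -
    have "real m \<ge> 4 / p" unfolding m_def by linarith
    then show ?thesis using p by (simp add: field_simps)
  qed
  define M where "M = 1 + \<alpha> + real m"
  have "M * p = p + \<alpha> * p + real m * p" by (simp add: M_def distrib_right)
  then have M: "M * p \<ge> 4" using m p mult_pos_pos[OF \<alpha>_pos p(1)] by linarith
  obtain n :: nat and e l B where e: "\<And>i. i < n \<Longrightarrow> 0 \<le> e i \<and> e i \<le> (1::real)" and B: "B \<ge> 0"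
    and l: "\<And>i y. i < n \<Longrightarrow> y \<in> {0..1} \<Longrightarrow> \<bar>l i y\<bar> \<le> B"
    and rep: "\<And>k y. k < m \<Longrightarrow> y \<in> {0..1} \<Longrightarrow> y ^ k = (\<Sum>i<n. l i y * e i ^ k)"
    using exists_bounded_interpolation[of m] by blast
  define good where "good C \<longleftrightarrow> C \<ge> 0 \<and> (\<forall>y\<in>{0..1}. \<forall>w\<in>{0<..1}. \<forall>x. \<bar>x\<bar> \<ge> 3 \<longrightarrow>
    \<bar>atom w (x - y) - (\<Sum>i<n. l i y * atom w (x - e i))\<bar> \<le> C * \<bar>x\<bar> powr - M)" for C
  have "\<exists>C. good C"
    unfolding good_def M_def by (rule atom_interpolation_error[OF e B l rep])
  then obtain Ce where Ce: "good Ce" ..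
  have Ce0: "Ce \<ge> 0" using Ce unfolding good_def by (rule conjunct1)
  have Ce1: "\<bar>atom w (x - y) - (\<Sum>i<n. l i y * atom w (x - e i))\<bar> \<le> Ce * \<bar>x\<bar> powr - M"
    if "y \<in> {0..1}" "w \<in> {0<..1}" "\<bar>x\<bar> \<ge> 3" for y w x
    using conjunct2[OF Ce[unfolded good_def], rule_format, OF that] .
  define S2 where "S2 = suminf (\<lambda>i. ((real i + 1) / 2) powr - (1 + \<alpha> / 2))"
  define E where "E = 24 * (real n * (24 * atom_const * B) powr p) + 48 * (36 * S2) powr p + Ce powr p"
  have "((\<lambda>N. E * real N powr - (\<alpha> * p / 2)) \<longlongrightarrow> E * 0) sequentially"
    using \<alpha>_pos p by (intro tendsto_mult tendsto_const tendsto_neg_powr filterlim_real_sequentially) auto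
  then have "eventually (\<lambda>N. E * real N powr - (\<alpha> * p / 2) < g / 4 \<and> N > 0) sequentially"
    using order_tendstoD(2)[of _ "E * 0" sequentially "g / 4"] g eventually_gt_at_top[of 0]
    by (auto intro: eventually_conj)
  then obtain N where N: "N > 0" "E * real N powr - (\<alpha> * p / 2) < g / 4"
    by (auto simp: eventually_sequentially)
  have "((\<lambda>w. 24 * (real N * (10 * atom_const * w powr (1 - \<alpha>)) powr p)) \<longlongrightarrow> 24 * (real N * (10 * atom_const * 0 powr (1 - \<alpha>)) powr p)) (at_right 0)"
    using \<alpha>_less p atom_const_pos by (intro tendsto_intros) (auto simp: eventually_at_filter intro!: always_eventually)
  then have "eventually (\<lambda>w. 24 * (real N * (10 * atom_const * w powr (1 - \<alpha>)) powr p) < g / 4) (at_right 0)"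
    using g by (intro order_tendstoD(2)) auto
  then obtain w1 where w1: "w1 > 0" "\<And>w. 0 < w \<Longrightarrow> w < w1 \<Longrightarrow> 24 * (real N * (10 * atom_const * w powr (1 - \<alpha>)) powr p) < g / 4"
    unfolding eventually_at_right_field by auto
  define w0 where "w0 = min 1 (w1 / 2)"
  define c where "c = fill_coeff R N l"
  define b where "b = fill_point N e"
  have w0: "0 < w0" "w0 \<le> 1" "w0 < w1" using w1 by (auto simp: w0_def)
  have main: "(\<integral>\<^sup>+x. ennreal (\<bar>indicator {0..<1} x + cluster (N + n) c b w x\<bar> powr p) \<partial>lborel) \<le> ennreal (1 - g / 2)"
    if w: "w \<in> {0<..w0}" for w
  proof -
    have "(\<integral>\<^sup>+x. ennreal (\<bar>indicator {0..<1} x + cluster (N + n) c b w x\<bar> powr p) \<partial>lborel)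
      \<le> ennreal (1 - g + 24 * (real N * (10 * atom_const * w powr (1 - \<alpha>)) powr p) + E * real N powr - (\<alpha> * p / 2))"
      unfolding c_def b_def E_def
      by (rule nn_integral_cluster_fill_le(1)[OF p R N(1) e B l Ce0 _ Ce1 S2_def cell[OF N(1)] g(2)])
         (use M w w0 in auto)
    also have "\<dots> \<le> ennreal (1 - g / 2)"
      using N(2) w1(2)[of w] w w0 by (intro ennreal_leI) auto
    finally show ?thesis .
  qed
  have bb: "0 \<le> b i \<and> b i \<le> 1" if "i < N + n" for i
    using node_in_unit[of i N] e[of "i - N"] that by (auto simp: b_def fill_point_def)
  define tame where "tame C w \<longleftrightarrow>
     (\<forall>h. \<bar>h\<bar> \<le> 1 \<longrightarrow> (\<integral>\<^sup>+x. ennreal (\<bar>cluster (N + n) c b w (x + h) - cluster (N + n) c b w x\<bar> powr p) \<partial>lborel)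
        \<le> ennreal (C * \<bar>h\<bar> powr ((1 - \<alpha>) * p / 2))) \<and>
     (\<forall>x. \<bar>cluster (N + n) c b w x\<bar> \<le> C * w powr -2 / (1 + x\<^sup>2))" for C w
  have "\<exists>C>0. \<forall>w\<in>{0<..1}. tame C w"
    unfolding tame_def
  proof (rule cluster_bounds[OF bb p M])
    show "\<bar>cluster (N + n) c b w x\<bar> \<le> Ce * real N powr - \<alpha> * \<bar>x\<bar> powr - M"
      if "w \<in> {0<..1}" "\<bar>x\<bar> \<ge> 3" for w x
      unfolding c_def b_def
      by (rule nn_integral_cluster_fill_le(2)[OF p R N(1) e B l Ce0 _ Ce1 S2_def cell[OF N(1)] g(2)])
         (use M that in auto)
  qed (use Ce0 in auto)
  then obtain C where C: "C > 0" "\<And>w. w \<in> {0<..1} \<Longrightarrow> tame C w" by blast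
  have tame: "tame C w" if "w \<in> {0<..w0}" for w using C(2)[of w] that w0 by auto
  show ?thesis
  proof (rule exI[where x = p], rule exI[where x = "1 - g / 2"], rule exI[where x = w0], rule exI[where x = C],
      rule exI[where x = "(1 - \<alpha>) * p / 2"], rule exI[where x = "N + n"], rule exI[where x = c],
      rule exI[where x = b], intro conjI ballI)
    show "0 < (1 - \<alpha>) * p / 2" using \<alpha>_less p by simp
    show "0 < 1 - g / 2" "1 - g / 2 < 1" using g by auto
    show "\<forall>i<N + n. 0 \<le> b i \<and> b i \<le> 1" using bb by blast
    fix w assume w: "w \<in> {0<..w0}"
    show "(\<integral>\<^sup>+x. ennreal (\<bar>indicator {0..<1} x + cluster (N + n) c b w x\<bar> powr p) \<partial>lborel) \<le> ennreal (1 - g / 2)"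
      by (rule main[OF w])
    show "\<forall>h. \<bar>h\<bar> \<le> 1 \<longrightarrow> (\<integral>\<^sup>+x. ennreal (\<bar>cluster (N + n) c b w (x + h) - cluster (N + n) c b w x\<bar> powr p) \<partial>lborel)
        \<le> ennreal (C * \<bar>h\<bar> powr ((1 - \<alpha>) * p / 2))"
      using tame[OF w] unfolding tame_def by (rule conjunct1)
    show "\<forall>x. \<bar>cluster (N + n) c b w x\<bar> \<le> C * w powr -2 / (1 + x\<^sup>2)"
      using tame[OF w] unfolding tame_def by (rule conjunct2)
  qed (fact p(1) p(2) w0(1) w0(2) C(1))+
qed

end

section \<open>The potential of an atom\<close>

lemma integrable_of_nn_integral_le:
  fixes f :: "real \<Rightarrow> real"
  assumes "f \<in> borel_measurable borel" "\<And>x. f x \<ge> 0" "(\<integral>\<^sup>+x. ennreal (f x) \<partial>lborel) \<le> ennreal C"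
  shows "integrable lborel f"
proof (rule integrableI_bounded)
  have "(\<integral>\<^sup>+x. ennreal (norm (f x)) \<partial>lborel) = (\<integral>\<^sup>+x. ennreal (f x) \<partial>lborel)"
    using assms(2) by (intro nn_integral_cong) auto
  also have "\<dots> < \<infinity>" using assms(3) by (rule order_le_less_trans) simp
  finally show "(\<integral>\<^sup>+x. ennreal (norm (f x)) \<partial>lborel) < \<infinity>" .
qed (use assms in auto)

lemma integrable_abs_powr_interval:
  fixes a b c e :: real
  assumes "a \<le> b" "e > -1"
  shows "integrable lborel (\<lambda>x. \<bar>x - c\<bar> powr e * indicator {a..b} x)"
proof (rule integrable_of_nn_integral_le)
  have "(\<integral>\<^sup>+x. ennreal (\<bar>x - c\<bar> powr e) * indicator {a..b} x \<partial>lborel) \<le>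
    ennreal ((sgn (b - c) * \<bar>b - c\<bar> powr (e + 1) - sgn (a - c) * \<bar>a - c\<bar> powr (e + 1)) / (e + 1))"
    by (rule nn_integral_le_of_has_integral[OF has_integral_abs_powr[OF assms], of "{}"]) auto
  then show "(\<integral>\<^sup>+x. ennreal (\<bar>x - c\<bar> powr e * indicator {a..b} x) \<partial>lborel) \<le>
    ennreal ((sgn (b - c) * \<bar>b - c\<bar> powr (e + 1) - sgn (a - c) * \<bar>a - c\<bar> powr (e + 1)) / (e + 1))"
    by (simp add: ennreal_mult' ennreal_indicator)
qed auto

lemma integrable_weight:
  fixes e :: real
  assumes "e > 1"
  shows "integrable lborel (\<lambda>x. (1 + \<bar>x\<bar>) powr - e)"
proof -
  have "integrable lborel (\<lambda>x. (1 + x) powr - e * indicator {0..} x)"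
  proof -
    have "integrable lborel (\<lambda>x. x powr - e * indicator {1..} x)"
    proof (rule integrable_of_nn_integral_le)
      have "((\<lambda>x. x powr - e) has_integral - (1 powr (- e + 1)) / (- e + 1)) {1..}"
        using assms by (intro has_integral_powr_to_inf) auto
      then have "(\<integral>\<^sup>+x. ennreal (x powr - e) * indicator {1..} x \<partial>lborel) \<le> ennreal (- (1 powr (- e + 1)) / (- e + 1))"
        by (rule nn_integral_le_of_has_integral[where N = "{}"]) auto
      then show "(\<integral>\<^sup>+x. ennreal (x powr - e * indicator {1..} x) \<partial>lborel) \<le> ennreal (- (1 powr (- e + 1)) / (- e + 1))"
        by (simp add: ennreal_mult' ennreal_indicator)
    qed auto
    then have "integrable lborel (\<lambda>x. (1 + 1 * x) powr - e * indicator {1..} (1 + 1 * x))"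
      by (rule lborel_integrable_real_affine) auto
    moreover have "(indicator {1..} (1 + 1 * x) :: real) = indicator {0..} x" for x :: real by (auto simp: indicator_def)
    ultimately show ?thesis by simp
  qed
  note half = this
  have "integrable lborel (\<lambda>x. (1 + (0 + (-1) * x)) powr - e * indicator {0..} (0 + (-1) * x))"
    using half by (rule lborel_integrable_real_affine) auto
  then have "integrable lborel (\<lambda>x. (1 + x) powr - e * indicator {0..} x + (1 + (0 + (-1) * x)) powr - e * indicator {0..} (0 + (-1) * x))"
    using half by (intro Bochner_Integration.integrable_add)
  then show ?thesis
    by (rule Bochner_Integration.integrable_bound) (auto simp: indicator_def)
qed

text \<open>Used for moving the ends of a truncated integral by a bounded amount.\<close>

lemma tendsto_integral_edge:
  fixes q :: "real \<Rightarrow> real"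
  assumes q: "(q \<longlongrightarrow> 0) at_top" and w: "w \<ge> 0" and m: "q \<in> borel_measurable borel"
  shows "((\<lambda>T. \<integral>x. q x * indicator {T<..T + w} x \<partial>lborel) \<longlongrightarrow> 0) at_top"
proof (rule tendstoI)
  fix e :: real assume e: "e > 0"
  define d where "d = e / (w + 1)"
  have d: "d > 0" "d * w < e" using e w by (auto simp: d_def field_simps)
  have "eventually (\<lambda>x. \<bar>q x\<bar> < d) at_top"
    using tendstoD[OF q d(1)] by (simp add: dist_real_def)
  then obtain X where X: "\<And>x. x \<ge> X \<Longrightarrow> \<bar>q x\<bar> < d" by (auto simp: eventually_at_top_linorder)
  have "norm (\<integral>x. q x * indicator {T<..T + w} x \<partial>lborel) \<le> d * w" if T: "T \<ge> X" for T
  proof -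
    have i: "integrable lborel (\<lambda>x. d * indicator {T<..T + w} x)"
      using w by (intro integrable_mult_right integrable_real_indicator) auto
    have b: "norm (q x * indicator {T<..T + w} x) \<le> d * indicator {T<..T + w} x" for x
      using X[of x] T by (auto simp: indicator_def)
    have "norm (\<integral>x. q x * indicator {T<..T + w} x \<partial>lborel) \<le> (\<integral>x. norm (q x * indicator {T<..T + w} x) \<partial>lborel)"
      by (rule integral_norm_bound)
    also have "\<dots> \<le> (\<integral>x. d * indicator {T<..T + w} x \<partial>lborel)"
      using i b d(1) by (intro integral_mono') auto
    also have "\<dots> = d * w" using w by simp
    finally show ?thesis .
  qed
  then have "dist (\<integral>x. q x * indicator {T<..T + w} x \<partial>lborel) 0 < e" if "T \<ge> X" for T
    using d that by (simp add: dist_real_def) (meson order_le_less_trans)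
  then show "eventually (\<lambda>T. dist (\<integral>x. q x * indicator {T<..T + w} x \<partial>lborel) 0 < e) at_top"
    by (auto simp: eventually_at_top_linorder)
qed

context riesz_order begin

text \<open>The integrand of the potential of \<open>|x|^(1-\<alpha>)\<close> at the point \<open>a\<close>, with its limit 1 at infinity subtracted, without which the symmetric integrals would diverge.\<close>

definition ratio_kernel :: "real \<Rightarrow> real \<Rightarrow> real" where
  "ratio_kernel a x = \<bar>a - x\<bar> powr - (1 - \<alpha>) * \<bar>x\<bar> powr (1 - \<alpha>) - 1"

definition ratio_integral :: "real \<Rightarrow> real \<Rightarrow> real \<Rightarrow> real" where
  "ratio_integral a c d = (\<integral>x. ratio_kernel a x * indicator {c<..d} x \<partial>lborel)"

lemma ratio_kernel_measurable [measurable]: "ratio_kernel a \<in> borel_measurable borel"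
  unfolding ratio_kernel_def by measurable

lemma integrable_ratio_kernel:
  "integrable lborel (\<lambda>x. ratio_kernel a x * indicator {c<..d} x)"
proof (cases "c \<le> d")
  case True
  define B where "B = (\<bar>c\<bar> + \<bar>d\<bar>) powr (1 - \<alpha>)"
  have "integrable lborel (\<lambda>x. B * (\<bar>x - a\<bar> powr - (1 - \<alpha>) * indicator {c..d} x) + indicator {c..d} x)"
    using \<alpha>_pos True by (intro Bochner_Integration.integrable_add integrable_mult_right
       integrable_abs_powr_interval integrable_real_indicator) auto
  then show ?thesis
  proof (rule Bochner_Integration.integrable_bound)
    show "AE x in lborel. norm (ratio_kernel a x * indicator {c<..d} x)
      \<le> norm (B * (\<bar>x - a\<bar> powr - (1 - \<alpha>) * indicator {c..d} x) + indicator {c..d} x)"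
    proof (rule AE_I2)
      fix x
      show "norm (ratio_kernel a x * indicator {c<..d} x)
        \<le> norm (B * (\<bar>x - a\<bar> powr - (1 - \<alpha>) * indicator {c..d} x) + indicator {c..d} x)"
      proof (cases "x \<in> {c<..d}")
        case True
        then have "\<bar>x\<bar> \<le> \<bar>c\<bar> + \<bar>d\<bar>" by auto
        then have "\<bar>x\<bar> powr (1 - \<alpha>) \<le> B" unfolding B_def using \<alpha>_less by (intro powr_mono2) auto
        then have "\<bar>a - x\<bar> powr - (1 - \<alpha>) * \<bar>x\<bar> powr (1 - \<alpha>) \<le> \<bar>a - x\<bar> powr - (1 - \<alpha>) * B"
          by (intro mult_left_mono) auto
        moreover have "0 \<le> \<bar>a - x\<bar> powr - (1 - \<alpha>) * \<bar>x\<bar> powr (1 - \<alpha>)" by simp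
        ultimately have "\<bar>ratio_kernel a x\<bar> \<le> B * \<bar>x - a\<bar> powr - (1 - \<alpha>) + 1"
          unfolding ratio_kernel_def abs_minus_commute[of x a] by (simp only: mult.commute)
        then show ?thesis using True by (simp add: B_def)
      qed simp
    qed
  qed auto
qed simp

lemma ratio_integral_split:
  assumes "c \<le> e" "e \<le> d"
  shows "ratio_integral a c d = ratio_integral a c e + ratio_integral a e d"
proof -
  have "ratio_kernel a x * indicator {c<..d} x = ratio_kernel a x * indicator {c<..e} x + ratio_kernel a x * indicator {e<..d} x" for x
    using assms by (auto simp: indicator_def)
  then show ?thesis unfolding ratio_integral_def by (simp add: integrable_ratio_kernel)
qed

text \<open>The kernel is homogeneous of degree 0 in \<open>(a, x)\<close>, since the exponent of \<open>|x|^(1-\<alpha>)\<close> is opposite to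
  that of the Riesz kernel.\<close>

lemma ratio_integral_scale:
  assumes a: "a > 0"
  shows "ratio_integral a (- T) T = a * ratio_integral 1 (- (T / a)) (T / a)"
proof -
  have "ratio_kernel a (0 + a * x) * indicator {- T<..T} (0 + a * x) = ratio_kernel 1 x * indicator {- (T / a)<..T / a} x" for x
  proof -
    have c: "a powr - (1 - \<alpha>) * a powr (1 - \<alpha>) = 1" using a by (simp only: powr_add[symmetric]) simp
    have "a - a * x = a * (1 - x)" by (simp add: algebra_simps)
    then have "\<bar>a - (0 + a * x)\<bar> = a * \<bar>1 - x\<bar>" using a by (simp add: abs_mult)
    moreover have "\<bar>0 + a * x\<bar> = a * \<bar>x\<bar>" using a by (simp add: abs_mult)
    ultimately have "ratio_kernel a (0 + a * x) =
      (a powr - (1 - \<alpha>) * a powr (1 - \<alpha>)) * (\<bar>1 - x\<bar> powr - (1 - \<alpha>) * \<bar>x\<bar> powr (1 - \<alpha>)) - 1"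
      unfolding ratio_kernel_def by (simp only: powr_mult mult_ac)
    then have "ratio_kernel a (0 + a * x) = ratio_kernel 1 x" unfolding c by (simp add: ratio_kernel_def)
    moreover have "(indicator {- T<..T} (0 + a * x) :: real) = indicator {- (T / a)<..T / a} x"
      using a by (auto simp: indicator_def field_simps)
    ultimately show ?thesis by simp
  qed
  then show ?thesis unfolding ratio_integral_def
    using a by (subst lborel_integral_real_affine[where c = a and t = 0]) auto
qed

lemma ratio_kernel_tendsto_0: "((\<lambda>x. ratio_kernel a x) \<longlongrightarrow> 0) at_top" "((\<lambda>x. ratio_kernel a (- x)) \<longlongrightarrow> 0) at_top"
proof -
  have 1: "((\<lambda>x. \<bar>a / x - 1\<bar> powr - (1 - \<alpha>) - 1) \<longlongrightarrow> \<bar>0 - 1\<bar> powr - (1 - \<alpha>) - 1) F"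
    if "filterlim (\<lambda>x. x) at_infinity F" for F
    by (intro tendsto_intros tendsto_divide_0[OF tendsto_const that]) auto
  have eq: "ratio_kernel a x = \<bar>a / x - 1\<bar> powr - (1 - \<alpha>) - 1" if "x \<noteq> 0" for x
  proof -
    have "\<bar>a - x\<bar> = \<bar>a / x - 1\<bar> * \<bar>x\<bar>" using that unfolding abs_mult[symmetric] by (simp add: algebra_simps)
    then have "ratio_kernel a x = \<bar>a / x - 1\<bar> powr - (1 - \<alpha>) * (\<bar>x\<bar> powr - (1 - \<alpha>) * \<bar>x\<bar> powr (1 - \<alpha>)) - 1"
      unfolding ratio_kernel_def by (simp add: powr_mult)
    also have "\<bar>x\<bar> powr - (1 - \<alpha>) * \<bar>x\<bar> powr (1 - \<alpha>) = 1"
      using that by (simp only: powr_add[symmetric]) simp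
    finally show ?thesis by simp
  qed
  have top: "(ratio_kernel a \<longlongrightarrow> 0) at_top"
  proof (rule Lim_transform_eventually)
    show "((\<lambda>x. \<bar>a / x - 1\<bar> powr - (1 - \<alpha>) - 1) \<longlongrightarrow> 0) at_top"
      using 1[of at_top] at_top_le_at_infinity by (simp add: filterlim_def)
    show "eventually (\<lambda>x. \<bar>a / x - 1\<bar> powr - (1 - \<alpha>) - 1 = ratio_kernel a x) at_top"
      using eventually_gt_at_top[of 0] by eventually_elim (simp add: eq)
  qed
  then show "((\<lambda>x. ratio_kernel a x) \<longlongrightarrow> 0) at_top" .
  have bot: "(ratio_kernel a \<longlongrightarrow> 0) at_bot"
  proof (rule Lim_transform_eventually)
    show "((\<lambda>x. \<bar>a / x - 1\<bar> powr - (1 - \<alpha>) - 1) \<longlongrightarrow> 0) at_bot"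
      using 1[of at_bot] at_bot_le_at_infinity by (simp add: filterlim_def)
    show "eventually (\<lambda>x. \<bar>a / x - 1\<bar> powr - (1 - \<alpha>) - 1 = ratio_kernel a x) at_bot"
      using eventually_gt_at_bot[of 0] by eventually_elim (simp add: eq)
  qed
  show "((\<lambda>x. ratio_kernel a (- x)) \<longlongrightarrow> 0) at_top"
    by (rule filterlim_compose[OF bot filterlim_uminus_at_bot_at_top])
qed

text \<open>The first-order terms in \<open>1 / x\<close> of the kernel at \<open>x\<close> and at \<open>- x\<close> cancel, so the sum of the two is
  \<open>O (x^(-2))\<close> and symmetric integrals converge.\<close>

lemma ratio_integral_1_converges: "\<exists>L. ((\<lambda>T. ratio_integral 1 (- T) T) \<longlongrightarrow> L) at_top"
proof -
  \<comment> \<open>The kernel folded onto the positive half-line.\<close>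
  define h where "h x = (ratio_kernel 1 x + ratio_kernel 1 (- x)) * indicator {0<..} x" for x
  have hm [measurable]: "h \<in> borel_measurable borel" unfolding h_def by measurable
  obtain C where C: "C \<ge> 0" "\<And>z. \<bar>z\<bar> \<le> 1/2 \<Longrightarrow> \<bar>(1 + z) powr - (1 - \<alpha>) - (\<Sum>k<2. (- (1 - \<alpha>) gchoose k) * z ^ k)\<bar> \<le> C * \<bar>z\<bar>\<^sup>2"
    using binomial_remainder[of "- (1 - \<alpha>)" 2] by auto
  have far: "\<bar>h x\<bar> \<le> 2 * C * 9 * (1 + \<bar>x\<bar>) powr -2" if x: "x > 2" for x
  proof -
    define z where "z = 1 / x"
    have z: "0 < z" "z \<le> 1/2" using x by (auto simp: z_def field_simps)
    have r: "ratio_kernel 1 x = (1 - z) powr - (1 - \<alpha>) - 1" "ratio_kernel 1 (- x) = (1 + z) powr - (1 - \<alpha>) - 1"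
    proof -
      have c: "x powr - (1 - \<alpha>) * x powr (1 - \<alpha>) = 1" using x by (simp only: powr_add[symmetric]) simp
      have "\<bar>1 - x\<bar> = (1 - z) * x" "\<bar>1 - (- x)\<bar> = (1 + z) * x" using x by (auto simp: z_def field_simps)
      then show "ratio_kernel 1 x = (1 - z) powr - (1 - \<alpha>) - 1" "ratio_kernel 1 (- x) = (1 + z) powr - (1 - \<alpha>) - 1"
        unfolding ratio_kernel_def using x c by (simp_all only: powr_mult abs_minus_cancel abs_of_pos mult.assoc)
    qed
    have "\<bar>(1 + z) powr - (1 - \<alpha>) - (1 + - (1 - \<alpha>) * z)\<bar> \<le> C * z\<^sup>2"
      using C(2)[of z] z by (simp add: numeral_2_eq_2)
    moreover have "\<bar>(1 - z) powr - (1 - \<alpha>) - (1 + - (1 - \<alpha>) * (- z))\<bar> \<le> C * z\<^sup>2"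
      using C(2)[of "- z"] z by (simp add: numeral_2_eq_2)
    ultimately have "\<bar>ratio_kernel 1 x + ratio_kernel 1 (- x)\<bar> \<le> 2 * (C * z\<^sup>2)"
      unfolding r by (simp add: abs_le_iff)
    also have "z\<^sup>2 = 1 / x\<^sup>2" by (simp add: z_def power_divide)
    also have "1 / x\<^sup>2 \<le> 9 / (1 + \<bar>x\<bar>)\<^sup>2"
    proof -
      have "(1 + \<bar>x\<bar>)\<^sup>2 \<le> (3 * x)\<^sup>2" using x by (intro power_mono) auto
      then show ?thesis using x by (simp add: field_simps power_mult_distrib)
    qed
    also have "9 / (1 + \<bar>x\<bar>)\<^sup>2 = 9 * (1 + \<bar>x\<bar>) powr -2" by (simp add: powr_minus powr_numeral divide_inverse)
    finally have "\<bar>ratio_kernel 1 x + ratio_kernel 1 (- x)\<bar> \<le> 2 * (C * (9 * (1 + \<bar>x\<bar>) powr - 2))"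
      using C(1) by (simp add: mult_left_mono)
    then show ?thesis using x by (simp add: h_def)
  qed
  have i2: "integrable lborel (\<lambda>x. ratio_kernel 1 (- x) * indicator {0<..2} x)"
  proof -
    have "integrable lborel (\<lambda>x. ratio_kernel 1 (0 + (-1) * x) * indicator {-3<..3} (0 + (-1) * x))"
      using integrable_ratio_kernel by (rule lborel_integrable_real_affine) auto
    then show ?thesis by (rule Bochner_Integration.integrable_bound) (auto simp: indicator_def)
  qed
  have "integrable lborel (\<lambda>x. (\<bar>ratio_kernel 1 x * indicator {0<..2} x\<bar> + \<bar>ratio_kernel 1 (- x) * indicator {0<..2} x\<bar>)
     + 2 * C * 9 * (1 + \<bar>x\<bar>) powr -2)"
    by (intro Bochner_Integration.integrable_add integrable_mult_right integrable_weight integrable_abs integrable_ratio_kernel i2) auto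
  then have hi: "integrable lborel h"
  proof (rule Bochner_Integration.integrable_bound)
    show "AE x in lborel. norm (h x) \<le> norm ((\<bar>ratio_kernel 1 x * indicator {0<..2} x\<bar> + \<bar>ratio_kernel 1 (- x) * indicator {0<..2} x\<bar>)
     + 2 * C * 9 * (1 + \<bar>x\<bar>) powr -2)"
    proof (rule AE_I2)
      fix x
      have nn: "0 \<le> 2 * C * 9 * (1 + \<bar>x\<bar>) powr -2" using C by simp
      show "norm (h x) \<le> norm ((\<bar>ratio_kernel 1 x * indicator {0<..2} x\<bar> + \<bar>ratio_kernel 1 (- x) * indicator {0<..2} x\<bar>)
         + 2 * C * 9 * (1 + \<bar>x\<bar>) powr -2)"
      proof (cases "x > 2")
        case True
        then show ?thesis using far[OF True] nn by simp
      next
        case False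
        show ?thesis
        proof (cases "x > 0")
          case True
          have "\<bar>h x\<bar> \<le> \<bar>ratio_kernel 1 x\<bar> + \<bar>ratio_kernel 1 (- x)\<bar>" using True by (simp add: h_def)
          then show ?thesis using True False nn by simp
        qed (simp add: h_def)
      qed
    qed
  qed simp
  have "((\<lambda>T. \<integral>x. indicator {..T} x *\<^sub>R h x \<partial>lborel) \<longlongrightarrow> (\<integral>x. h x \<partial>lborel)) at_top"
    by (rule tendsto_integral_at_top[OF _ hi]) simp
  moreover have "eventually (\<lambda>T. (\<integral>x. indicator {..T} x *\<^sub>R h x \<partial>lborel) = ratio_integral 1 (- T) T) at_top"
    using eventually_gt_at_top[of 0]
  proof eventually_elim
    case (elim T)
    have i1: "integrable lborel (\<lambda>x. ratio_kernel 1 (0 + (-1) * x) * indicator {- T<..0} (0 + (-1) * x))"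
      using integrable_ratio_kernel by (rule lborel_integrable_real_affine) auto
    have "ratio_integral 1 (- T) T = ratio_integral 1 (- T) 0 + ratio_integral 1 0 T"
      using elim by (intro ratio_integral_split) auto
    also have "ratio_integral 1 (- T) 0 = (\<integral>x. ratio_kernel 1 (0 + (-1) * x) * indicator {- T<..0} (0 + (-1) * x) \<partial>lborel)"
      unfolding ratio_integral_def by (subst lborel_integral_real_affine[where c = "-1" and t = 0]) auto
    also have "\<dots> + ratio_integral 1 0 T = (\<integral>x. ratio_kernel 1 (0 + (-1) * x) * indicator {- T<..0} (0 + (-1) * x)
        + ratio_kernel 1 x * indicator {0<..T} x \<partial>lborel)"
      unfolding ratio_integral_def
      by (rule Bochner_Integration.integral_add[symmetric, OF i1 integrable_ratio_kernel])
    also have "\<dots> = (\<integral>x. indicator {..T} x *\<^sub>R h x \<partial>lborel)"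
    proof (rule integral_cong_AE)
      have "AE x in lborel. x \<notin> {0, T}" by (intro AE_not_in finite_imp_null_set_lborel) auto
      then show "AE x in lborel. ratio_kernel 1 (0 + (-1) * x) * indicator {- T<..0} (0 + (-1) * x)
        + ratio_kernel 1 x * indicator {0<..T} x = indicator {..T} x *\<^sub>R h x"
        by eventually_elim (auto simp: h_def indicator_def)
    qed auto
    finally show ?case by simp
  qed
  ultimately show ?thesis by (blast intro: Lim_transform_eventually)
qed

lemma atom_weight_le:
  assumes w: "w > 0"
  shows "\<bar>atom w x\<bar> \<le> 16 * atom_const * (1 + w powr - (1 + \<alpha>)) * (1 + \<bar>x\<bar>) powr - (1 + \<alpha>)"
proof -
  define W where "W = (1 + \<bar>x\<bar>) powr - (1 + \<alpha>)"
  have W: "W \<ge> 0" "w powr - (1 + \<alpha>) \<ge> 0" by (auto simp: W_def)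
  have W4: "u powr - (1 + \<alpha>) \<le> 4 * W" if "(1 + \<bar>x\<bar>) / 2 \<le> u" for u
  proof -
    have "u powr - (1 + \<alpha>) \<le> ((1 + \<bar>x\<bar>) / 2) powr - (1 + \<alpha>)" using that \<alpha>_pos by (intro powr_mono2') auto
    also have "\<dots> = 2 powr (1 + \<alpha>) * W" unfolding W_def by (rule divide_powr_minus) auto
    also have "\<dots> \<le> 2 powr 2 * W" using W \<alpha>_less by (intro mult_right_mono powr_mono) auto
    finally show ?thesis by (simp add: powr_numeral)
  qed
  have "\<bar>atom w x\<bar> \<le> 16 * atom_const * (1 + w powr - (1 + \<alpha>)) * W"
  proof (cases "\<bar>x\<bar> \<ge> 1")
    case True
    then have "\<bar>atom w x\<bar> \<le> 4 * atom_const * K x" using w by (intro atom_le) auto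
    also have "\<dots> \<le> 4 * atom_const * (4 * W)" unfolding K_def using True atom_const_pos by (intro mult_left_mono W4) auto
    also have "\<dots> = (16 * atom_const * 1) * W" by simp
    also have "\<dots> \<le> 16 * atom_const * (1 + w powr - (1 + \<alpha>)) * W"
      using W atom_const_pos by (intro mult_right_mono mult_left_mono) auto
    finally show ?thesis .
  next
    case False
    have "\<bar>atom w x\<bar> \<le> atom_const * w powr - (1 + \<alpha>) * 1" using atom_le_width[OF w, of x] by simp
    also have "\<dots> \<le> atom_const * w powr - (1 + \<alpha>) * (4 * W)"
      using W4[of 1] False atom_const_pos W by (intro mult_left_mono) auto
    also have "\<dots> = (4 * atom_const * w powr - (1 + \<alpha>)) * W" by simp
    also have "\<dots> \<le> (16 * atom_const * (1 + w powr - (1 + \<alpha>))) * W"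
      using W atom_const_pos by (intro mult_right_mono mult_mono) auto
    finally show ?thesis .
  qed
  then show ?thesis by (simp only: W_def)
qed

text \<open>The singularity at \<open>t\<close> is integrable, and outside the unit neighbourhood of \<open>t\<close> the Riesz kernel is at most 1.\<close>

lemma integrable_riesz:
  fixes g :: "real \<Rightarrow> real"
  assumes g [measurable]: "g \<in> borel_measurable borel"
    and le: "\<And>x. \<bar>g x\<bar> \<le> C * (1 + \<bar>x\<bar>) powr - (1 + \<alpha>)"
  shows "integrable lborel (\<lambda>x. g x * \<bar>t - x\<bar> powr - (1 - \<alpha>))"
proof -
  define W where "W x = (1 + \<bar>x\<bar>) powr - (1 + \<alpha>)" for x :: real
  have W: "0 \<le> W x" "W x \<le> 1" for x
    using powr_mono2'[of "- (1 + \<alpha>)" 1 "1 + \<bar>x\<bar>"] \<alpha>_pos by (auto simp: W_def)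
  have C: "C \<ge> 0" using le[of 0] by (simp add: order_trans[OF abs_ge_zero])
  have "integrable lborel (\<lambda>x. C * (W x + \<bar>x - t\<bar> powr - (1 - \<alpha>) * indicator {t - 1..t + 1} x))"
    unfolding W_def using \<alpha>_pos
    by (intro integrable_mult_right Bochner_Integration.integrable_add integrable_weight integrable_abs_powr_interval) auto
  then show ?thesis
  proof (rule Bochner_Integration.integrable_bound)
    show "AE x in lborel. norm (g x * \<bar>t - x\<bar> powr - (1 - \<alpha>))
      \<le> norm (C * (W x + \<bar>x - t\<bar> powr - (1 - \<alpha>) * indicator {t - 1..t + 1} x))"
    proof (rule AE_I2)
      fix x
      have "\<bar>g x * \<bar>t - x\<bar> powr - (1 - \<alpha>)\<bar> \<le> (C * W x) * \<bar>x - t\<bar> powr - (1 - \<alpha>)"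
        using le[of x] unfolding W_def abs_mult abs_minus_commute[of t x] by (simp add: mult_right_mono)
      also have "\<dots> = C * (W x * \<bar>x - t\<bar> powr - (1 - \<alpha>))" by simp
      also have "\<dots> \<le> C * (W x + \<bar>x - t\<bar> powr - (1 - \<alpha>) * indicator {t - 1..t + 1} x)"
      proof (intro mult_left_mono C)
        show "W x * \<bar>x - t\<bar> powr - (1 - \<alpha>) \<le> W x + \<bar>x - t\<bar> powr - (1 - \<alpha>) * indicator {t - 1..t + 1} x"
        proof (cases "x \<in> {t - 1..t + 1}")
          case True
          have "W x * \<bar>x - t\<bar> powr - (1 - \<alpha>) \<le> 1 * \<bar>x - t\<bar> powr - (1 - \<alpha>)" using W by (intro mult_right_mono) auto
          then show ?thesis using True W(1)[of x] by simp
        next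
          case False
          then have "\<bar>x - t\<bar> powr - (1 - \<alpha>) \<le> 1"
            using powr_mono2'[of "- (1 - \<alpha>)" 1 "\<bar>x - t\<bar>"] \<alpha>_less by auto
          then show ?thesis using False W(1)[of x] mult_left_mono[of "\<bar>x - t\<bar> powr - (1 - \<alpha>)" 1 "W x"] by simp
        qed
      qed
      finally show "norm (g x * \<bar>t - x\<bar> powr - (1 - \<alpha>))
        \<le> norm (C * (W x + \<bar>x - t\<bar> powr - (1 - \<alpha>) * indicator {t - 1..t + 1} x))"
        by (simp only: real_norm_def)
    qed
  qed simp
qed

lemma atom_integrable_riesz:
  assumes "w > 0"
  shows "integrable lborel (\<lambda>x. atom w x * \<bar>t - x\<bar> powr - (1 - \<alpha>))"
  by (rule integrable_riesz[OF atom_measurable atom_weight_le[OF assms]])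

text \<open>The limit as a function of \<open>a\<close> is linear on \<open>a \<ge> 0\<close>, and it does not
  notice a bounded shift of the interval because the kernel tends to 0.\<close>

lemma ratio_integral_shifted_limit:
  assumes a: "a \<ge> 0" and w: "w \<ge> 0" and L: "((\<lambda>T. ratio_integral 1 (- T) T) \<longlongrightarrow> L) at_top"
  shows "((\<lambda>T. ratio_integral a (- T + w) (T + w)) \<longlongrightarrow> a * L) at_top"
    "((\<lambda>T. ratio_integral a (- T - w) (T - w)) \<longlongrightarrow> a * L) at_top"
proof -
  have base: "((\<lambda>T. ratio_integral a (- T) T) \<longlongrightarrow> a * L) at_top"
  proof (cases "a = 0")
    case True
    have "ratio_integral 0 c d = 0" for c d
      unfolding ratio_integral_def
    proof (rule integral_eq_zero_AE)
      have "AE x in lborel. x \<notin> {0}" by (intro AE_not_in finite_imp_null_set_lborel) auto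
      then show "AE x in lborel. ratio_kernel 0 x * indicator {c<..d} x = 0"
      proof eventually_elim
        case (elim x)
        then have "\<bar>x\<bar> powr - (1 - \<alpha>) * \<bar>x\<bar> powr (1 - \<alpha>) = 1" by (simp only: powr_add[symmetric]) simp
        then show ?case by (simp add: ratio_kernel_def)
      qed
    qed
    then show ?thesis using True by simp
  next
    case False
    then have a: "a > 0" using a by simp
    have "((\<lambda>T. ratio_integral 1 (- (T / a)) (T / a)) \<longlongrightarrow> L) at_top"
      by (rule filterlim_compose[OF L]) (use a in \<open>auto intro!: filterlim_tendsto_pos_mult_at_top[OF tendsto_const _ filterlim_ident, of "1 / a", simplified]\<close>)
    then have "((\<lambda>T. a * ratio_integral 1 (- (T / a)) (T / a)) \<longlongrightarrow> a * L) at_top"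
      by (intro tendsto_mult_left)
    then show ?thesis by (simp add: ratio_integral_scale[OF a])
  qed
  have E1: "((\<lambda>T. ratio_integral a T (T + w)) \<longlongrightarrow> 0) at_top"
    unfolding ratio_integral_def by (rule tendsto_integral_edge[OF ratio_kernel_tendsto_0(1) w]) simp
  have "((\<lambda>T. \<integral>x. ratio_kernel a (- x) * indicator {T<..T + w} x \<partial>lborel) \<longlongrightarrow> 0) at_top"
    by (rule tendsto_integral_edge[OF ratio_kernel_tendsto_0(2) w]) simp
  moreover have "(\<integral>x. ratio_kernel a (- x) * indicator {T<..T + w} x \<partial>lborel) = ratio_integral a (- T - w) (- T)" for T
  proof -
    have "ratio_integral a (- T - w) (- T) = (\<integral>x. ratio_kernel a (0 + (-1) * x) * indicator {- T - w<..- T} (0 + (-1) * x) \<partial>lborel)"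
      unfolding ratio_integral_def by (subst lborel_integral_real_affine[where c = "-1" and t = 0]) auto
    also have "\<dots> = (\<integral>x. ratio_kernel a (- x) * indicator {T<..T + w} x \<partial>lborel)"
    proof (rule integral_cong_AE)
      have "AE x in lborel. x \<notin> {T, T + w}" by (intro AE_not_in finite_imp_null_set_lborel) auto
      then show "AE x in lborel. ratio_kernel a (0 + (-1) * x) * indicator {- T - w<..- T} (0 + (-1) * x)
         = ratio_kernel a (- x) * indicator {T<..T + w} x"
        by eventually_elim (auto simp: indicator_def)
    qed auto
    finally show ?thesis ..
  qed
  ultimately have E2: "((\<lambda>T. ratio_integral a (- T - w) (- T)) \<longlongrightarrow> 0) at_top" by simp
  have sh: "filterlim (\<lambda>T. T - w) at_top at_top"
    by (rule filterlim_at_top_mono[of "\<lambda>T. - w + T", OF filterlim_tendsto_add_at_top[OF tendsto_const filterlim_ident]]) auto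
  have E1': "((\<lambda>T. ratio_integral a (T - w) T) \<longlongrightarrow> 0) at_top"
    using filterlim_compose[OF E1 sh] by simp
  have E2': "((\<lambda>T. ratio_integral a (- T) (- T + w)) \<longlongrightarrow> 0) at_top"
    using filterlim_compose[OF E2 sh] by (simp add: algebra_simps)
  have "((\<lambda>T. ratio_integral a (- T) T + ratio_integral a T (T + w) - ratio_integral a (- T) (- T + w)) \<longlongrightarrow> a * L + 0 - 0) at_top"
    by (intro tendsto_intros base E1 E2')
  moreover have "eventually (\<lambda>T. ratio_integral a (- T) T + ratio_integral a T (T + w) - ratio_integral a (- T) (- T + w)
      = ratio_integral a (- T + w) (T + w)) at_top"
    using eventually_ge_at_top[of w]
  proof eventually_elim
    case (elim T)
    have "ratio_integral a (- T) (T + w) = ratio_integral a (- T) T + ratio_integral a T (T + w)"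
      using elim w by (intro ratio_integral_split) auto
    moreover have "ratio_integral a (- T) (T + w) = ratio_integral a (- T) (- T + w) + ratio_integral a (- T + w) (T + w)"
      using elim w by (intro ratio_integral_split) auto
    ultimately show ?case by simp
  qed
  ultimately show "((\<lambda>T. ratio_integral a (- T + w) (T + w)) \<longlongrightarrow> a * L) at_top"
    using Lim_transform_eventually by fastforce
  have "((\<lambda>T. ratio_integral a (- T) T + ratio_integral a (- T - w) (- T) - ratio_integral a (T - w) T) \<longlongrightarrow> a * L + 0 - 0) at_top"
    by (intro tendsto_intros base E1' E2)
  moreover have "eventually (\<lambda>T. ratio_integral a (- T) T + ratio_integral a (- T - w) (- T) - ratio_integral a (T - w) T
      = ratio_integral a (- T - w) (T - w)) at_top"
    using eventually_ge_at_top[of w]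
  proof eventually_elim
    case (elim T)
    have "ratio_integral a (- T - w) T = ratio_integral a (- T - w) (- T) + ratio_integral a (- T) T"
      using elim w by (intro ratio_integral_split) auto
    moreover have "ratio_integral a (- T - w) T = ratio_integral a (- T - w) (T - w) + ratio_integral a (T - w) T"
      using elim w by (intro ratio_integral_split) auto
    ultimately show ?case by simp
  qed
  ultimately show "((\<lambda>T. ratio_integral a (- T - w) (T - w)) \<longlongrightarrow> a * L) at_top"
    using Lim_transform_eventually by fastforce
qed

text \<open>For \<open>t \<ge> w\<close> the three points \<open>t\<close>, \<open>t - w\<close>, \<open>t + w\<close> are nonnegative, and the truncated
  potential is a second difference of three regularised integrals, in which the subtracted constants cancel. Their limits are \<open>t L\<close>, \<open>(t - w) L\<close>
  and \<open>(t + w) L\<close>, with second difference 0.\<close>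

lemma atom_potential_vanishes:
  assumes w: "w > 0" and t: "\<bar>t\<bar> \<ge> w"
  shows "(\<integral>x. atom w x * \<bar>t - x\<bar> powr - (1 - \<alpha>) \<partial>lborel) = 0"
proof -
  have pos: "(\<integral>x. atom w x * \<bar>t - x\<bar> powr - (1 - \<alpha>) \<partial>lborel) = 0" if t: "t \<ge> w" for t
  proof -
    define F where "F x = atom w x * \<bar>t - x\<bar> powr - (1 - \<alpha>)" for x
    have Fi: "integrable lborel F" unfolding F_def by (rule atom_integrable_riesz[OF w])
    define c where "c = 1 / (\<alpha> * (1 - \<alpha>) * w\<^sup>2)"
    obtain L where L: "((\<lambda>T. ratio_integral 1 (- T) T) \<longlongrightarrow> L) at_top" using ratio_integral_1_converges by blast
    define R where "R T = c * (2 * ratio_integral t (- T) T - ratio_integral (t - w) (- T - w) (T - w) - ratio_integral (t + w) (- T + w) (T + w))" for T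
    have "(R \<longlongrightarrow> c * (2 * (t * L) - (t - w) * L - (t + w) * L)) at_top"
      unfolding R_def using t w ratio_integral_shifted_limit(1)[OF _ _ L, of t 0]
      by (intro tendsto_intros ratio_integral_shifted_limit[OF _ _ L]) auto
    also have "c * (2 * (t * L) - (t - w) * L - (t + w) * L) = 0" by (simp add: algebra_simps)
    finally have "(\<lambda>n. R (real n)) \<longlonglongrightarrow> 0" by (rule filterlim_compose[OF _ filterlim_real_sequentially])
    \<comment> \<open>Substituting \<open>x \<mapsto> x \<plusminus> w\<close> turns the two outer terms of the atom into ratio kernels at \<open>t \<plusminus> w\<close>, on shifted
      intervals.\<close>
    moreover have "R T = (\<integral>x. F x * indicator {- T<..T} x \<partial>lborel)" for T
    proof -
      have s1: "ratio_integral (t - w) (- T - w) (T - w) = (\<integral>x. ratio_kernel (t - w) (- w + 1 * x) * indicator {- T - w<..T - w} (- w + 1 * x) \<partial>lborel)"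
        unfolding ratio_integral_def by (subst lborel_integral_real_affine[where c = 1 and t = "- w"]) auto
      have i1: "integrable lborel (\<lambda>x. ratio_kernel (t - w) (- w + 1 * x) * indicator {- T - w<..T - w} (- w + 1 * x))"
        using integrable_ratio_kernel by (rule lborel_integrable_real_affine) auto
      have s2: "ratio_integral (t + w) (- T + w) (T + w) = (\<integral>x. ratio_kernel (t + w) (w + 1 * x) * indicator {- T + w<..T + w} (w + 1 * x) \<partial>lborel)"
        unfolding ratio_integral_def by (subst lborel_integral_real_affine[where c = 1 and t = "w"]) auto
      have i2: "integrable lborel (\<lambda>x. ratio_kernel (t + w) (w + 1 * x) * indicator {- T + w<..T + w} (w + 1 * x))"
        using integrable_ratio_kernel by (rule lborel_integrable_real_affine) auto
      have "R T = (\<integral>x. c * (2 * (ratio_kernel t x * indicator {- T<..T} x)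
         - ratio_kernel (t - w) (- w + 1 * x) * indicator {- T - w<..T - w} (- w + 1 * x)
         - ratio_kernel (t + w) (w + 1 * x) * indicator {- T + w<..T + w} (w + 1 * x)) \<partial>lborel)"
        unfolding R_def s1 s2 using i1 i2 integrable_ratio_kernel[of t "-T" T]
        by (simp add: ratio_integral_def)
      also have "\<dots> = (\<integral>x. F x * indicator {- T<..T} x \<partial>lborel)"
      proof (rule Bochner_Integration.integral_cong[OF refl])
        fix x
        have e: "t - w - (- w + 1 * x) = t - x" "t + w - (w + 1 * x) = t - x" "- w + 1 * x = x - w" "w + 1 * x = x + w"
          by auto
        have "(indicator {- T - w<..T - w} (- w + 1 * x) :: real) = indicator {- T<..T} x"
          "(indicator {- T + w<..T + w} (w + 1 * x) :: real) = indicator {- T<..T} x"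
          by (auto simp: indicator_def)
        then show "c * (2 * (ratio_kernel t x * indicator {- T<..T} x)
         - ratio_kernel (t - w) (- w + 1 * x) * indicator {- T - w<..T - w} (- w + 1 * x)
         - ratio_kernel (t + w) (w + 1 * x) * indicator {- T + w<..T + w} (w + 1 * x)) = F x * indicator {- T<..T} x"
          unfolding ratio_kernel_def F_def atom_def e c_def by (simp add: indicator_def algebra_simps add_divide_distrib diff_divide_distrib)
      qed
      finally show ?thesis .
    qed
    moreover have "(\<lambda>n. \<integral>x. F x * indicator {- real n<..real n} x \<partial>lborel) \<longlonglongrightarrow> (\<integral>x. F x \<partial>lborel)"
    proof (rule integral_dominated_convergence[where w = "\<lambda>x. norm (F x)"])
      show "AE x in lborel. (\<lambda>n. F x * indicator {- real n<..real n} x) \<longlonglongrightarrow> F x"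
      proof (rule AE_I2)
        fix x
        have "eventually (\<lambda>n. real n > \<bar>x\<bar>) sequentially"
          using filterlim_real_sequentially unfolding filterlim_at_top_dense by blast
        then have "eventually (\<lambda>n. F x * indicator {- real n<..real n} x = F x) sequentially"
          by eventually_elim (auto simp: indicator_def)
        then show "(\<lambda>n. F x * indicator {- real n<..real n} x) \<longlonglongrightarrow> F x"
          by (rule tendsto_eventually)
      qed
    qed (use Fi in \<open>auto simp: indicator_def\<close>)
    ultimately have "(\<integral>x. F x \<partial>lborel) = 0" using LIMSEQ_unique by simp
    then show ?thesis by (simp add: F_def)
  qed
  show ?thesis
  proof (cases "t \<ge> 0")
    case True
    then show ?thesis using pos t by simp
  next
    case False
    have "(\<integral>x. atom w x * \<bar>t - x\<bar> powr - (1 - \<alpha>) \<partial>lborel)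
      = (\<integral>x. atom w (0 + (-1) * x) * \<bar>t - (0 + (-1) * x)\<bar> powr - (1 - \<alpha>) \<partial>lborel)"
      by (subst lborel_integral_real_affine[where c = "-1" and t = 0]) auto
    also have "\<dots> = (\<integral>x. atom w x * \<bar>- t - x\<bar> powr - (1 - \<alpha>) \<partial>lborel)"
    proof (rule Bochner_Integration.integral_cong[OF refl])
      fix x
      have "\<bar>t - (0 + (-1) * x)\<bar> = \<bar>- t - x\<bar>" by simp
      then show "atom w (0 + (-1) * x) * \<bar>t - (0 + (-1) * x)\<bar> powr - (1 - \<alpha>) = atom w x * \<bar>- t - x\<bar> powr - (1 - \<alpha>)"
        by simp
    qed
    also have "\<dots> = 0" using False t by (intro pos) auto
    finally show ?thesis .
  qed
qed

end

section \<open>One correction\<close>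

definition block :: "nat \<Rightarrow> nat \<Rightarrow> real set" where
  "block m k = {real k / real m..<(real k + 1) / real m}"

definition blocks :: "nat \<Rightarrow> nat set \<Rightarrow> real set" where
  "blocks m A = (\<Union>k\<in>A. block m k)"

lemma in_block_iff: "m > 0 \<Longrightarrow> x \<in> block m k \<longleftrightarrow> real k \<le> real m * x \<and> real m * x < real k + 1"
  by (auto simp: block_def pos_divide_le_eq pos_less_divide_eq mult.commute)

lemma block_measurable [measurable]: "block m k \<in> sets borel"
  by (simp add: block_def)

lemma blocks_measurable [measurable]: "blocks m A \<in> sets borel"
  unfolding blocks_def by (intro sets.countable_UN') auto

lemma emeasure_block: "m > 0 \<Longrightarrow> emeasure lborel (block m k) = ennreal (1 / real m)"
  by (simp add: block_def divide_right_mono flip: diff_divide_distrib)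

lemma disjoint_blocks: "m > 0 \<Longrightarrow> disjoint_family_on (block m) A"
  unfolding disjoint_family_on_def by (auto simp: in_block_iff)

lemma nn_integral_blocks:
  assumes "m > 0" "finite A" "f \<in> borel_measurable borel"
  shows "(\<integral>\<^sup>+x. f x * indicator (blocks m A) x \<partial>lborel) = (\<Sum>k\<in>A. \<integral>\<^sup>+x. f x * indicator (block m k) x \<partial>lborel)"
proof -
  have "indicator (blocks m A) x = (\<Sum>k\<in>A. indicator (block m k) x :: ennreal)" for x
    unfolding blocks_def by (rule indicator_UN_disjoint[OF assms(2) disjoint_blocks[OF assms(1)]])
  then have "(\<integral>\<^sup>+x. f x * indicator (blocks m A) x \<partial>lborel) = (\<integral>\<^sup>+x. (\<Sum>k\<in>A. f x * indicator (block m k) x) \<partial>lborel)"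
    by (simp only: sum_distrib_left)
  also have "\<dots> = (\<Sum>k\<in>A. \<integral>\<^sup>+x. f x * indicator (block m k) x \<partial>lborel)"
    using assms by (intro nn_integral_sum) auto
  finally show ?thesis .
qed

text \<open>The integral may be infinite, in which case every point will do.\<close>

lemma exists_below_average:
  fixes G :: "real \<Rightarrow> ennreal"
  assumes m: "m > 0" and G: "G \<in> borel_measurable borel"
  shows "\<exists>y\<in>block m k. G y * ennreal (1 / real m) \<le> (\<integral>\<^sup>+x. G x * indicator (block m k) x \<partial>lborel)"
proof (rule ccontr)
  define I where "I = (\<integral>\<^sup>+x. G x * indicator (block m k) x \<partial>lborel)"
  assume "\<not> ?thesis"
  then have gt: "I < G y * ennreal (1 / real m)" if "y \<in> block m k" for y
    using that by (auto simp: I_def not_le)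
  have mem: "real k / real m \<in> block m k" using m by (simp add: in_block_iff)
  have fin: "I \<noteq> \<infinity>" using gt[OF mem] by auto
  note [measurable] = G
  have "(\<integral>\<^sup>+x. I * indicator (block m k) x \<partial>lborel) < (\<integral>\<^sup>+x. ennreal (1 / real m) * (G x * indicator (block m k) x) \<partial>lborel)"
  proof (rule nn_integral_less)
    show "(\<integral>\<^sup>+x. I * indicator (block m k) x \<partial>lborel) \<noteq> \<infinity>"
      using fin m by (simp add: nn_integral_cmult emeasure_block ennreal_mult_eq_top_iff)
    show "AE x in lborel. I * indicator (block m k) x \<le> ennreal (1 / real m) * (G x * indicator (block m k) x)"
      using gt by (intro AE_I2) (auto simp: indicator_def mult.commute intro: less_imp_le)
    show "\<not> (AE x in lborel. ennreal (1 / real m) * (G x * indicator (block m k) x) \<le> I * indicator (block m k) x)"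
    proof
      assume "AE x in lborel. ennreal (1 / real m) * (G x * indicator (block m k) x) \<le> I * indicator (block m k) x"
      then have "AE x in lborel. x \<notin> block m k"
      proof eventually_elim
        case (elim x)
        show ?case
        proof
          assume x: "x \<in> block m k"
          then show False using elim gt[OF x] by (simp add: mult.commute)
        qed
      qed
      then have "emeasure lborel (block m k) = 0"
        by (subst (asm) AE_iff_measurable[OF _ refl]) auto
      then show False using m by (simp add: emeasure_block)
    qed
  qed auto
  also have "\<dots> = ennreal (1 / real m) * I" unfolding I_def by (rule nn_integral_cmult) auto
  also have "(\<integral>\<^sup>+x. I * indicator (block m k) x \<partial>lborel) = ennreal (1 / real m) * I"
    using m by (simp add: nn_integral_cmult emeasure_block mult.commute)
  finally show False by simp
qed

text \<open>The integral over the small translations is the one that bounds the integral of \<open>|f x - f y|^p\<close> over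
  any interval of length \<open>1 / m\<close> containing \<open>y\<close>.\<close>

definition osc :: "real \<Rightarrow> nat \<Rightarrow> (real \<Rightarrow> real) \<Rightarrow> real \<Rightarrow> ennreal" where
  "osc p m f y = (\<integral>\<^sup>+h. ennreal (\<bar>f (y + h) - f y\<bar> powr p) * indicator {- 1 / real m..1 / real m} h \<partial>lborel)"

text \<open>The weights are such that the values at the sample points, times the length \<open>1 / m\<close> of a block, add up to a bound
  for the integral of \<open>|f|^p\<close> after the correction.\<close>

definition energy :: "real \<Rightarrow> real \<Rightarrow> nat \<Rightarrow> (real \<Rightarrow> real) \<Rightarrow> real \<Rightarrow> ennreal" where
  "energy p q m f y = ennreal (q * \<bar>f y\<bar> powr p) + ennreal (real m) * osc p m f y"

lemma osc_measurable [measurable]: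
  assumes [measurable]: "f \<in> borel_measurable borel"
  shows "osc p m f \<in> borel_measurable borel"
  unfolding osc_def[abs_def] by measurable

lemma energy_measurable [measurable]:
  assumes [measurable]: "f \<in> borel_measurable borel"
  shows "energy p q m f \<in> borel_measurable borel"
  unfolding energy_def[abs_def] by measurable

lemma nn_integral_scaled:
  fixes f :: "real \<Rightarrow> ennreal"
  assumes "f \<in> borel_measurable borel" "c > 0"
  shows "(\<integral>\<^sup>+x. f (c * x + t) \<partial>lborel) = ennreal (1 / c) * (\<integral>\<^sup>+x. f x \<partial>lborel)"
proof -
  have "(\<integral>\<^sup>+x. f x \<partial>lborel) = ennreal c * (\<integral>\<^sup>+x. f (c * x + t) \<partial>lborel)"
    using nn_integral_real_affine[OF assms(1), of c t] assms(2) by (simp add: add.commute)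
  then show ?thesis using assms(2)
    by (simp add: mult.assoc[symmetric] ennreal_mult[symmetric])
qed

text \<open>On the block of the sample point \<open>y\<close>, the corrected function is \<open>(f - f y) + f y (1 + \<psi>)\<close> up to the copies of \<open>\<psi>\<close> from the other
  blocks. All copies, including those tails, are accounted for by the integral over the whole line in the hypothesis on \<open>\<psi>\<close>, and the first term by the oscillation
  at \<open>y\<close>. The blocks in \<open>A - B\<close> are abandoned since their samples exceed \<open>M\<close>; Chebyshev's inequality bounds their number.\<close>

lemma correction_step:
  fixes f \<psi> :: "real \<Rightarrow> real" and A :: "nat set" and m :: nat and p q M u :: real
  assumes p: "0 < p" "p \<le> 1" and q: "q > 0" and m: "m > 0" and M: "M > 0" and u: "u \<ge> 0"
    and f [measurable]: "f \<in> borel_measurable borel" and \<psi> [measurable]: "\<psi> \<in> borel_measurable borel"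
    and A: "A \<subseteq> {..<m}"
    and gain: "(\<integral>\<^sup>+x. ennreal (\<bar>indicator {0..<1} x + \<psi> x\<bar> powr p) \<partial>lborel) \<le> ennreal q"
    and en: "(\<integral>\<^sup>+y. energy p q m f y * indicator (blocks m A) y \<partial>lborel) \<le> ennreal u"
  shows "\<exists>a B. B \<subseteq> A \<and> (\<forall>k. \<bar>a k\<bar> \<le> M) \<and> (\<Sum>k<m. \<bar>a k\<bar> powr p) / real m \<le> u / q \<and>
     (\<integral>\<^sup>+x. ennreal (\<bar>f x + (\<Sum>k<m. a k * \<psi> (real m * x - real k))\<bar> powr p) * indicator (blocks m B) x \<partial>lborel) \<le> ennreal u \<and>
     real (card (A - B)) / real m \<le> u / (q * M powr p)"
proof -
  define G where "G = energy p q m f"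
  have Gm [measurable]: "G \<in> borel_measurable borel" unfolding G_def by measurable
  have fA: "finite A" using A by (rule finite_subset) simp
  have "\<forall>k. \<exists>y\<in>block m k. G y * ennreal (1 / real m) \<le> (\<integral>\<^sup>+x. G x * indicator (block m k) x \<partial>lborel)"
    using exists_below_average[OF m Gm] by blast
  then obtain y where y: "\<And>k. y k \<in> block m k"
    "\<And>k. G (y k) * ennreal (1 / real m) \<le> (\<integral>\<^sup>+x. G x * indicator (block m k) x \<partial>lborel)" by metis
  \<comment> \<open>On abandoned blocks nothing is added, which keeps all coefficients below \<open>M\<close>.\<close>
  define B where "B = {k\<in>A. \<bar>f (y k)\<bar> \<le> M}"
  define a where "a k = (if k \<in> B then f (y k) else 0)" for k
  have BA: "B \<subseteq> A" "finite B" using fA by (auto simp: B_def)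
  have total: "(\<Sum>k\<in>A. G (y k) * ennreal (1 / real m)) \<le> ennreal u"
  proof -
    have "(\<Sum>k\<in>A. G (y k) * ennreal (1 / real m)) \<le> (\<Sum>k\<in>A. \<integral>\<^sup>+x. G x * indicator (block m k) x \<partial>lborel)"
      by (intro sum_mono y)
    also have "\<dots> = (\<integral>\<^sup>+x. G x * indicator (blocks m A) x \<partial>lborel)"
      by (rule nn_integral_blocks[symmetric, OF m fA Gm])
    finally show ?thesis using en unfolding G_def by simp
  qed
  have sumA: "(\<Sum>k\<in>A. \<bar>f (y k)\<bar> powr p) / real m \<le> u / q"
  proof -
    have "ennreal (\<Sum>k\<in>A. q * \<bar>f (y k)\<bar> powr p / real m) = (\<Sum>k\<in>A. ennreal (q * \<bar>f (y k)\<bar> powr p) * ennreal (1 / real m))"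
      using q by (subst sum_ennreal[symmetric]) (auto simp: ennreal_mult[symmetric])
    also have "\<dots> \<le> (\<Sum>k\<in>A. G (y k) * ennreal (1 / real m))"
      unfolding G_def energy_def by (intro sum_mono mult_right_mono) auto
    also have "\<dots> \<le> ennreal u" by (rule total)
    finally have "(\<Sum>k\<in>A. q * \<bar>f (y k)\<bar> powr p / real m) \<le> u" using u by simp
    then have "q * ((\<Sum>k\<in>A. \<bar>f (y k)\<bar> powr p) / real m) \<le> u"
      by (simp add: sum_distrib_left sum_divide_distrib)
    then show ?thesis using q by (simp add: pos_le_divide_eq mult.commute)
  qed
  have suma: "(\<Sum>k<m. \<bar>a k\<bar> powr p) / real m \<le> u / q"
  proof -
    have "(\<Sum>k<m. \<bar>a k\<bar> powr p) = (\<Sum>k\<in>B. \<bar>f (y k)\<bar> powr p)"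
      using A BA(1) p by (intro sum.mono_neutral_cong_right) (auto simp: a_def)
    also have "\<dots> \<le> (\<Sum>k\<in>A. \<bar>f (y k)\<bar> powr p)" using BA fA by (intro sum_mono2) auto
    finally have "(\<Sum>k<m. \<bar>a k\<bar> powr p) / real m \<le> (\<Sum>k\<in>A. \<bar>f (y k)\<bar> powr p) / real m"
      by (intro divide_right_mono) auto
    then show ?thesis using sumA by linarith
  qed
  have dead: "real (card (A - B)) / real m \<le> u / (q * M powr p)"
  proof -
    have "real (card (A - B)) * M powr p = (\<Sum>k\<in>A - B. M powr p)" by simp
    also have "\<dots> \<le> (\<Sum>k\<in>A - B. \<bar>f (y k)\<bar> powr p)"
      using M p by (intro sum_mono powr_mono2) (auto simp: B_def)
    also have "\<dots> \<le> (\<Sum>k\<in>A. \<bar>f (y k)\<bar> powr p)" using fA by (intro sum_mono2) auto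
    finally have "real (card (A - B)) * M powr p / real m \<le> (\<Sum>k\<in>A. \<bar>f (y k)\<bar> powr p) / real m"
      by (intro divide_right_mono) auto
    also note sumA
    finally have "(real (card (A - B)) / real m) * M powr p \<le> u / q" by simp
    moreover have "M powr p > 0" using M by simp
    ultimately have "real (card (A - B)) / real m \<le> (u / q) / M powr p" by (simp only: pos_le_divide_eq)
    then show ?thesis by simp
  qed
  define f' where "f' x = f x + (\<Sum>k<m. a k * \<psi> (real m * x - real k))" for x
  define \<Theta> where "\<Theta> x = ennreal (\<bar>indicator {0..<1} x + \<psi> x\<bar> powr p)" for x :: real
  have \<Theta>m [measurable]: "\<Theta> \<in> borel_measurable borel" unfolding \<Theta>_def by measurable
  \<comment> \<open>On block \<open>k\<close> the indicator functions, weighted by the coefficients, add up to \<open>a k = f (y k)\<close>; so every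
    copy of \<open>\<psi>\<close> may be completed by its indicator function if \<open>f (y k)\<close> is subtracted from \<open>f\<close>.\<close>
  have pw: "ennreal (\<bar>f' x\<bar> powr p) * indicator (blocks m B) x \<le>
     (\<Sum>k\<in>B. ennreal (\<bar>f x - f (y k)\<bar> powr p) * indicator (block m k) x) + (\<Sum>j\<in>B. ennreal (\<bar>f (y j)\<bar> powr p) * \<Theta> (real m * x - real j))" for x
  proof (cases "x \<in> blocks m B")
    case True
    then obtain k where k: "k \<in> B" "x \<in> block m k" by (auto simp: blocks_def)
    have km: "k < m" using k BA A by auto
    have ind: "indicator {0..<1} (real m * x - real j) = (if j = k then 1 else 0 :: real)" for j
      using k(2) m by (auto simp: in_block_iff indicator_def)
    have "(\<Sum>j<m. a j * (indicator {0..<1} (real m * x - real j) + \<psi> (real m * x - real j)))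
      = a k + (\<Sum>j<m. a j * \<psi> (real m * x - real j))"
      unfolding distrib_left sum.distrib ind using km by (simp add: if_distrib cong: if_cong)
    then have "f' x = (f x - f (y k)) + (\<Sum>j<m. a j * (indicator {0..<1} (real m * x - real j) + \<psi> (real m * x - real j)))"
      using k by (simp add: f'_def a_def)
    then have "\<bar>f' x\<bar> powr p \<le> \<bar>f x - f (y k)\<bar> powr p + \<bar>\<Sum>j<m. a j * (indicator {0..<1} (real m * x - real j) + \<psi> (real m * x - real j))\<bar> powr p"
      using p by (simp only:) (intro abs_add_powr_le)
    also have "\<bar>\<Sum>j<m. a j * (indicator {0..<1} (real m * x - real j) + \<psi> (real m * x - real j))\<bar> powr p
      \<le> (\<Sum>j<m. \<bar>a j * (indicator {0..<1} (real m * x - real j) + \<psi> (real m * x - real j))\<bar> powr p)"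
      using p by (intro abs_sum_powr_le)
    also have "\<dots> = (\<Sum>j\<in>B. \<bar>f (y j)\<bar> powr p * \<bar>indicator {0..<1} (real m * x - real j) + \<psi> (real m * x - real j)\<bar> powr p)"
      using A BA(1) by (intro sum.mono_neutral_cong_right) (auto simp: a_def abs_mult powr_mult)
    finally have "ennreal (\<bar>f' x\<bar> powr p) \<le> ennreal (\<bar>f x - f (y k)\<bar> powr p +
        (\<Sum>j\<in>B. \<bar>f (y j)\<bar> powr p * \<bar>indicator {0..<1} (real m * x - real j) + \<psi> (real m * x - real j)\<bar> powr p))"
      by (rule ennreal_leI) simp
    also have "\<dots> = ennreal (\<bar>f x - f (y k)\<bar> powr p) + (\<Sum>j\<in>B. ennreal (\<bar>f (y j)\<bar> powr p) * \<Theta> (real m * x - real j))"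
      by (subst ennreal_plus) (auto simp: sum_nonneg \<Theta>_def ennreal_mult sum_ennreal[symmetric])
    also have "ennreal (\<bar>f x - f (y k)\<bar> powr p) = ennreal (\<bar>f x - f (y k)\<bar> powr p) * indicator (block m k) x"
      using k by simp
    also have "\<dots> \<le> (\<Sum>k\<in>B. ennreal (\<bar>f x - f (y k)\<bar> powr p) * indicator (block m k) x)"
      using k BA by (intro member_le_sum) auto
    finally show ?thesis using True by (simp add: add_right_mono)
  qed simp
  have local_osc: "(\<integral>\<^sup>+x. ennreal (\<bar>f x - f (y k)\<bar> powr p) * indicator (block m k) x \<partial>lborel) \<le> osc p m f (y k)" for k
  proof -
    have "(\<integral>\<^sup>+x. ennreal (\<bar>f x - f (y k)\<bar> powr p) * indicator (block m k) x \<partial>lborel)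
      = (\<integral>\<^sup>+h. ennreal (\<bar>f (y k + 1 * h) - f (y k)\<bar> powr p) * indicator (block m k) (y k + 1 * h) \<partial>lborel)"
      by (subst nn_integral_real_affine[where c = 1 and t = "y k"]) auto
    also have "\<dots> \<le> osc p m f (y k)"
      unfolding osc_def
    proof (rule nn_integral_mono)
      fix h
      have "h \<in> {- 1 / real m..1 / real m}" if "y k + h \<in> block m k"
        using that y(1)[of k] by (auto simp: block_def add_divide_distrib)
      then show "ennreal (\<bar>f (y k + 1 * h) - f (y k)\<bar> powr p) * indicator (block m k) (y k + 1 * h)
        \<le> ennreal (\<bar>f (y k + h) - f (y k)\<bar> powr p) * indicator {- 1 / real m..1 / real m} h"
        by (auto simp: indicator_def)
    qed
    finally show ?thesis .
  qed
  have copy: "(\<integral>\<^sup>+x. \<Theta> (real m * x + - real j) \<partial>lborel) \<le> ennreal (1 / real m) * ennreal q" for j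
    using m gain unfolding \<Theta>_def[symmetric] by (subst nn_integral_scaled) (auto intro: mult_left_mono)
  have "(\<integral>\<^sup>+x. ennreal (\<bar>f' x\<bar> powr p) * indicator (blocks m B) x \<partial>lborel) \<le>
     (\<integral>\<^sup>+x. (\<Sum>k\<in>B. ennreal (\<bar>f x - f (y k)\<bar> powr p) * indicator (block m k) x) + (\<Sum>j\<in>B. ennreal (\<bar>f (y j)\<bar> powr p) * \<Theta> (real m * x - real j)) \<partial>lborel)"
    by (intro nn_integral_mono pw)
  also have "\<dots> = (\<Sum>k\<in>B. \<integral>\<^sup>+x. ennreal (\<bar>f x - f (y k)\<bar> powr p) * indicator (block m k) x \<partial>lborel)
     + (\<Sum>j\<in>B. ennreal (\<bar>f (y j)\<bar> powr p) * (\<integral>\<^sup>+x. \<Theta> (real m * x + - real j) \<partial>lborel))"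
    by (simp add: nn_integral_add nn_integral_sum nn_integral_cmult)
  also have "\<dots> \<le> (\<Sum>k\<in>B. osc p m f (y k)) + (\<Sum>j\<in>B. ennreal (\<bar>f (y j)\<bar> powr p) * (ennreal (1 / real m) * ennreal q))"
    by (intro add_mono sum_mono mult_left_mono local_osc copy) auto
  also have "\<dots> = (\<Sum>k\<in>B. G (y k) * ennreal (1 / real m))"
    unfolding sum.distrib[symmetric]
  proof (rule sum.cong[OF refl])
    fix k
    have "ennreal (real m) * ennreal (1 / real m) = 1" using m by (simp add: ennreal_mult[symmetric])
    then have "ennreal (real m) * osc p m f (y k) * ennreal (1 / real m) = osc p m f (y k)"
      by (metis mult.assoc mult.commute mult_1)
    then show "osc p m f (y k) + ennreal (\<bar>f (y k)\<bar> powr p) * (ennreal (1 / real m) * ennreal q) = G (y k) * ennreal (1 / real m)"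
      unfolding G_def energy_def distrib_right using q by (simp add: ennreal_mult mult_ac add.commute)
  qed
  also have "\<dots> \<le> (\<Sum>k\<in>A. G (y k) * ennreal (1 / real m))"
    using BA fA by (intro sum_mono2) auto
  also note total
  finally have "(\<integral>\<^sup>+x. ennreal (\<bar>f' x\<bar> powr p) * indicator (blocks m B) x \<partial>lborel) \<le> ennreal u" .
  moreover have "\<bar>a k\<bar> \<le> M" for k using M by (auto simp: a_def B_def)
  ultimately show ?thesis using BA(1) suma dead unfolding f'_def
    by (intro exI[of _ a] exI[of _ B] conjI allI)
qed

section \<open>Iterated corrections\<close>

definition corrected :: "(real \<Rightarrow> real) \<Rightarrow> (nat \<Rightarrow> real \<Rightarrow> real) \<Rightarrow> nat \<Rightarrow> (nat \<Rightarrow> nat \<Rightarrow> real) \<Rightarrow> nat \<Rightarrow> real \<Rightarrow> real" where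
  "corrected f0 \<psi> D a n x = f0 x + (\<Sum>j<n. \<Sum>k<D ^ j. a j k * \<psi> j (real (D ^ j) * x - real k))"

lemma corrected_measurable:
  assumes [measurable]: "f0 \<in> borel_measurable borel" "\<And>j. \<psi> j \<in> borel_measurable borel"
  shows "corrected f0 \<psi> D a n \<in> borel_measurable borel"
  unfolding corrected_def[abs_def] by measurable

text \<open>A correction from generation \<open>j\<close> varies on the scale \<open>D^(-j)\<close>, so a translation by at most \<open>D^(-n)\<close> costs the factor
  \<open>(D^(j-n))^\<gamma>\<close> in the \<open>p\<close>-th mean. Subadditivity adds up the generations, and Fubini exchanges the integration over the translation with
  the one over the point.\<close>

lemma osc_corrected_le:
  fixes p C L \<gamma> :: real and n D :: nat
  assumes p: "0 < p" "p \<le> 1" and D: "D > 0" and L: "L \<ge> 0" and C: "C \<ge> 0" and \<gamma>: "\<gamma> > 0"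
    and f0 [measurable]: "f0 \<in> borel_measurable borel" and \<psi> [measurable]: "\<And>j. \<psi> j \<in> borel_measurable borel"
    and lip: "\<And>y h. y \<in> {0..<1} \<Longrightarrow> \<bar>h\<bar> \<le> 1 \<Longrightarrow> \<bar>f0 (y + h) - f0 y\<bar> \<le> L * \<bar>h\<bar>"
    and modulus: "\<And>j h. \<bar>h\<bar> \<le> 1 \<Longrightarrow> (\<integral>\<^sup>+x. ennreal (\<bar>\<psi> j (x + h) - \<psi> j x\<bar> powr p) \<partial>lborel) \<le> ennreal (C * \<bar>h\<bar> powr \<gamma>)"
    and S: "S \<subseteq> {0..<1}" "S \<in> sets borel"
  shows "(\<integral>\<^sup>+y. ennreal (real (D ^ n)) * osc p (D ^ n) (corrected f0 \<psi> D a n) y * indicator S y \<partial>lborel) \<le>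
    ennreal (2 * (L / real (D ^ n)) powr p
      + 2 * C * (\<Sum>j<n. (real (D ^ j) / real (D ^ n)) powr \<gamma> * ((\<Sum>k<D ^ j. \<bar>a j k\<bar> powr p) / real (D ^ j))))"
proof -
  define m where "m = D ^ n"
  have m: "m > 0" "real m \<ge> 1" using D by (auto simp: m_def Suc_le_eq)
  define Ih where "Ih h = (indicator {- 1 / real m..1 / real m} h :: ennreal)" for h :: real
  have [measurable]: "Ih \<in> borel_measurable borel" unfolding Ih_def by measurable
  have hlen: "(\<integral>\<^sup>+h. Ih h \<partial>lborel) = ennreal (2 / real m)"
    unfolding Ih_def using m by simp
  have h1: "\<bar>h\<bar> \<le> 1 / real m" if "Ih h \<noteq> 0" for h
    using that by (auto simp: Ih_def indicator_def split: if_splits)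
  have h1': "1 / real m \<le> 1" using m by simp
  define V where "V j k y h = ennreal (\<bar>\<psi> j (real (D ^ j) * (y + h) - real k) - \<psi> j (real (D ^ j) * y - real k)\<bar> powr p)" for j k y h
  have Vm [measurable]: "(\<lambda>(y, h). V j k y h) \<in> borel_measurable (borel \<Otimes>\<^sub>M borel)" for j k
    unfolding V_def by measurable
  have Vm1 [measurable]: "(\<lambda>h. V j k y h) \<in> borel_measurable borel" for j k y unfolding V_def by measurable
  have Vm2 [measurable]: "(\<lambda>y. V j k y h) \<in> borel_measurable borel" for j k h unfolding V_def by measurable
  have inner: "(\<integral>\<^sup>+y. V j k y h \<partial>lborel) \<le> ennreal (1 / real (D ^ j) * (C * (real (D ^ j) / real m) powr \<gamma>))"
    if "j < n" "Ih h \<noteq> 0" for j k h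
  proof -
    define c where "c = real (D ^ j)"
    have c: "c > 0" "c \<le> real m" using D that unfolding c_def m_def by (auto intro!: power_increasing simp: Suc_le_eq)
    define H where "H z = ennreal (\<bar>\<psi> j (z + c * h) - \<psi> j z\<bar> powr p)" for z
    have [measurable]: "H \<in> borel_measurable borel" unfolding H_def by measurable
    have ch: "\<bar>c * h\<bar> \<le> c / real m" using mult_left_mono[OF h1[OF that(2)], of c] c by (simp add: abs_mult)
    have "c / real m \<le> 1" using c m by simp
    have "V j k y h = H (c * y + - real k)" for y
      unfolding V_def H_def c_def by (simp add: algebra_simps)
    then have "(\<integral>\<^sup>+y. V j k y h \<partial>lborel) = (\<integral>\<^sup>+y. H (c * y + - real k) \<partial>lborel)" by simp
    also have "\<dots> = ennreal (1 / c) * (\<integral>\<^sup>+z. H z \<partial>lborel)" using c by (intro nn_integral_scaled) auto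
    also have "\<dots> \<le> ennreal (1 / c) * ennreal (C * \<bar>c * h\<bar> powr \<gamma>)"
      unfolding H_def using ch \<open>c / real m \<le> 1\<close> by (intro mult_left_mono modulus) auto
    also have "\<dots> \<le> ennreal (1 / c) * ennreal (C * (c / real m) powr \<gamma>)"
      using ch C \<gamma> by (intro mult_left_mono ennreal_leI powr_mono2) auto
    also have "\<dots> = ennreal (1 / c * (C * (c / real m) powr \<gamma>))" using c C by (intro ennreal_mult[symmetric]) auto
    finally show ?thesis by (simp add: c_def)
  qed
  have double: "(\<integral>\<^sup>+y. (\<integral>\<^sup>+h. V j k y h * Ih h \<partial>lborel) \<partial>lborel) \<le>
      ennreal (2 / real m * (1 / real (D ^ j) * (C * (real (D ^ j) / real m) powr \<gamma>)))" if "j < n" for j k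
  proof -
    have "(\<integral>\<^sup>+y. (\<integral>\<^sup>+h. V j k y h * Ih h \<partial>lborel) \<partial>lborel) = (\<integral>\<^sup>+h. (\<integral>\<^sup>+y. V j k y h * Ih h \<partial>lborel) \<partial>lborel)"
      by (rule lborel_pair.Fubini'[of "\<lambda>h y. V j k y h * Ih h"]) measurable
    also have "\<dots> = (\<integral>\<^sup>+h. (\<integral>\<^sup>+y. V j k y h \<partial>lborel) * Ih h \<partial>lborel)"
      by (intro nn_integral_cong nn_integral_multc) measurable
    also have "\<dots> \<le> (\<integral>\<^sup>+h. ennreal (1 / real (D ^ j) * (C * (real (D ^ j) / real m) powr \<gamma>)) * Ih h \<partial>lborel)"
    proof (rule nn_integral_mono)
      fix h
      show "(\<integral>\<^sup>+y. V j k y h \<partial>lborel) * Ih h \<le> ennreal (1 / real (D ^ j) * (C * (real (D ^ j) / real m) powr \<gamma>)) * Ih h"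
        using inner[OF that, of h k] by (cases "Ih h = 0") (auto intro: mult_right_mono)
    qed
    also have "\<dots> = ennreal (1 / real (D ^ j) * (C * (real (D ^ j) / real m) powr \<gamma>)) * ennreal (2 / real m)"
      by (subst nn_integral_cmult) (auto simp: hlen)
    also have "\<dots> = ennreal (2 / real m * (1 / real (D ^ j) * (C * (real (D ^ j) / real m) powr \<gamma>)))"
      using C by (subst ennreal_mult[symmetric]) (auto simp: mult_ac)
    finally show ?thesis .
  qed
  have pw: "ennreal (\<bar>corrected f0 \<psi> D a n (y + h) - corrected f0 \<psi> D a n y\<bar> powr p) * Ih h * indicator S y
    \<le> ennreal ((L / real m) powr p) * Ih h * indicator S y + (\<Sum>j<n. \<Sum>k<D ^ j. ennreal (\<bar>a j k\<bar> powr p) * (V j k y h * Ih h))" for y h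
  proof (cases "y \<in> S \<and> Ih h \<noteq> 0")
    case True
    then have y: "y \<in> {0..<1}" and h: "\<bar>h\<bar> \<le> 1 / real m" using S h1 by auto
    have "\<bar>f0 (y + h) - f0 y\<bar> \<le> L * \<bar>h\<bar>" using y h h1' by (intro lip) auto
    also have "\<dots> \<le> L / real m" using mult_left_mono[OF h L] by simp
    finally have b0: "\<bar>f0 (y + h) - f0 y\<bar> powr p \<le> (L / real m) powr p" using p by (intro powr_mono2) auto
    define v where "v j k = \<psi> j (real (D ^ j) * (y + h) - real k) - \<psi> j (real (D ^ j) * y - real k)" for j k
    have "corrected f0 \<psi> D a n (y + h) - corrected f0 \<psi> D a n y = (f0 (y + h) - f0 y) + (\<Sum>j<n. \<Sum>k<D ^ j. a j k * v j k)"
      unfolding corrected_def v_def by (simp add: right_diff_distrib sum_subtractf)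
    then have "\<bar>corrected f0 \<psi> D a n (y + h) - corrected f0 \<psi> D a n y\<bar> powr p
      \<le> \<bar>f0 (y + h) - f0 y\<bar> powr p + \<bar>\<Sum>j<n. \<Sum>k<D ^ j. a j k * v j k\<bar> powr p"
      by (simp only:) (rule abs_add_powr_le[OF p])
    also have "\<bar>\<Sum>j<n. \<Sum>k<D ^ j. a j k * v j k\<bar> powr p \<le> (\<Sum>j<n. \<bar>\<Sum>k<D ^ j. a j k * v j k\<bar> powr p)"
      by (rule abs_sum_powr_le[OF p])
    also have "\<dots> \<le> (\<Sum>j<n. \<Sum>k<D ^ j. \<bar>a j k * v j k\<bar> powr p)"
      by (intro sum_mono abs_sum_powr_le[OF p])
    finally have "\<bar>corrected f0 \<psi> D a n (y + h) - corrected f0 \<psi> D a n y\<bar> powr p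
      \<le> (L / real m) powr p + (\<Sum>j<n. \<Sum>k<D ^ j. \<bar>a j k\<bar> powr p * \<bar>v j k\<bar> powr p)"
      using b0 by (simp add: abs_mult powr_mult)
    then have "ennreal (\<bar>corrected f0 \<psi> D a n (y + h) - corrected f0 \<psi> D a n y\<bar> powr p)
      \<le> ennreal ((L / real m) powr p + (\<Sum>j<n. \<Sum>k<D ^ j. \<bar>a j k\<bar> powr p * \<bar>v j k\<bar> powr p))"
      by (rule ennreal_leI)
    also have "\<dots> = ennreal ((L / real m) powr p) + (\<Sum>j<n. \<Sum>k<D ^ j. ennreal (\<bar>a j k\<bar> powr p) * V j k y h)"
      by (subst ennreal_plus) (auto simp: sum_nonneg V_def v_def ennreal_mult sum_ennreal[symmetric])
    finally show ?thesis using True by (simp add: Ih_def indicator_def split: if_splits)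
  next
    case False
    then show ?thesis by (auto simp: indicator_def)
  qed
  define g where "g = corrected f0 \<psi> D a n"
  have [measurable]: "g \<in> borel_measurable borel" unfolding g_def by (rule corrected_measurable) auto
  note [measurable] = S(2)
  have "(\<integral>\<^sup>+y. ennreal (real m) * osc p m g y * indicator S y \<partial>lborel)
    = ennreal (real m) * (\<integral>\<^sup>+y. (\<integral>\<^sup>+h. ennreal (\<bar>g (y + h) - g y\<bar> powr p) * Ih h * indicator S y \<partial>lborel) \<partial>lborel)"
  proof -
    have "ennreal (real m) * osc p m g y * indicator S y
      = ennreal (real m) * (\<integral>\<^sup>+h. ennreal (\<bar>g (y + h) - g y\<bar> powr p) * Ih h * indicator S y \<partial>lborel)" for y
      unfolding osc_def Ih_def[symmetric] by (subst nn_integral_multc) (auto simp: mult.assoc)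
    then show ?thesis by (simp only:) (rule nn_integral_cmult, measurable)
  qed
  also have "\<dots> \<le> ennreal (real m) * (\<integral>\<^sup>+y. (\<integral>\<^sup>+h. ennreal ((L / real m) powr p) * Ih h * indicator S y
      + (\<Sum>j<n. \<Sum>k<D ^ j. ennreal (\<bar>a j k\<bar> powr p) * (V j k y h * Ih h)) \<partial>lborel) \<partial>lborel)"
    unfolding g_def by (intro mult_left_mono nn_integral_mono pw) auto
  also have "\<dots> \<le> ennreal (real m) * ennreal ((L / real m) powr p * (2 / real m) + (\<Sum>j<n. \<Sum>k<D ^ j. \<bar>a j k\<bar> powr p *
      (2 / real m * (1 / real (D ^ j) * (C * (real (D ^ j) / real m) powr \<gamma>)))))"
  proof (intro mult_left_mono)
  have "(\<integral>\<^sup>+y. (\<integral>\<^sup>+h. ennreal ((L / real m) powr p) * Ih h * indicator S y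
      + (\<Sum>j<n. \<Sum>k<D ^ j. ennreal (\<bar>a j k\<bar> powr p) * (V j k y h * Ih h)) \<partial>lborel) \<partial>lborel)
    = (\<integral>\<^sup>+y. ennreal ((L / real m) powr p) * ennreal (2 / real m) * indicator S y \<partial>lborel)
      + (\<Sum>j<n. \<Sum>k<D ^ j. ennreal (\<bar>a j k\<bar> powr p) * (\<integral>\<^sup>+y. (\<integral>\<^sup>+h. V j k y h * Ih h \<partial>lborel) \<partial>lborel))"
  proof -
    have "(\<integral>\<^sup>+h. ennreal ((L / real m) powr p) * Ih h * indicator S y
      + (\<Sum>j<n. \<Sum>k<D ^ j. ennreal (\<bar>a j k\<bar> powr p) * (V j k y h * Ih h)) \<partial>lborel)
      = ennreal ((L / real m) powr p) * ennreal (2 / real m) * indicator S y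
        + (\<Sum>j<n. \<Sum>k<D ^ j. ennreal (\<bar>a j k\<bar> powr p) * (\<integral>\<^sup>+h. V j k y h * Ih h \<partial>lborel))" for y
      by (subst nn_integral_add) (auto simp: nn_integral_sum nn_integral_cmult nn_integral_multc hlen)
    then show ?thesis
      by (simp only:) (subst nn_integral_add, auto simp: nn_integral_sum nn_integral_cmult)
  qed
  also have "\<dots> \<le> ennreal ((L / real m) powr p * (2 / real m)) + (\<Sum>j<n. \<Sum>k<D ^ j. ennreal (\<bar>a j k\<bar> powr p) *
      ennreal (2 / real m * (1 / real (D ^ j) * (C * (real (D ^ j) / real m) powr \<gamma>))))"
  proof (intro add_mono sum_mono mult_left_mono double)
    have "emeasure lborel S \<le> emeasure lborel {0..<1::real}" using S by (intro emeasure_mono) auto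
    then have "emeasure lborel S \<le> 1" by simp
    then have "ennreal ((L / real m) powr p * (2 / real m)) * emeasure lborel S \<le> ennreal ((L / real m) powr p * (2 / real m)) * 1"
      by (intro mult_left_mono) auto
    then show "(\<integral>\<^sup>+y. ennreal ((L / real m) powr p) * ennreal (2 / real m) * indicator S y \<partial>lborel) \<le> ennreal ((L / real m) powr p * (2 / real m))"
      by (subst (asm) ennreal_mult) (auto simp: nn_integral_cmult_indicator)
  qed auto
  also have "\<dots> = ennreal ((L / real m) powr p * (2 / real m) + (\<Sum>j<n. \<Sum>k<D ^ j. \<bar>a j k\<bar> powr p *
      (2 / real m * (1 / real (D ^ j) * (C * (real (D ^ j) / real m) powr \<gamma>)))))"
  proof -
    define X where "X j k = \<bar>a j k\<bar> powr p * (2 / real m * (1 / real (D ^ j) * (C * (real (D ^ j) / real m) powr \<gamma>)))" for j k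
    have X: "X j k \<ge> 0" for j k unfolding X_def using C by simp
    have "ennreal (\<bar>a j k\<bar> powr p) * ennreal (2 / real m * (1 / real (D ^ j) * (C * (real (D ^ j) / real m) powr \<gamma>))) = ennreal (X j k)" for j k
      unfolding X_def using C by (intro ennreal_mult[symmetric]) auto
    then have "(\<Sum>j<n. \<Sum>k<D ^ j. ennreal (\<bar>a j k\<bar> powr p) * ennreal (2 / real m * (1 / real (D ^ j) * (C * (real (D ^ j) / real m) powr \<gamma>))))
      = ennreal (\<Sum>j<n. \<Sum>k<D ^ j. X j k)"
      by (simp only: sum_ennreal X sum_nonneg)
    moreover have "ennreal ((L / real m) powr p * (2 / real m)) + ennreal (\<Sum>j<n. \<Sum>k<D ^ j. X j k)
      = ennreal ((L / real m) powr p * (2 / real m) + (\<Sum>j<n. \<Sum>k<D ^ j. X j k))"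
      using X by (intro ennreal_plus[symmetric] sum_nonneg) auto
    ultimately show ?thesis unfolding X_def by (simp only:)
  qed
  finally show "(\<integral>\<^sup>+y. (\<integral>\<^sup>+h. ennreal ((L / real m) powr p) * Ih h * indicator S y
      + (\<Sum>j<n. \<Sum>k<D ^ j. ennreal (\<bar>a j k\<bar> powr p) * (V j k y h * Ih h)) \<partial>lborel) \<partial>lborel) \<le> ennreal ((L / real m) powr p * (2 / real m) + (\<Sum>j<n. \<Sum>k<D ^ j. \<bar>a j k\<bar> powr p *
      (2 / real m * (1 / real (D ^ j) * (C * (real (D ^ j) / real m) powr \<gamma>)))))" .
  qed simp
  also have "\<dots> = ennreal (real m * ((L / real m) powr p * (2 / real m) + (\<Sum>j<n. \<Sum>k<D ^ j. \<bar>a j k\<bar> powr p *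
      (2 / real m * (1 / real (D ^ j) * (C * (real (D ^ j) / real m) powr \<gamma>))))))"
    using C by (intro ennreal_mult[symmetric]) (auto intro!: sum_nonneg add_nonneg_nonneg)
  also have "real m * ((L / real m) powr p * (2 / real m) + (\<Sum>j<n. \<Sum>k<D ^ j. \<bar>a j k\<bar> powr p *
      (2 / real m * (1 / real (D ^ j) * (C * (real (D ^ j) / real m) powr \<gamma>)))))
    = 2 * (L / real m) powr p + 2 * C * (\<Sum>j<n. (real (D ^ j) / real m) powr \<gamma> * ((\<Sum>k<D ^ j. \<bar>a j k\<bar> powr p) / real (D ^ j)))"
  proof -
    have "real m * (\<Sum>j<n. \<Sum>k<D ^ j. \<bar>a j k\<bar> powr p * (2 / real m * (1 / real (D ^ j) * (C * (real (D ^ j) / real m) powr \<gamma>))))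
      = 2 * C * (\<Sum>j<n. (real (D ^ j) / real m) powr \<gamma> * ((\<Sum>k<D ^ j. \<bar>a j k\<bar> powr p) / real (D ^ j)))"
      unfolding sum_distrib_left sum_divide_distrib
      by (intro sum.cong refl) (use m in \<open>simp add: field_simps\<close>)
    then show ?thesis using m by (simp add: distrib_left)
  qed
  finally show ?thesis unfolding g_def m_def .
qed

text \<open>This subdivides the blocks that survive one correction for the next one.\<close>

lemma blocks_refine:
  assumes m: "m > 0" and D: "D > 0"
  shows "blocks (D * m) {k. k div D \<in> B} = blocks m B"
proof -
  have "x \<in> blocks (D * m) {k. k div D \<in> B} \<longleftrightarrow> x \<in> blocks m B" for x
  proof
    assume "x \<in> blocks (D * m) {k. k div D \<in> B}"
    then obtain k where k: "k div D \<in> B" "real k \<le> real D * (real m * x)" "real D * (real m * x) < real k + 1"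
      using m D by (auto simp: blocks_def in_block_iff mult.assoc)
    have "D * (k div D) \<le> k" by simp
    then have 1: "real D * real (k div D) \<le> real k" by (metis of_nat_mult of_nat_le_iff)
    have "k < D * Suc (k div D)" using D by (metis mult_Suc_right dividend_less_times_div add.commute)
    then have "Suc k \<le> D * Suc (k div D)" by simp
    then have 2: "real k + 1 \<le> real D * (real (k div D) + 1)"
      by (metis of_nat_Suc of_nat_mult of_nat_le_iff add.commute)
    have "real D * real (k div D) \<le> real D * (real m * x)" "real D * (real m * x) < real D * (real (k div D) + 1)"
      using 1 2 k by linarith+
    then have "real (k div D) \<le> real m * x" "real m * x < real (k div D) + 1" using D by simp_all
    then show "x \<in> blocks m B" using k m by (auto simp: blocks_def in_block_iff intro!: bexI[of _ "k div D"])
  next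
    assume "x \<in> blocks m B"
    then obtain b where b: "b \<in> B" "real b \<le> real m * x" "real m * x < real b + 1"
      using m by (auto simp: blocks_def in_block_iff)
    define k where "k = nat \<lfloor>real D * (real m * x)\<rfloor>"
    have "0 \<le> real m * x" using b(2) of_nat_0_le_iff[of b, where 'a = real] by linarith
    then have nn: "0 \<le> real D * (real m * x)" by simp
    have k: "real k \<le> real D * (real m * x)" "real D * (real m * x) < real k + 1" using nn by (auto simp: k_def)
    have "real D * real b \<le> real D * (real m * x)" "real D * (real m * x) < real D * (real b + 1)"
      using b D by simp_all
    then have "real (D * b) < real k + 1" "real k < real (D * (b + 1))" using k by (simp_all add: distrib_left)
    then have "D * b < k + 1" "k < D * (b + 1)" by (metis of_nat_Suc of_nat_less_iff Suc_eq_plus1 add.commute)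
       (use \<open>real k < real (D * (b + 1))\<close> in \<open>simp only: of_nat_less_iff\<close>)
    then have "k div D = b" using D by (intro div_nat_eqI) (auto simp: mult.commute)
    then have "k div D \<in> B" using b by simp
    then show "x \<in> blocks (D * m) {k. k div D \<in> B}"
      using k m D by (auto simp: blocks_def in_block_iff mult.assoc intro!: exI[of _ k])
  qed
  then show ?thesis by blast
qed

lemma blocks_diff:
  assumes "m > 0"
  shows "blocks m A - blocks m B = blocks m (A - B)"
proof -
  have "k = k'" if "x \<in> block m k" "x \<in> block m k'" for x k k'
    using that assms by (auto simp: in_block_iff)
  then show ?thesis unfolding blocks_def by blast
qed

lemma emeasure_blocks:
  assumes m: "m > 0" and A: "finite A"
  shows "emeasure lborel (blocks m A) = ennreal (real (card A) / real m)"
proof -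
  have "emeasure lborel (blocks m A) = (\<integral>\<^sup>+x. 1 * indicator (blocks m A) x \<partial>lborel)" by simp
  also have "\<dots> = (\<Sum>k\<in>A. ennreal (1 / real m))"
    using m A by (subst nn_integral_blocks) (auto simp: emeasure_block)
  also have "\<dots> = ennreal (\<Sum>k\<in>A. 1 / real m)" by (intro sum_ennreal) auto
  finally show ?thesis by simp
qed

lemma blocks_subset_unit: "m > 0 \<Longrightarrow> A \<subseteq> {..<m} \<Longrightarrow> blocks m A \<subseteq> {0..<1}"
proof
  fix x assume m: "m > 0" and A: "A \<subseteq> {..<m}" and "x \<in> blocks m A"
  then obtain k where k: "k < m" "real k \<le> real m * x" "real m * x < real k + 1"
    by (auto simp: blocks_def in_block_iff)
  have "0 \<le> real m * x" using k(2) by linarith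
  moreover have "real k + 1 \<le> real m" using k(1) by simp
  then have "real m * x < real m * 1" using k(3) by linarith
  ultimately show "x \<in> {0..<1}" using m by (auto simp: zero_le_mult_iff)
qed

text \<open>As \<open>2 d \<le> r\<close>, the sum is dominated by its last term.\<close>

lemma geometric_convolution:
  fixes d r :: real
  assumes "0 \<le> d" "2 * d \<le> r"
  shows "(\<Sum>j<Suc n. d ^ (Suc n - j) * r ^ j) \<le> 2 * d * r ^ n"
proof (induction n)
  case (Suc n)
  have "(\<Sum>j<Suc (Suc n). d ^ (Suc (Suc n) - j) * r ^ j) = (\<Sum>j<Suc n. d * (d ^ (Suc n - j) * r ^ j)) + d * r ^ Suc n"
    by (simp add: Suc_diff_le mult.assoc)
  also have "(\<Sum>j<Suc n. d * (d ^ (Suc n - j) * r ^ j)) = d * (\<Sum>j<Suc n. d ^ (Suc n - j) * r ^ j)"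
    by (rule sum_distrib_left[symmetric])
  also have "\<dots> \<le> d * (2 * d * r ^ n)" using Suc assms by (intro mult_left_mono) auto
  also have "\<dots> \<le> d * (r * r ^ n)" using assms by (intro mult_left_mono mult_right_mono) auto
  finally show ?case by simp
qed (use assms in simp)

lemma corrected_Suc:
  "corrected f0 \<psi> D (a(n := b)) (Suc n) x = corrected f0 \<psi> D a n x + (\<Sum>k<D ^ n. b k * \<psi> n (real (D ^ n) * x - real k))"
  by (simp add: corrected_def)

lemma corrected_cong:
  assumes "\<And>j. j < n \<Longrightarrow> a j = a' j"
  shows "corrected f0 \<psi> D a n = corrected f0 \<psi> D a' n"
  unfolding corrected_def[abs_def] using assms by simp

lemma nn_integral_energy:
  assumes [measurable]: "f \<in> borel_measurable borel" "S \<in> sets borel" and q: "q \<ge> 0"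
  shows "(\<integral>\<^sup>+y. energy p q m f y * indicator S y \<partial>lborel) =
     ennreal q * (\<integral>\<^sup>+y. ennreal (\<bar>f y\<bar> powr p) * indicator S y \<partial>lborel)
     + (\<integral>\<^sup>+y. ennreal (real m) * osc p m f y * indicator S y \<partial>lborel)"
proof -
  have "energy p q m f y * indicator S y = ennreal q * (ennreal (\<bar>f y\<bar> powr p) * indicator S y)
     + ennreal (real m) * osc p m f y * indicator S y" for y
    unfolding energy_def distrib_right using q by (simp add: ennreal_mult mult.assoc)
  then show ?thesis by (simp add: nn_integral_add nn_integral_cmult)
qed

text \<open>The energy bound \<open>U q1^n\<close> with \<open>q < q1 < 1\<close> is propagated by induction: the correction multiplies the integral of
  \<open>|f|^p\<close> by \<open>q\<close>, and the oscillation at the next scale, a convolution of the earlier energies with powers of \<open>D^(-\<gamma>)\<close>, fits into the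
  difference between \<open>q\<close> and \<open>q1\<close> for large \<open>D\<close>. Only the square root \<open>r\<close> of \<open>q1\<close> is spent on the decay of the thresholds \<open>M\<close>,
  where \<open>M^p = \<Lambda>^p r^n\<close>; the other square root makes the abandoned measure, which is of order \<open>U q1^n / M^p\<close>, summable.

  The numbers \<open>D\<close>, \<open>U\<close> and \<open>r\<close> come before \<open>\<psi>\<close> and \<open>\<Lambda>\<close> in the quantification, because the widths of the atoms in \<open>\<psi> j\<close>
  and the factor \<open>\<Lambda>\<close> will be chosen in terms of them.\<close>

lemma iterated_correction:
  fixes f0 :: "real \<Rightarrow> real" and p q C \<gamma> L F :: real
  assumes p: "0 < p" "p \<le> 1" and q: "0 < q" "q < 1" and C: "C \<ge> 0" and \<gamma>: "\<gamma> > 0" and L: "L \<ge> 0"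
    and f0 [measurable]: "f0 \<in> borel_measurable borel"
    and lip: "\<And>y h. y \<in> {0..<1} \<Longrightarrow> \<bar>h\<bar> \<le> 1 \<Longrightarrow> \<bar>f0 (y + h) - f0 y\<bar> \<le> L * \<bar>h\<bar>"
    and F: "\<And>y. y \<in> {0..<1} \<Longrightarrow> \<bar>f0 y\<bar> \<le> F"
  shows "\<exists>(D::nat) U r. 2 \<le> D \<and> 0 < U \<and> 0 < r \<and> r < 1 \<and> (\<forall>\<psi> \<Lambda>. 0 < \<Lambda> \<longrightarrow>
    (\<forall>j. \<psi> j \<in> borel_measurable borel) \<longrightarrow>
    (\<forall>j. (\<integral>\<^sup>+x. ennreal (\<bar>indicator {0..<1} x + \<psi> j x\<bar> powr p) \<partial>lborel) \<le> ennreal q) \<longrightarrow>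
    (\<forall>j h. \<bar>h\<bar> \<le> 1 \<longrightarrow> (\<integral>\<^sup>+x. ennreal (\<bar>\<psi> j (x + h) - \<psi> j x\<bar> powr p) \<partial>lborel) \<le> ennreal (C * \<bar>h\<bar> powr \<gamma>)) \<longrightarrow>
    (\<exists>a A. A 0 = {0} \<and> (\<forall>n. A n \<subseteq> {..<D ^ n}) \<and> (\<forall>n k. \<bar>a n k\<bar> \<le> \<Lambda> * (r powr (1 / p)) ^ n) \<and>
      (\<forall>n. (\<integral>\<^sup>+x. ennreal (\<bar>corrected f0 \<psi> D a n x\<bar> powr p) * indicator (blocks (D ^ n) (A n)) x \<partial>lborel)
         \<le> ennreal (U / q * (r\<^sup>2) ^ n)) \<and>
      (\<forall>n. emeasure lborel (blocks (D ^ n) (A n) - blocks (D ^ Suc n) (A (Suc n))) \<le> ennreal (U / (q * \<Lambda> powr p) * r ^ n))))"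
proof -
  define q1 where "q1 = (1 + q) / 2"
  define r where "r = sqrt q1"
  have q1: "0 < q1" "q1 < 1" "q < q1" using q by (auto simp: q1_def)
  have r: "0 < r" "r < 1" "r\<^sup>2 = q1" using q1 by (auto simp: r_def)
  define d where "d = min (q1 / 2) ((1 - q) / 2 / (2 + 4 * C / q))"
  have d: "0 < d" "2 * d \<le> q1" "d * (2 + 4 * C / q) \<le> (1 - q) / 2"
  proof -
    have pos: "2 + 4 * C / q > 0" using C q by (simp add: add_pos_nonneg)
    show "0 < d" unfolding d_def using pos q q1 by simp
    have "d \<le> q1 / 2" unfolding d_def by (rule min.cobounded1)
    then show "2 * d \<le> q1" by simp
    have "d \<le> (1 - q) / 2 / (2 + 4 * C / q)" unfolding d_def by (rule min.cobounded2)
    then show "d * (2 + 4 * C / q) \<le> (1 - q) / 2" using pos by (simp only: pos_le_divide_eq)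
  qed
  have "((\<lambda>D. real D powr - \<gamma>) \<longlongrightarrow> 0) sequentially" "((\<lambda>D. real D powr - p) \<longlongrightarrow> 0) sequentially"
    using \<gamma> p by (auto intro!: tendsto_neg_powr filterlim_real_sequentially)
  then have "eventually (\<lambda>D. real D powr - \<gamma> < d) sequentially" "eventually (\<lambda>D. real D powr - p < d) sequentially"
    using d(1) by (auto dest: order_tendstoD(2))
  then have "eventually (\<lambda>D. real D powr - \<gamma> < d \<and> real D powr - p < d \<and> D \<ge> 2) sequentially"
    using eventually_ge_at_top[of 2] by eventually_elim auto
  then obtain D :: nat where D: "real D powr - \<gamma> < d" "real D powr - p < d" "D \<ge> 2"
    by (auto simp: eventually_sequentially)
  have D0: "D > 0" "real D > 0" using D by auto
  define U where "U = \<bar>F\<bar> powr p + 2 * L powr p + 1"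
  have U: "U > 0" "L powr p \<le> U" by (auto simp: U_def add_nonneg_pos)
  have numeric: "q * (U * q1 ^ n) + (2 * (L / real (D ^ Suc n)) powr p
      + 2 * C * (\<Sum>j<Suc n. (real (D ^ j) / real (D ^ Suc n)) powr \<gamma> * s j)) \<le> U * q1 ^ Suc n"
    if s: "\<And>j. j < Suc n \<Longrightarrow> 0 \<le> s j \<and> s j \<le> U * q1 ^ j / q" for n s
  proof -
    have pw: "(1 / real (D ^ i)) powr e = (real D powr - e) ^ i" for i e
      using D0 by (simp add: powr_divide powr_power powr_minus powr_realpow[symmetric] powr_powr mult.commute field_simps)
    have dn: "d ^ n \<le> q1 ^ n" using d by (intro power_mono) auto
    have "(L / real (D ^ Suc n)) powr p = L powr p * (real D powr - p) ^ Suc n"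
      unfolding pw[symmetric] powr_mult[symmetric] by simp
    also have "\<dots> \<le> U * d ^ Suc n" using U D by (intro mult_mono power_mono) auto
    also have "\<dots> \<le> U * (d * q1 ^ n)" using U d dn by (intro mult_left_mono) auto
    finally have 1: "2 * (L / real (D ^ Suc n)) powr p \<le> 2 * (U * d * q1 ^ n)" by simp
    have "(\<Sum>j<Suc n. (real (D ^ j) / real (D ^ Suc n)) powr \<gamma> * s j) \<le> (\<Sum>j<Suc n. (U / q) * (d ^ (Suc n - j) * q1 ^ j))"
    proof (rule sum_mono)
      fix j assume j: "j \<in> {..<Suc n}"
      have "D ^ Suc n = D ^ j * D ^ (Suc n - j)" using j by (simp only: power_add[symmetric]) simp
      then have "real (D ^ j) / real (D ^ Suc n) = 1 / real (D ^ (Suc n - j))"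
        using D0 by (simp only: of_nat_mult) simp
      then have "(real (D ^ j) / real (D ^ Suc n)) powr \<gamma> = (real D powr - \<gamma>) ^ (Suc n - j)" by (simp only: pw)
      also have "\<dots> \<le> d ^ (Suc n - j)" using D by (intro power_mono) auto
      finally have "(real (D ^ j) / real (D ^ Suc n)) powr \<gamma> * s j \<le> d ^ (Suc n - j) * (U * q1 ^ j / q)"
        using s[of j] j d by (intro mult_mono) auto
      then show "(real (D ^ j) / real (D ^ Suc n)) powr \<gamma> * s j \<le> (U / q) * (d ^ (Suc n - j) * q1 ^ j)"
        by (simp add: mult_ac)
    qed
    also have "\<dots> = (U / q) * (\<Sum>j<Suc n. d ^ (Suc n - j) * q1 ^ j)" by (rule sum_distrib_left[symmetric])
    also have "\<dots> \<le> (U / q) * (2 * d * q1 ^ n)"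
      using U q d by (intro mult_left_mono geometric_convolution) auto
    finally have "2 * C * (\<Sum>j<Suc n. (real (D ^ j) / real (D ^ Suc n)) powr \<gamma> * s j) \<le> 2 * C * ((U / q) * (2 * d * q1 ^ n))"
      using C by (intro mult_left_mono) auto
    then have "q * (U * q1 ^ n) + (2 * (L / real (D ^ Suc n)) powr p
      + 2 * C * (\<Sum>j<Suc n. (real (D ^ j) / real (D ^ Suc n)) powr \<gamma> * s j))
      \<le> q * (U * q1 ^ n) + (2 * (U * d * q1 ^ n) + 2 * C * ((U / q) * (2 * d * q1 ^ n)))"
      using 1 by linarith
    also have "\<dots> = (U * q1 ^ n) * (q + d * (2 + 4 * C / q))" by (simp add: algebra_simps)
    also have "\<dots> \<le> (U * q1 ^ n) * (q + (1 - q) / 2)" using U d q1 by (intro mult_left_mono add_left_mono) auto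
    also have "q + (1 - q) / 2 = q1" by (simp add: q1_def field_simps)
    finally show ?thesis by (simp add: mult_ac)
  qed
  have main: "\<exists>a A. A 0 = {0} \<and> (\<forall>n. A n \<subseteq> {..<D ^ n}) \<and> (\<forall>n k. \<bar>a n k\<bar> \<le> \<Lambda> * (r powr (1 / p)) ^ n) \<and>
      (\<forall>n. (\<integral>\<^sup>+x. ennreal (\<bar>corrected f0 \<psi> D a n x\<bar> powr p) * indicator (blocks (D ^ n) (A n)) x \<partial>lborel)
         \<le> ennreal (U / q * (r\<^sup>2) ^ n)) \<and>
      (\<forall>n. emeasure lborel (blocks (D ^ n) (A n) - blocks (D ^ Suc n) (A (Suc n))) \<le> ennreal (U / (q * \<Lambda> powr p) * r ^ n))"
    if \<Lambda>: "0 < \<Lambda>" and \<psi> [measurable]: "\<And>j. \<psi> j \<in> borel_measurable borel"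
      and gain: "\<And>j. (\<integral>\<^sup>+x. ennreal (\<bar>indicator {0..<1} x + \<psi> j x\<bar> powr p) \<partial>lborel) \<le> ennreal q"
      and modulus: "\<And>j h. \<bar>h\<bar> \<le> 1 \<Longrightarrow> (\<integral>\<^sup>+x. ennreal (\<bar>\<psi> j (x + h) - \<psi> j x\<bar> powr p) \<partial>lborel) \<le> ennreal (C * \<bar>h\<bar> powr \<gamma>)"
    for \<psi> :: "nat \<Rightarrow> real \<Rightarrow> real" and \<Lambda> :: real
  proof -
    have cm [measurable]: "corrected f0 \<psi> D a n \<in> borel_measurable borel" for a n
      by (rule corrected_measurable) auto
    have Dn: "D ^ n > 0" for n using D0 by simp
    \<comment> \<open>A state consists of the coefficients and the indices of the blocks alive. \<open>P\<close> is the invariant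
      of a state at generation \<open>n\<close>, \<open>Q\<close> relates the states at generations \<open>n\<close> and \<open>n + 1\<close>.\<close>
    define P where "P n s \<longleftrightarrow> snd s \<subseteq> {..<D ^ n} \<and> (n = 0 \<longrightarrow> snd s = {0}) \<and>
        (\<forall>j<n. (\<Sum>k<D ^ j. \<bar>fst s j k\<bar> powr p) / real (D ^ j) \<le> U * q1 ^ j / q) \<and>
        (\<integral>\<^sup>+y. energy p q (D ^ n) (corrected f0 \<psi> D (fst s) n) y * indicator (blocks (D ^ n) (snd s)) y \<partial>lborel) \<le> ennreal (U * q1 ^ n)"
      for n and s :: "(nat \<Rightarrow> nat \<Rightarrow> real) \<times> nat set"
    define Q where "Q n s s' \<longleftrightarrow> (\<forall>j<n. fst s' j = fst s j) \<and> (\<forall>k. \<bar>fst s' n k\<bar> \<le> \<Lambda> * (r powr (1 / p)) ^ n) \<and>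
        emeasure lborel (blocks (D ^ n) (snd s) - blocks (D ^ Suc n) (snd s')) \<le> ennreal (U / (q * \<Lambda> powr p) * r ^ n)"
      for n and s s' :: "(nat \<Rightarrow> nat \<Rightarrow> real) \<times> nat set"
    have start: "P 0 (\<lambda>_ _. 0, {0})"
    proof -
      have S: "blocks 1 {0} = {0..<1}" by (auto simp: blocks_def block_def)
      have c0: "corrected f0 \<psi> D (\<lambda>_ _. 0) 0 = f0" by (simp add: corrected_def[abs_def])
      have "(\<integral>\<^sup>+y. ennreal (real 1) * osc p 1 f0 y * indicator {0..<1} y \<partial>lborel) \<le> ennreal (2 * L powr p)"
        using osc_corrected_le[where S = "{0..<1}" and n = 0 and a = "\<lambda>_ _. 0", OF p D0(1) L C \<gamma> f0 \<psi> lip modulus]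
        by (simp add: corrected_def[abs_def])
      moreover have "ennreal q * (\<integral>\<^sup>+y. ennreal (\<bar>f0 y\<bar> powr p) * indicator {0..<1} y \<partial>lborel) \<le> ennreal (\<bar>F\<bar> powr p)"
      proof -
        have "(\<integral>\<^sup>+y. ennreal (\<bar>f0 y\<bar> powr p) * indicator {0..<1} y \<partial>lborel) \<le> (\<integral>\<^sup>+y. ennreal (\<bar>F\<bar> powr p) * indicator {0..<1::real} y \<partial>lborel)"
        proof (rule nn_integral_mono)
          fix y :: real
          have "\<bar>f0 y\<bar> powr p \<le> \<bar>F\<bar> powr p" if "y \<in> {0..<1}" using F[OF that] p by (intro powr_mono2) auto
          then show "ennreal (\<bar>f0 y\<bar> powr p) * indicator {0..<1} y \<le> ennreal (\<bar>F\<bar> powr p) * indicator {0..<1} y"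
            by (auto simp: indicator_def intro: ennreal_leI)
        qed
        also have "\<dots> = ennreal (\<bar>F\<bar> powr p)" by (subst nn_integral_cmult_indicator) auto
        finally have "ennreal q * (\<integral>\<^sup>+y. ennreal (\<bar>f0 y\<bar> powr p) * indicator {0..<1} y \<partial>lborel) \<le> 1 * ennreal (\<bar>F\<bar> powr p)"
          using q by (intro mult_mono) auto
        then show ?thesis by simp
      qed
      ultimately have "(\<integral>\<^sup>+y. energy p q 1 f0 y * indicator {0..<1} y \<partial>lborel) \<le> ennreal (\<bar>F\<bar> powr p) + ennreal (2 * L powr p)"
        using q by (subst nn_integral_energy) (auto intro: add_mono)
      also have "\<dots> \<le> ennreal U" by (subst ennreal_plus[symmetric]) (auto simp: U_def intro!: ennreal_leI)
      finally show ?thesis unfolding P_def using S c0 by simp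
    qed
    have step: "\<exists>s'. P (Suc n) s' \<and> Q n s s'" if P: "P n s" for n s
    proof -
      define a where "a = fst s"
      define A where "A = snd s"
      define M where "M = \<Lambda> * (r powr (1 / p)) ^ n"
      define f where "f = corrected f0 \<psi> D a n"
      have M: "M > 0" unfolding M_def using \<Lambda> r by simp
      have Mp: "M powr p = \<Lambda> powr p * r ^ n"
      proof -
        have "(x ^ n) powr p = (x powr p) ^ n" for x :: real by (induction n) (simp_all add: powr_mult)
        then show ?thesis unfolding M_def using r p by (simp add: powr_mult powr_powr)
      qed
      have A: "A \<subseteq> {..<D ^ n}" and old: "\<And>j. j < n \<Longrightarrow> (\<Sum>k<D ^ j. \<bar>a j k\<bar> powr p) / real (D ^ j) \<le> U * q1 ^ j / q"
        and en: "(\<integral>\<^sup>+y. energy p q (D ^ n) f y * indicator (blocks (D ^ n) A) y \<partial>lborel) \<le> ennreal (U * q1 ^ n)"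
        using P unfolding P_def a_def A_def f_def by auto
      have un: "U * q1 ^ n \<ge> 0" using U q1 by simp
      have fm: "f \<in> borel_measurable borel" unfolding f_def by (rule cm)
      obtain b B where B: "B \<subseteq> A" and b: "\<And>k. \<bar>b k\<bar> \<le> M" and sb: "(\<Sum>k<D ^ n. \<bar>b k\<bar> powr p) / real (D ^ n) \<le> U * q1 ^ n / q"
        and int: "(\<integral>\<^sup>+x. ennreal (\<bar>f x + (\<Sum>k<D ^ n. b k * \<psi> n (real (D ^ n) * x - real k))\<bar> powr p) * indicator (blocks (D ^ n) B) x \<partial>lborel) \<le> ennreal (U * q1 ^ n)"
        and dead: "real (card (A - B)) / real (D ^ n) \<le> U * q1 ^ n / (q * M powr p)"
        using correction_step[OF p q(1) Dn M un fm \<psi>[of n] A gain[of n] en] by blast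
      define a' where "a' = a(n := b)"
      define A' where "A' = {k. k div D \<in> B}"
      have bl: "blocks (D ^ Suc n) A' = blocks (D ^ n) B"
        unfolding A'_def using blocks_refine[OF Dn D0(1), of n B] by simp
      have A'sub: "A' \<subseteq> {..<D ^ Suc n}"
      proof
        fix k assume "k \<in> A'"
        then have "k div D < D ^ n" using B A by (auto simp: A'_def)
        then have "k < D ^ n * D" using D0 by (simp add: div_less_iff_less_mult)
        then show "k \<in> {..<D ^ Suc n}" by (simp add: mult.commute)
      qed
      have sums: "(\<Sum>k<D ^ j. \<bar>a' j k\<bar> powr p) / real (D ^ j) \<le> U * q1 ^ j / q" if "j < Suc n" for j
        using that old[of j] sb by (cases "j = n") (auto simp: a'_def)
      define f' where "f' = corrected f0 \<psi> D a' (Suc n)"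
      have f': "f' x = f x + (\<Sum>k<D ^ n. b k * \<psi> n (real (D ^ n) * x - real k))" for x
        unfolding f'_def a'_def f_def by (rule corrected_Suc)
      have [measurable]: "f' \<in> borel_measurable borel" unfolding f'_def by (rule cm)
      have "(\<integral>\<^sup>+y. energy p q (D ^ Suc n) f' y * indicator (blocks (D ^ Suc n) A') y \<partial>lborel)
        = ennreal q * (\<integral>\<^sup>+y. ennreal (\<bar>f' y\<bar> powr p) * indicator (blocks (D ^ Suc n) A') y \<partial>lborel)
         + (\<integral>\<^sup>+y. ennreal (real (D ^ Suc n)) * osc p (D ^ Suc n) f' y * indicator (blocks (D ^ Suc n) A') y \<partial>lborel)"
        using q by (intro nn_integral_energy) auto
      also have "\<dots> \<le> ennreal q * ennreal (U * q1 ^ n) + ennreal (2 * (L / real (D ^ Suc n)) powr p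
        + 2 * C * (\<Sum>j<Suc n. (real (D ^ j) / real (D ^ Suc n)) powr \<gamma> * ((\<Sum>k<D ^ j. \<bar>a' j k\<bar> powr p) / real (D ^ j))))"
      proof (rule add_mono)
        show "ennreal q * (\<integral>\<^sup>+y. ennreal (\<bar>f' y\<bar> powr p) * indicator (blocks (D ^ Suc n) A') y \<partial>lborel) \<le> ennreal q * ennreal (U * q1 ^ n)"
          unfolding bl f' by (intro mult_left_mono int) auto
        show "(\<integral>\<^sup>+y. ennreal (real (D ^ Suc n)) * osc p (D ^ Suc n) f' y * indicator (blocks (D ^ Suc n) A') y \<partial>lborel)
          \<le> ennreal (2 * (L / real (D ^ Suc n)) powr p
        + 2 * C * (\<Sum>j<Suc n. (real (D ^ j) / real (D ^ Suc n)) powr \<gamma> * ((\<Sum>k<D ^ j. \<bar>a' j k\<bar> powr p) / real (D ^ j))))"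
          unfolding f'_def using A'sub
          by (intro osc_corrected_le[OF p D0(1) L C \<gamma> f0 \<psi> lip modulus] blocks_subset_unit Dn) auto
      qed
      also have "\<dots> = ennreal (q * (U * q1 ^ n) + (2 * (L / real (D ^ Suc n)) powr p
        + 2 * C * (\<Sum>j<Suc n. (real (D ^ j) / real (D ^ Suc n)) powr \<gamma> * ((\<Sum>k<D ^ j. \<bar>a' j k\<bar> powr p) / real (D ^ j)))))"
      proof -
        have "ennreal q * ennreal (U * q1 ^ n) = ennreal (q * (U * q1 ^ n))"
          using q un by (intro ennreal_mult[symmetric]) auto
        moreover have "0 \<le> 2 * (L / real (D ^ Suc n)) powr p
          + 2 * C * (\<Sum>j<Suc n. (real (D ^ j) / real (D ^ Suc n)) powr \<gamma> * ((\<Sum>k<D ^ j. \<bar>a' j k\<bar> powr p) / real (D ^ j)))"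
          using C by (intro add_nonneg_nonneg mult_nonneg_nonneg sum_nonneg divide_nonneg_nonneg) auto
        moreover have "0 \<le> q * (U * q1 ^ n)" using q un by simp
        ultimately show ?thesis by (simp only: ennreal_plus)
      qed
      also have "\<dots> \<le> ennreal (U * q1 ^ Suc n)"
        by (intro ennreal_leI numeric conjI sums divide_nonneg_nonneg sum_nonneg) auto
      finally have e': "(\<integral>\<^sup>+y. energy p q (D ^ Suc n) f' y * indicator (blocks (D ^ Suc n) A') y \<partial>lborel) \<le> ennreal (U * q1 ^ Suc n)" .
      have "P (Suc n) (a', A')" unfolding P_def fst_conv snd_conv
        by (intro conjI allI impI; (rule A'sub | rule sums, assumption | rule e'[unfolded f'_def] | simp))
      moreover have "Q n s (a', A')"
      proof -
        have "emeasure lborel (blocks (D ^ n) A - blocks (D ^ n) B) = ennreal (real (card (A - B)) / real (D ^ n))"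
          using A Dn unfolding blocks_diff[OF Dn] by (intro emeasure_blocks) (auto intro: finite_subset)
        also have "\<dots> \<le> ennreal (U * q1 ^ n / (q * M powr p))" by (intro ennreal_leI dead)
        also have "U * q1 ^ n / (q * M powr p) = U / (q * \<Lambda> powr p) * r ^ n"
        proof -
          have "q1 ^ n = r ^ n * r ^ n" unfolding r(3)[symmetric] by (simp add: power2_eq_square power_mult_distrib)
          then have "U * q1 ^ n / (q * M powr p) = (U * r ^ n) * r ^ n / ((q * \<Lambda> powr p) * r ^ n)"
            unfolding Mp by (simp only: mult_ac)
          also have "\<dots> = (U * r ^ n) / (q * \<Lambda> powr p)" using r(1) by (intro mult_divide_mult_cancel_right) simp
          finally show ?thesis by simp
        qed
        finally have "emeasure lborel (blocks (D ^ n) A - blocks (D ^ n) B) \<le> ennreal (U / (q * \<Lambda> powr p) * r ^ n)" .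
        moreover have "a' j = a j" if "j < n" for j using that by (simp add: a'_def)
        moreover have "\<bar>a' n k\<bar> \<le> \<Lambda> * (r powr (1 / p)) ^ n" for k using b by (simp add: a'_def M_def)
        ultimately show ?thesis unfolding Q_def fst_conv snd_conv bl A_def[symmetric] a_def[symmetric] by blast
      qed
      ultimately show ?thesis by blast
    qed
    have "\<exists>s. P 0 s" using start by (rule exI[of "P 0"])
    then have "\<exists>s. \<forall>n. P n (s n) \<and> Q n (s n) (s (Suc n))"
      by (rule dependent_nat_choice) (rule step)
    then obtain s where s: "\<And>n. P n (s n)" "\<And>n. Q n (s n) (s (Suc n))" by blast
    \<comment> \<open>Coefficients of generation \<open>j\<close> do not change after step \<open>j + 1\<close>.\<close>
    define a where "a j = fst (s (Suc j)) j" for j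
    define A where "A n = snd (s n)" for n
    have stable: "fst (s (Suc j + i)) j = a j" for i j
    proof (induction i)
      case (Suc i)
      have "fst (s (Suc (Suc j + i))) j = fst (s (Suc j + i)) j" using s(2)[of "Suc j + i"] unfolding Q_def by simp
      then show ?case using Suc by simp
    qed (simp add: a_def)
    have coh: "fst (s n) j = a j" if "j < n" for n j
      using stable[of j "n - Suc j"] that by simp
    have ce: "corrected f0 \<psi> D (fst (s n)) n = corrected f0 \<psi> D a n" for n
      by (rule corrected_cong) (rule coh)
    have intn: "(\<integral>\<^sup>+x. ennreal (\<bar>corrected f0 \<psi> D a n x\<bar> powr p) * indicator (blocks (D ^ n) (A n)) x \<partial>lborel)
         \<le> ennreal (U / q * (r\<^sup>2) ^ n)" for n
    proof -
      let ?I = "\<integral>\<^sup>+x. ennreal (\<bar>corrected f0 \<psi> D a n x\<bar> powr p) * indicator (blocks (D ^ n) (A n)) x \<partial>lborel"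
      have "ennreal q * ?I \<le> (\<integral>\<^sup>+y. energy p q (D ^ n) (corrected f0 \<psi> D a n) y * indicator (blocks (D ^ n) (A n)) y \<partial>lborel)"
        using q by (subst nn_integral_energy) auto
      also have "\<dots> \<le> ennreal (U * q1 ^ n)" using s(1)[of n] unfolding P_def ce A_def by blast
      finally have "ennreal (1 / q) * (ennreal q * ?I) \<le> ennreal (1 / q) * ennreal (U * q1 ^ n)" by (intro mult_left_mono) auto
      moreover have "ennreal (1 / q) * (ennreal q * ?I) = ?I"
        using q by (simp add: mult.assoc[symmetric] ennreal_mult[symmetric])
      moreover have "ennreal (1 / q) * ennreal (U * q1 ^ n) = ennreal (U / q * (r\<^sup>2) ^ n)"
        using q U q1 r(3) by (simp add: ennreal_mult[symmetric])
      ultimately show ?thesis by simp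
    qed
    show ?thesis
    proof (rule exI[of _ a], rule exI[of _ A], intro conjI allI)
      show "A 0 = {0}" using s(1)[of 0] unfolding P_def A_def by simp
      fix n
      show "A n \<subseteq> {..<D ^ n}" using s(1)[of n] unfolding P_def A_def by simp
      show "\<bar>a n k\<bar> \<le> \<Lambda> * (r powr (1 / p)) ^ n" for k using s(2)[of n] unfolding Q_def a_def by simp
      show "emeasure lborel (blocks (D ^ n) (A n) - blocks (D ^ Suc n) (A (Suc n))) \<le> ennreal (U / (q * \<Lambda> powr p) * r ^ n)"
        using s(2)[of n] unfolding Q_def A_def by blast
    qed (rule intn)
  qed
  show ?thesis
    using D(3) U(1) r(1,2) main by (intro exI[of _ D] exI[of _ U] exI[of _ r] conjI allI impI) auto
qed

section \<open>The limit of the corrections\<close>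

text \<open>Comparison with the integral of \<open>1 / (1 + u^2)\<close>, whose primitive is the arctangent, over unit intervals.\<close>

lemma sum_lattice_inverse_square_le:
  fixes z :: real
  shows "(\<Sum>k<m. 1 / (1 + (z - real k)\<^sup>2)) \<le> 12"
proof -
  have slope: "1 / (1 + (z - real k)\<^sup>2) \<le> 3 * (arctan (real (Suc k) - z) - arctan (real k - z))" for k
  proof -
    have "\<exists>\<xi>. real k - z < \<xi> \<and> \<xi> < real (Suc k) - z \<and>
       arctan (real (Suc k) - z) - arctan (real k - z) = (real (Suc k) - z - (real k - z)) * inverse (1 + \<xi>\<^sup>2)"
      by (rule MVT2) (auto intro: DERIV_arctan)
    then obtain \<xi> where \<xi>: "real k - z < \<xi>" "\<xi> < real k - z + 1"
      "arctan (real (Suc k) - z) - arctan (real k - z) = inverse (1 + \<xi>\<^sup>2)" by auto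
    define u where "u = real k - z"
    have "\<xi>\<^sup>2 \<le> 2 * u\<^sup>2 + 2"
    proof -
      have "(\<xi> - u)\<^sup>2 \<le> 1\<^sup>2" using \<xi> unfolding u_def by (intro power_mono) auto
      moreover have "\<xi>\<^sup>2 = u\<^sup>2 + (\<xi> - u)\<^sup>2 + 2 * u * (\<xi> - u)" by (simp add: power2_eq_square algebra_simps)
      moreover have "2 * u * (\<xi> - u) \<le> u\<^sup>2 + (\<xi> - u)\<^sup>2" by (rule sum_squares_bound)
      ultimately show ?thesis by simp
    qed
    moreover have "3 * (1 + u\<^sup>2) = 3 + 2 * u\<^sup>2 + u\<^sup>2" by simp
    ultimately have "1 + \<xi>\<^sup>2 \<le> 3 * (1 + u\<^sup>2)" using zero_le_power2[of u] by linarith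
    moreover have "0 < 1 + \<xi>\<^sup>2" "0 < 1 + u\<^sup>2" by (simp_all add: add_pos_nonneg)
    ultimately have "1 / (1 + u\<^sup>2) \<le> 3 * inverse (1 + \<xi>\<^sup>2)" by (simp add: field_simps)
    moreover have "(z - real k)\<^sup>2 = u\<^sup>2" by (simp add: u_def power2_commute)
    ultimately show ?thesis using \<xi>(3) by simp
  qed
  have "(\<Sum>k<m. 1 / (1 + (z - real k)\<^sup>2)) \<le> (\<Sum>k<m. 3 * (arctan (real (Suc k) - z) - arctan (real k - z)))"
    by (intro sum_mono slope)
  also have "\<dots> = 3 * (arctan (real m - z) - arctan (real 0 - z))"
    unfolding sum_distrib_left[symmetric] by (subst sum_lessThan_telescope) simp
  also have "\<dots> \<le> 3 * (pi / 2 + pi / 2)"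
    using arctan_ubound[of "real m - z"] arctan_lbound[of "real 0 - z"] by simp
  also have "\<dots> \<le> 12" using pi_less_4 by simp
  finally show ?thesis .
qed

text \<open>Far from the unit interval every term is at most \<open>4 / (m x)^2\<close>, and there are only \<open>m\<close> of them.\<close>

lemma sum_scaled_lattice_le:
  fixes x :: real
  assumes m: "m > 0"
  shows "(\<Sum>k<m. 1 / (1 + (real m * x - real k)\<^sup>2)) \<le> 60 / (1 + x\<^sup>2)"
proof (cases "\<bar>x\<bar> \<ge> 2")
  case False
  have "x\<^sup>2 \<le> 2\<^sup>2" using False by (intro abs_le_square_iff[THEN iffD1]) auto
  then have "12 \<le> 60 / (1 + x\<^sup>2)" by (simp add: field_simps add_pos_nonneg)
  then show ?thesis using sum_lattice_inverse_square_le[where m = m and z = "real m * x"] by linarith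
next
  case True
  have x2: "4 \<le> x\<^sup>2" using abs_le_square_iff[of 2 x] True by simp
  have "1 / (1 + (real m * x - real k)\<^sup>2) \<le> 4 / ((real m)\<^sup>2 * x\<^sup>2)" if k: "k < m" for k
  proof -
    have "real m * \<bar>x\<bar> \<le> \<bar>real m * x - real k\<bar> + real k" using abs_triangle_ineq[of "real m * x - real k" "real k"]
      by (simp add: abs_mult)
    moreover have "real m * 2 \<le> real m * \<bar>x\<bar>" using True by (intro mult_left_mono) auto
    moreover have "real k \<le> real m" using k by simp
    ultimately have "real m * \<bar>x\<bar> / 2 \<le> \<bar>real m * x - real k\<bar>" by linarith
    then have "(real m * \<bar>x\<bar> / 2)\<^sup>2 \<le> \<bar>real m * x - real k\<bar>\<^sup>2" by (intro power_mono) auto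
    then have "(real m)\<^sup>2 * x\<^sup>2 / 4 \<le> 1 + (real m * x - real k)\<^sup>2" by (simp add: power_mult_distrib power_divide)
    then have "1 / (1 + (real m * x - real k)\<^sup>2) \<le> 1 / ((real m)\<^sup>2 * x\<^sup>2 / 4)"
    proof (rule divide_left_mono)
      have "0 < (real m)\<^sup>2 * x\<^sup>2 / 4" using m less_le_trans[OF _ x2, of 0] by (intro divide_pos_pos mult_pos_pos) auto
      then show "0 < (1 + (real m * x - real k)\<^sup>2) * ((real m)\<^sup>2 * x\<^sup>2 / 4)"
        by (intro mult_pos_pos add_pos_nonneg) auto
    qed simp
    then show ?thesis by simp
  qed
  then have "(\<Sum>k<m. 1 / (1 + (real m * x - real k)\<^sup>2)) \<le> (\<Sum>k<m. 4 / ((real m)\<^sup>2 * x\<^sup>2))" by (intro sum_mono) auto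
  also have "\<dots> = 4 / (real m * x\<^sup>2)" using m by (simp add: power2_eq_square)
  also have "\<dots> \<le> 4 / (1 * x\<^sup>2)"
  proof (rule divide_left_mono)
    show "1 * x\<^sup>2 \<le> real m * x\<^sup>2" using m by (intro mult_right_mono) auto
    show "0 < (real m * x\<^sup>2) * (1 * x\<^sup>2)" using m x2 by (intro mult_pos_pos) auto
  qed simp
  also have "\<dots> = 60 / (15 * x\<^sup>2)" by simp
  also have "\<dots> \<le> 60 / (1 + x\<^sup>2)"
  proof (rule divide_left_mono)
    show "1 + x\<^sup>2 \<le> 15 * x\<^sup>2" using x2 by linarith
    show "0 < (15 * x\<^sup>2) * (1 + x\<^sup>2)" using x2 by (intro mult_pos_pos) auto
  qed simp
  finally show ?thesis .
qed

lemma interpolate_bounds: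
  fixes d A B h b \<tau> :: real
  assumes "\<bar>d\<bar> \<le> A" "\<bar>d\<bar> \<le> B * h powr b" "0 < \<tau>" "\<tau> < 1"
  shows "\<bar>d\<bar> \<le> A powr (1 - \<tau>) * B powr \<tau> * h powr (b * \<tau>)"
proof -
  have "\<bar>d\<bar> = \<bar>d\<bar> powr (1 - \<tau>) * \<bar>d\<bar> powr \<tau>" by (simp add: powr_add[symmetric])
  also have "\<dots> \<le> A powr (1 - \<tau>) * (B * h powr b) powr \<tau>"
    using assms by (intro mult_mono powr_mono2) auto
  also have "\<dots> = A powr (1 - \<tau>) * B powr \<tau> * h powr (b * \<tau>)" by (simp add: powr_mult powr_powr)
  finally show ?thesis .
qed

text \<open>Interpolating the two bounds with weight \<open>\<tau>\<close> gives the terms \<open>(\<theta>^(1-\<tau>) E^\<tau>)^j |x - y|^(b \<tau>)\<close>, and for small \<open>\<tau>\<close> the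
  base is less than 1 no matter how large \<open>E\<close> is.\<close>

lemma holder_suminf:
  fixes g :: "nat \<Rightarrow> real \<Rightarrow> real" and \<theta> E G H b :: real
  assumes \<theta>: "0 < \<theta>" "\<theta> < 1" and E: "E \<ge> 1"
    and small: "\<And>j x. \<bar>g j x\<bar> \<le> G * \<theta> ^ j"
    and rough: "\<And>j x y. \<bar>g j x - g j y\<bar> \<le> H * E ^ j * \<bar>x - y\<bar> powr b"
  shows "\<exists>\<tau> J. 0 < \<tau> \<and> \<tau> < 1 \<and> (\<forall>x y. \<bar>(\<Sum>j. g j x) - (\<Sum>j. g j y)\<bar> \<le> J * \<bar>x - y\<bar> powr (b * \<tau>))"
proof -
  \<comment> \<open>The solution of \<open>\<theta>^(1-\<tau>) E^\<tau> = sqrt \<theta>\<close>.\<close>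
  define \<tau> where "\<tau> = - ln \<theta> / (2 * (ln E - ln \<theta>))"
  have lnt: "ln \<theta> < 0" "ln E \<ge> 0" using \<theta> E by auto
  have \<tau>: "0 < \<tau>" "\<tau> < 1" "(1 - \<tau>) * ln \<theta> + \<tau> * ln E = ln \<theta> / 2"
  proof -
    have pos: "0 < 2 * (ln E - ln \<theta>)" using lnt by simp
    show "0 < \<tau>" unfolding \<tau>_def using lnt pos by (intro divide_pos_pos) auto
    show "\<tau> < 1" unfolding \<tau>_def pos_divide_less_eq[OF pos] using lnt by simp
    have "\<tau> * (2 * (ln E - ln \<theta>)) = - ln \<theta>" unfolding \<tau>_def using pos by simp
    then show "(1 - \<tau>) * ln \<theta> + \<tau> * ln E = ln \<theta> / 2" by (simp add: algebra_simps)
  qed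
  define \<kappa> where "\<kappa> = \<theta> powr (1 - \<tau>) * E powr \<tau>"
  have \<kappa>: "0 < \<kappa>" "\<kappa> < 1"
  proof -
    have "\<kappa> = exp ((1 - \<tau>) * ln \<theta> + \<tau> * ln E)" unfolding \<kappa>_def using \<theta> E by (simp add: powr_def exp_add)
    then have "\<kappa> = exp (ln \<theta> / 2)" using \<tau>(3) by simp
    then show "0 < \<kappa>" "\<kappa> < 1" using lnt by auto
  qed
  define J where "J = (2 * G) powr (1 - \<tau>) * H powr \<tau>"
  have diff: "\<bar>g j x - g j y\<bar> \<le> J * \<kappa> ^ j * \<bar>x - y\<bar> powr (b * \<tau>)" for j x y
  proof -
    have "\<bar>g j x - g j y\<bar> \<le> (2 * G * \<theta> ^ j) powr (1 - \<tau>) * (H * E ^ j) powr \<tau> * \<bar>x - y\<bar> powr (b * \<tau>)"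
    proof (rule interpolate_bounds[OF _ rough \<tau>(1,2)])
      show "\<bar>g j x - g j y\<bar> \<le> 2 * G * \<theta> ^ j" using small[of j x] small[of j y] by linarith
    qed
    also have "(2 * G * \<theta> ^ j) powr (1 - \<tau>) * (H * E ^ j) powr \<tau> = J * \<kappa> ^ j"
    proof -
      have "(x ^ j) powr e = (x powr e) ^ j" for x e :: real by (induction j) (simp_all add: powr_mult)
      then show ?thesis unfolding J_def \<kappa>_def power_mult_distrib powr_mult by (simp only: mult_ac)
    qed
    finally show ?thesis .
  qed
  have sg: "summable (\<lambda>j. g j x)" for x
  proof (rule summable_comparison_test)
    show "summable (\<lambda>j. G * \<theta> ^ j)" using \<theta> by (intro summable_mult summable_geometric) auto
  qed (use small in auto)
  have "\<bar>(\<Sum>j. g j x) - (\<Sum>j. g j y)\<bar> \<le> J / (1 - \<kappa>) * \<bar>x - y\<bar> powr (b * \<tau>)" for x y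
  proof -
    have "(\<lambda>j. \<kappa> ^ j) sums (1 / (1 - \<kappa>))" using \<kappa> by (intro geometric_sums) auto
    then have "(\<lambda>j. J * \<kappa> ^ j * \<bar>x - y\<bar> powr (b * \<tau>)) sums (J * (1 / (1 - \<kappa>)) * \<bar>x - y\<bar> powr (b * \<tau>))"
      by (intro sums_mult2 sums_mult)
    note sums = this
    have "(\<Sum>j. g j x) - (\<Sum>j. g j y) = (\<Sum>j. g j x - g j y)" by (rule suminf_diff[OF sg sg])
    also have "\<bar>\<dots>\<bar> \<le> (\<Sum>j. J * \<kappa> ^ j * \<bar>x - y\<bar> powr (b * \<tau>))"
      by (rule norm_suminf_le[where 'a = real, unfolded real_norm_def, OF _ sums_summable[OF sums]]) (rule diff)
    also have "\<dots> = J / (1 - \<kappa>) * \<bar>x - y\<bar> powr (b * \<tau>)" using sums_unique[OF sums] by simp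
    finally show ?thesis .
  qed
  then show ?thesis using \<tau>(1,2) by blast
qed

context riesz_order begin

lemma scaled_atom_potential:
  assumes w: "w > 0" and m: "m > 0" and t: "\<bar>m * t - s\<bar> \<ge> w"
  shows "has_bochner_integral lborel (\<lambda>x. atom w (m * x - s) * \<bar>t - x\<bar> powr - (1 - \<alpha>)) 0"
proof -
  define t' where "t' = m * t - s"
  have "has_bochner_integral lborel (\<lambda>x. atom w x * \<bar>t' - x\<bar> powr - (1 - \<alpha>)) 0"
    using atom_integrable_riesz[OF w, of t'] atom_potential_vanishes[OF w, of t'] t
    by (simp add: has_bochner_integral_iff t'_def)
  then have "has_bochner_integral lborel (\<lambda>x. atom w (- s + m * x) * \<bar>t' - (- s + m * x)\<bar> powr - (1 - \<alpha>)) (0 /\<^sub>R \<bar>m\<bar>)"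
    using m by (subst (asm) lborel_has_bochner_integral_real_affine_iff[of m _ _ "- s"]) auto
  then have "has_bochner_integral lborel (\<lambda>x. m powr (1 - \<alpha>) * (atom w (- s + m * x) * \<bar>t' - (- s + m * x)\<bar> powr - (1 - \<alpha>))) (m powr (1 - \<alpha>) * 0)"
    by (intro has_bochner_integral_mult_right) simp
  moreover have "m powr (1 - \<alpha>) * (atom w (- s + m * x) * \<bar>t' - (- s + m * x)\<bar> powr - (1 - \<alpha>))
    = atom w (m * x - s) * \<bar>t - x\<bar> powr - (1 - \<alpha>)" for x
  proof -
    have c: "m powr (1 - \<alpha>) * m powr - (1 - \<alpha>) = 1" using m by (simp only: powr_add[symmetric]) simp
    have "t' - (- s + m * x) = m * (t - x)" by (simp add: t'_def algebra_simps)
    then have "\<bar>t' - (- s + m * x)\<bar> powr - (1 - \<alpha>) = m powr - (1 - \<alpha>) * \<bar>t - x\<bar> powr - (1 - \<alpha>)"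
      using m by (simp add: abs_mult powr_mult)
    then have "m powr (1 - \<alpha>) * (atom w (- s + m * x) * \<bar>t' - (- s + m * x)\<bar> powr - (1 - \<alpha>))
      = (m powr (1 - \<alpha>) * m powr - (1 - \<alpha>)) * (atom w (- s + m * x) * \<bar>t - x\<bar> powr - (1 - \<alpha>))"
      by (simp only: mult_ac)
    also have "- s + m * x = m * x - s" by simp
    finally show ?thesis unfolding c by simp
  qed
  ultimately show ?thesis by (simp only: mult_zero_right)
qed

lemma cluster_potential:
  assumes w: "w > 0" and m: "m > 0" and t: "\<And>i. i < n \<Longrightarrow> \<bar>m * t - s - b i\<bar> \<ge> w"
  shows "has_bochner_integral lborel (\<lambda>x. cluster n c b w (m * x - s) * \<bar>t - x\<bar> powr - (1 - \<alpha>)) 0"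
proof -
  have "has_bochner_integral lborel (\<lambda>x. \<Sum>i<n. c i * (atom w (m * x - (s + b i)) * \<bar>t - x\<bar> powr - (1 - \<alpha>))) (\<Sum>i<n. c i * 0)"
    by (intro has_bochner_integral_sum has_bochner_integral_mult_right scaled_atom_potential[OF w m])
       (use t in \<open>auto simp: algebra_simps\<close>)
  then show ?thesis unfolding cluster_def by (simp add: sum_distrib_right mult.assoc diff_diff_eq)
qed

lemma corrected_potential:
  assumes w: "\<And>j. w j > 0" and D: "(D::nat) > 0" and f0: "has_bochner_integral lborel (\<lambda>x. f0 x * \<bar>t - x\<bar> powr - (1 - \<alpha>)) 0"
    and t: "\<And>j k i. k < D ^ j \<Longrightarrow> i < n \<Longrightarrow> \<bar>real (D ^ j) * t - real k - b i\<bar> \<ge> w j"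
  shows "has_bochner_integral lborel (\<lambda>x. corrected f0 (\<lambda>j. cluster n c b (w j)) D a N x * \<bar>t - x\<bar> powr - (1 - \<alpha>)) 0"
proof -
  have "has_bochner_integral lborel (\<lambda>x. f0 x * \<bar>t - x\<bar> powr - (1 - \<alpha>) +
     (\<Sum>j<N. \<Sum>k<D ^ j. a j k * (cluster n c b (w j) (real (D ^ j) * x - real k) * \<bar>t - x\<bar> powr - (1 - \<alpha>))))
     (0 + (\<Sum>j<N. \<Sum>k<D ^ j. a j k * 0))"
    by (intro has_bochner_integral_add has_bochner_integral_sum has_bochner_integral_mult_right f0 cluster_potential w)
       (use D t in auto)
  then show ?thesis unfolding corrected_def by (simp add: sum_distrib_right distrib_right mult.assoc)
qed

lemma cluster_holder:
  assumes w: "w > 0"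
  shows "\<bar>cluster n c b w x - cluster n c b w y\<bar> \<le> (\<Sum>i<n. \<bar>c i\<bar>) * atom_const * w powr -2 * \<bar>x - y\<bar> powr (1 - \<alpha>)"
proof -
  have "\<bar>cluster n c b w x - cluster n c b w y\<bar> = \<bar>\<Sum>i<n. c i * (atom w (x - b i) - atom w (y - b i))\<bar>"
    unfolding cluster_def by (simp add: right_diff_distrib sum_subtractf)
  also have "\<dots> \<le> (\<Sum>i<n. \<bar>c i\<bar> * (atom_const * w powr -2 * \<bar>x - y\<bar> powr (1 - \<alpha>)))"
  proof (rule order_trans[OF sum_abs sum_mono])
    fix i
    show "\<bar>c i * (atom w (x - b i) - atom w (y - b i))\<bar> \<le> \<bar>c i\<bar> * (atom_const * w powr -2 * \<bar>x - y\<bar> powr (1 - \<alpha>))"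
      unfolding abs_mult using atom_holder[OF w, of "x - b i" "y - b i"] by (intro mult_left_mono) auto
  qed
  also have "\<dots> = (\<Sum>i<n. \<bar>c i\<bar>) * atom_const * w powr -2 * \<bar>x - y\<bar> powr (1 - \<alpha>)"
    by (simp add: sum_distrib_right mult.assoc)
  finally show ?thesis .
qed

text \<open>The iteration starts from an atom at \<open>-3\<close>, and the interval \<open>[-1, 2]\<close> lies at distance at least 2 from it.\<close>

lemma atom_far_lipschitz:
  assumes "u \<ge> 2" "v \<ge> 2"
  shows "\<bar>atom 1 u - atom 1 v\<bar> \<le> 2 * \<bar>u - v\<bar>"
proof -
  have "\<exists>\<xi>. \<bar>\<xi>\<bar> < 1 \<and> (\<Sum>j\<in>{True, False}. (if j then 1 else -1) * atom 1 (u - (if j then 0 else u - v)))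
      = (\<Sum>j\<in>{True, False}. (if j then 1 else -1) * K (u - (if j then 0 else u - v) + \<xi>))"
    by (rule atom_combination_mvt) (use assms in \<open>auto split: if_splits\<close>)
  then obtain \<xi> where \<xi>: "\<bar>\<xi>\<bar> < 1" "atom 1 u - atom 1 v = K (u + \<xi>) - K (v + \<xi>)" by auto
  have "\<bar>K (u + \<xi>) - K (v + \<xi>)\<bar> \<le> 2 * 1 powr - (2 + \<alpha>) * \<bar>u + \<xi> - (v + \<xi>)\<bar>"
    using \<xi> assms by (intro K_diff_le) auto
  then show ?thesis using \<xi> by simp
qed

text \<open>The iteration is run on \<open>f0\<close>, the atom of width 1 at \<open>-3\<close>, with profiles of widths \<open>\<sigma> j = \<sigma>0 \<rho>^j\<close>. If \<open>lam\<close> is the rate at which the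
  coefficients decay, \<open>\<rho>\<close> is its fourth root: the profiles are bounded by a multiple of \<open>\<sigma>^(-2)\<close>, so the corrections decay at the
  rate \<open>lam \<rho>^(-2) = sqrt lam\<close>. The intervals \<open>T j\<close> about the centres of generation \<open>j\<close>
  have total length \<open>O (\<sigma> j)\<close>, since the \<open>D^j\<close> copies are scaled by \<open>D^(-j)\<close>. Taking \<open>\<sigma>0\<close> small and
  the threshold factor \<open>\<Lambda>\<close> large, both the union of these intervals and the union of the abandoned blocks have measure at most \<open>1/4\<close>.\<close>

lemma exists_real_counterexample:
  "\<exists>f V C r H. f \<in> borel_measurable borel \<and> (\<forall>x. \<bar>f x\<bar> \<le> C * (1 + \<bar>x\<bar>) powr - (1 + \<alpha>)) \<and>
     (\<exists>x. f x \<noteq> 0) \<and> V \<in> sets borel \<and> emeasure lborel V > 0 \<and>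
     (\<forall>t\<in>V. f t = 0 \<and> (\<integral>x. f x * \<bar>t - x\<bar> powr - (1 - \<alpha>) \<partial>lborel) = 0) \<and>
     0 < r \<and> (\<forall>x y. \<bar>f x - f y\<bar> \<le> H * \<bar>x - y\<bar> powr r)"
proof -
  obtain p q w0 C \<gamma> n c b where p: "0 < p" "p \<le> 1/4" and q: "0 < q" "q < 1" and w0: "0 < w0" "w0 \<le> 1"
    and C: "0 < C" and \<gamma>: "0 < \<gamma>" and b: "\<forall>i<n. 0 \<le> b i \<and> b i \<le> (1::real)"
    and prof: "\<forall>w\<in>{0<..w0}.
       (\<integral>\<^sup>+x. ennreal (\<bar>indicator {0..<1} x + cluster n c b w x\<bar> powr p) \<partial>lborel) \<le> ennreal q \<and>
       (\<forall>h. \<bar>h\<bar> \<le> 1 \<longrightarrow> (\<integral>\<^sup>+x. ennreal (\<bar>cluster n c b w (x + h) - cluster n c b w x\<bar> powr p) \<partial>lborel)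
          \<le> ennreal (C * \<bar>h\<bar> powr \<gamma>)) \<and>
       (\<forall>x. \<bar>cluster n c b w x\<bar> \<le> C * w powr -2 / (1 + x\<^sup>2))"
    using exists_profile by (elim exE conjE) (rule that)
  have p1: "p \<le> 1" using p by simp
  define f0 where "f0 x = atom 1 (x + 3)" for x
  have f0m [measurable]: "f0 \<in> borel_measurable borel" unfolding f0_def by measurable
  have lip: "\<bar>f0 (y + h) - f0 y\<bar> \<le> 2 * \<bar>h\<bar>" if "y \<in> {0..<1}" "\<bar>h\<bar> \<le> 1" for y h
    using atom_far_lipschitz[of "y + h + 3" "y + 3"] that by (simp add: f0_def abs_le_iff)
  have F: "\<bar>f0 y\<bar> \<le> atom_const" for y unfolding f0_def using atom_le_width[of 1 "y + 3"] by simp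
  \<comment> \<open>The property that \<open>iterated_correction\<close> provides.\<close>
  define iterable where "iterable D U r \<longleftrightarrow> (\<forall>\<psi> \<Lambda>. 0 < \<Lambda> \<longrightarrow>
    (\<forall>j. \<psi> j \<in> borel_measurable borel) \<longrightarrow>
    (\<forall>j. (\<integral>\<^sup>+x. ennreal (\<bar>indicator {0..<1} x + \<psi> j x\<bar> powr p) \<partial>lborel) \<le> ennreal q) \<longrightarrow>
    (\<forall>j h. \<bar>h\<bar> \<le> 1 \<longrightarrow> (\<integral>\<^sup>+x. ennreal (\<bar>\<psi> j (x + h) - \<psi> j x\<bar> powr p) \<partial>lborel) \<le> ennreal (C * \<bar>h\<bar> powr \<gamma>)) \<longrightarrow>
    (\<exists>a A. A 0 = {0} \<and> (\<forall>n. A n \<subseteq> {..<D ^ n}) \<and> (\<forall>n k. \<bar>a n k\<bar> \<le> \<Lambda> * (r powr (1 / p)) ^ n) \<and>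
      (\<forall>n. (\<integral>\<^sup>+x. ennreal (\<bar>corrected f0 \<psi> D a n x\<bar> powr p) * indicator (blocks (D ^ n) (A n)) x \<partial>lborel)
         \<le> ennreal (U / q * (r\<^sup>2) ^ n)) \<and>
      (\<forall>n. emeasure lborel (blocks (D ^ n) (A n) - blocks (D ^ Suc n) (A (Suc n))) \<le> ennreal (U / (q * \<Lambda> powr p) * r ^ n))))" for D :: nat and U r
  have "\<exists>(D::nat) U r. 2 \<le> D \<and> 0 < U \<and> 0 < r \<and> r < 1 \<and> iterable D U r"
    unfolding iterable_def
    by (rule iterated_correction[where L = 2 and F = atom_const, OF p(1) p1 q less_imp_le[OF C] \<gamma> _ f0m lip F]) simp_all
  then obtain D :: nat and U r where D: "2 \<le> D" and U: "0 < U" and r: "0 < r" "r < 1" and iter: "iterable D U r"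
    by (elim exE conjE)
  have Dpos: "D > 0" "\<And>j. D ^ j > 0" using D by auto
  have powr_less_1: "x powr e < 1" if "0 < x" "x < 1" "0 < e" for x e :: real
    using powr_less_mono2[of e x 1] that by simp
  define lam where "lam = r powr (1 / p)"
  have lam: "0 < lam" "lam < 1" unfolding lam_def using r p powr_less_1[of r "1 / p"] by auto
  define \<rho> where "\<rho> = lam powr (1/4)"
  have \<rho>: "0 < \<rho>" "\<rho> < 1" unfolding \<rho>_def using lam powr_less_1[of lam "1/4"] by auto
  define \<theta> where "\<theta> = lam powr (1/2)"
  have \<theta>: "0 < \<theta>" "\<theta> < 1" unfolding \<theta>_def using lam powr_less_1[of lam "1/2"] by auto
  have lr: "lam * \<rho> powr -2 = \<theta>"
  proof -
    have "lam * \<rho> powr -2 = lam powr 1 * lam powr ((1/4) * -2)" unfolding \<rho>_def powr_powr using lam by simp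
    also have "\<dots> = \<theta>" unfolding powr_add[symmetric] \<theta>_def by simp
    finally show ?thesis .
  qed
  define \<sigma>0 where "\<sigma>0 = min w0 ((1 - \<rho>) / (8 * real n + 8))"
  have \<sigma>0: "0 < \<sigma>0" "\<sigma>0 \<le> w0" "2 * real n * \<sigma>0 / (1 - \<rho>) \<le> 1/4"
  proof -
    show "0 < \<sigma>0" "\<sigma>0 \<le> w0" unfolding \<sigma>0_def using w0 \<rho> by auto
    have "\<sigma>0 \<le> (1 - \<rho>) / (8 * real n + 8)" unfolding \<sigma>0_def by (rule min.cobounded2)
    then have "\<sigma>0 * (8 * real n + 8) \<le> 1 - \<rho>" by (simp add: pos_le_divide_eq)
    then have "8 * real n * \<sigma>0 \<le> 1 - \<rho>" using \<open>0 < \<sigma>0\<close> by (simp add: algebra_simps)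
    then show "2 * real n * \<sigma>0 / (1 - \<rho>) \<le> 1/4" using \<rho> by (simp add: pos_divide_le_eq)
  qed
  define \<sigma> where "\<sigma> j = \<sigma>0 * \<rho> ^ j" for j :: nat
  have \<sigma>: "0 < \<sigma> j" "\<sigma> j \<le> w0" for j
  proof -
    show "0 < \<sigma> j" unfolding \<sigma>_def using \<sigma>0 \<rho> by simp
    have "\<sigma>0 * \<rho> ^ j \<le> w0 * 1" using \<sigma>0 \<rho> w0 by (intro mult_mono power_le_one) auto
    then show "\<sigma> j \<le> w0" by (simp add: \<sigma>_def)
  qed
  have \<sigma>_powr: "\<sigma> j powr -2 = \<sigma>0 powr -2 * (\<rho> powr -2) ^ j" for j
  proof -
    have "(x ^ j) powr e = (x powr e) ^ j" for x e :: real by (induction j) (simp_all add: powr_mult)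
    then show ?thesis unfolding \<sigma>_def by (simp add: powr_mult)
  qed
  \<comment> \<open>The value of \<open>\<Lambda>^p\<close> for which the series of the abandoned measures has sum \<open>1/4\<close>.\<close>
  define X where "X = 4 * U / (q * (1 - r))"
  have X: "X > 0" unfolding X_def using U q r by (intro divide_pos_pos mult_pos_pos) auto
  define \<Lambda> where "\<Lambda> = X powr (1 / p)"
  have \<Lambda>: "\<Lambda> > 0" "U / (q * \<Lambda> powr p) * (1 / (1 - r)) = 1/4"
  proof -
    show "\<Lambda> > 0" using X by (simp add: \<Lambda>_def)
    have "\<Lambda> powr p = X" unfolding \<Lambda>_def powr_powr using p X by simp
    moreover have "X * (q * (1 - r)) = 4 * U" unfolding X_def using q r by simp
    ultimately have "4 * U = q * \<Lambda> powr p * (1 - r)" by (simp add: mult_ac)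
    moreover have "q * \<Lambda> powr p * (1 - r) \<noteq> 0" using q r \<open>\<Lambda> > 0\<close> by simp
    ultimately show "U / (q * \<Lambda> powr p) * (1 / (1 - r)) = 1/4" by (simp add: divide_eq_eq)
  qed
  define \<psi> where "\<psi> j = cluster n c b (\<sigma> j)" for j
  have \<psi>m [measurable]: "\<psi> j \<in> borel_measurable borel" for j unfolding \<psi>_def by (rule cluster_measurable)
  have mem: "\<sigma> j \<in> {0<..w0}" for j using \<sigma> by simp
  have \<psi>_bound: "\<bar>\<psi> j x\<bar> \<le> C * \<sigma> j powr -2 / (1 + x\<^sup>2)" for j x
    using bspec[OF prof mem[of j]] unfolding \<psi>_def by blast
  have gain: "\<forall>j. (\<integral>\<^sup>+x. ennreal (\<bar>indicator {0..<1} x + \<psi> j x\<bar> powr p) \<partial>lborel) \<le> ennreal q"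
    using bspec[OF prof mem] unfolding \<psi>_def by blast
  have modulus: "\<forall>j h. \<bar>h\<bar> \<le> 1 \<longrightarrow> (\<integral>\<^sup>+x. ennreal (\<bar>\<psi> j (x + h) - \<psi> j x\<bar> powr p) \<partial>lborel) \<le> ennreal (C * \<bar>h\<bar> powr \<gamma>)"
    using bspec[OF prof mem] unfolding \<psi>_def by blast
  obtain a A where A0: "A 0 = {0}" and Asub: "\<forall>n. A n \<subseteq> {..<D ^ n}"
    and a: "\<forall>n k. \<bar>a n k\<bar> \<le> \<Lambda> * lam ^ n"
    and small: "\<forall>n. (\<integral>\<^sup>+x. ennreal (\<bar>corrected f0 \<psi> D a n x\<bar> powr p) * indicator (blocks (D ^ n) (A n)) x \<partial>lborel)
         \<le> ennreal (U / q * (r\<^sup>2) ^ n)"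
    and dead: "\<forall>n. emeasure lborel (blocks (D ^ n) (A n) - blocks (D ^ Suc n) (A (Suc n))) \<le> ennreal (U / (q * \<Lambda> powr p) * r ^ n)"
  proof -
    have "\<forall>j. \<psi> j \<in> borel_measurable borel" using \<psi>m ..
    from iter[unfolded iterable_def, THEN spec[of _ \<psi>], THEN spec[of _ \<Lambda>], THEN mp, OF \<Lambda>(1), THEN mp, OF this,
        THEN mp, OF gain, THEN mp, OF modulus]
    show ?thesis unfolding lam_def[symmetric] by (elim exE conjE) (rule that; assumption)
  qed
  note Asub = Asub[rule_format] and a = a[rule_format] and small = small[rule_format] and dead = dead[rule_format]

  \<comment> \<open>The correction of generation \<open>j\<close>, and the partial sums.\<close>
  define g where "g j x = (\<Sum>k<D ^ j. a j k * \<psi> j (real (D ^ j) * x - real k))" for j x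
  define fn where "fn N x = f0 x + (\<Sum>j<N. g j x)" for N x
  have fn_eq: "corrected f0 \<psi> D a N = fn N" for N by (simp add: corrected_def[abs_def] fn_def[abs_def] g_def)
  have gm [measurable]: "g j \<in> borel_measurable borel" for j unfolding g_def by measurable
  define G where "G = 60 * (\<Lambda> * C * \<sigma>0 powr -2)"
  have G: "G \<ge> 0" unfolding G_def using \<Lambda> C by simp
  have lt: "lam ^ j * (\<rho> powr -2) ^ j = \<theta> ^ j" for j by (simp only: power_mult_distrib[symmetric] lr)
  have g_bound: "\<bar>g j x\<bar> \<le> G * \<theta> ^ j / (1 + x\<^sup>2)" for j x
  proof -
    have "\<bar>g j x\<bar> \<le> (\<Sum>k<D ^ j. (\<Lambda> * lam ^ j * (C * \<sigma> j powr -2)) * (1 / (1 + (real (D ^ j) * x - real k)\<^sup>2)))"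
      unfolding g_def
    proof (rule order_trans[OF sum_abs sum_mono])
      fix k
      have "\<bar>a j k * \<psi> j (real (D ^ j) * x - real k)\<bar> \<le> (\<Lambda> * lam ^ j) * (C * \<sigma> j powr -2 / (1 + (real (D ^ j) * x - real k)\<^sup>2))"
        unfolding abs_mult using \<Lambda> lam by (intro mult_mono a \<psi>_bound) auto
      then show "\<bar>a j k * \<psi> j (real (D ^ j) * x - real k)\<bar> \<le> (\<Lambda> * lam ^ j * (C * \<sigma> j powr -2)) * (1 / (1 + (real (D ^ j) * x - real k)\<^sup>2))"
        by simp
    qed
    also have "\<dots> = (\<Lambda> * lam ^ j * (C * \<sigma> j powr -2)) * (\<Sum>k<D ^ j. 1 / (1 + (real (D ^ j) * x - real k)\<^sup>2))"
      by (rule sum_distrib_left[symmetric])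
    also have "\<dots> \<le> (\<Lambda> * lam ^ j * (C * \<sigma> j powr -2)) * (60 / (1 + x\<^sup>2))"
      using \<Lambda> lam C Dpos by (intro mult_left_mono sum_scaled_lattice_le) auto
    also have "\<Lambda> * lam ^ j * (C * \<sigma> j powr -2) = \<Lambda> * C * \<sigma>0 powr -2 * \<theta> ^ j"
      unfolding \<sigma>_powr lt[symmetric] by (simp only: mult_ac)
    finally show ?thesis unfolding G_def by (simp add: mult_ac)
  qed
  have one_le: "1 / (1 + x\<^sup>2) \<le> 1" for x :: real by (simp add: divide_le_eq add_pos_nonneg)
  have g_bound1: "\<bar>g j x\<bar> \<le> G * \<theta> ^ j" for j x
    using order_trans[OF g_bound[of j x]] mult_left_mono[OF one_le[of x], of "G * \<theta> ^ j"] G \<theta> by simp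
  have sumG: "summable (\<lambda>j. G * \<theta> ^ j)" using \<theta> by (intro summable_mult summable_geometric) auto
  have sg: "summable (\<lambda>j. \<bar>g j x\<bar>)" for x
    by (rule summable_comparison_test[OF _ sumG]) (use g_bound1 in auto)
  have sg': "summable (\<lambda>j. g j x)" for x using sg by (rule summable_rabs_cancel)
  define f where "f x = f0 x + (\<Sum>j. g j x)" for x
  have fm [measurable]: "f \<in> borel_measurable borel" unfolding f_def by measurable
  have fnm [measurable]: "fn N \<in> borel_measurable borel" for N unfolding fn_def by measurable
  have lim: "(\<lambda>N. fn N x) \<longlonglongrightarrow> f x" for x
    unfolding fn_def f_def by (intro tendsto_intros summable_LIMSEQ sg')
  define G1 where "G1 = G / (1 - \<theta>)"
  have G1: "G1 \<ge> 0" unfolding G1_def using G \<theta> by simp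
  have geo: "(\<Sum>j. G * \<theta> ^ j) = G1"
    unfolding G1_def using \<theta> by (subst suminf_mult) (auto simp: suminf_geometric)
  have part: "\<bar>\<Sum>j<N. g j x\<bar> \<le> G1 / (1 + x\<^sup>2)" for N x
  proof -
    have "\<bar>\<Sum>j<N. g j x\<bar> \<le> (\<Sum>j<N. G * \<theta> ^ j / (1 + x\<^sup>2))" by (intro order_trans[OF sum_abs sum_mono] g_bound)
    also have "\<dots> = (\<Sum>j<N. G * \<theta> ^ j) / (1 + x\<^sup>2)" by (rule sum_divide_distrib[symmetric])
    also have "\<dots> \<le> G1 / (1 + x\<^sup>2)"
      unfolding geo[symmetric] using G \<theta> by (intro divide_right_mono sum_le_suminf sumG) (auto simp: add_nonneg_nonneg)
    finally show ?thesis .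
  qed
  have fn_near: "\<bar>fn N x - f0 x\<bar> \<le> G1 / (1 + x\<^sup>2)" for N x using part[of x N] by (simp add: fn_def)
  have f_near: "\<bar>f x - f0 x\<bar> \<le> G1 / (1 + x\<^sup>2)" for x
    by (rule LIMSEQ_le_const2[OF tendsto_rabs[OF tendsto_diff[OF lim tendsto_const]]]) (use fn_near in auto)
  have tail: "\<bar>f x - fn N x\<bar> \<le> G1 * \<theta> ^ N" for x N
  proof -
    have "f x - fn N x = (\<Sum>j. g (j + N) x)"
      unfolding f_def fn_def suminf_minus_initial_segment[OF sg'[of x], of N] by simp
    also have "\<bar>\<dots>\<bar> \<le> (\<Sum>j. G * \<theta> ^ j * \<theta> ^ N)"
    proof (rule norm_suminf_le[where 'a = real, unfolded real_norm_def])
      show "\<bar>g (j + N) x\<bar> \<le> G * \<theta> ^ j * \<theta> ^ N" for j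
        using g_bound1[of "j + N" x] by (simp add: power_add mult.assoc)
      show "summable (\<lambda>j. G * \<theta> ^ j * \<theta> ^ N)" using sumG by (rule summable_mult2)
    qed
    also have "\<dots> = G1 * \<theta> ^ N" unfolding geo[symmetric] by (rule suminf_mult2[symmetric, OF sumG])
    finally show ?thesis .
  qed

  \<comment> \<open>All partial sums have a common majorant of the order of the weight \<open>(1 + |x|)^(-(1+\<alpha>))\<close>.\<close>
  define B where "B = 128 * atom_const * 16 + 4 * G1"
  have decay: "\<bar>u\<bar> \<le> B * (1 + \<bar>x\<bar>) powr - (1 + \<alpha>)" if u: "\<bar>u - f0 x\<bar> \<le> G1 / (1 + x\<^sup>2)" for u x
  proof -
    define W where "W = (1 + \<bar>x\<bar>) powr - (1 + \<alpha>)"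
    have W: "W \<ge> 0" by (simp add: W_def)
    have "\<bar>f0 x\<bar> \<le> 16 * atom_const * (1 + 1 powr - (1 + \<alpha>)) * (1 + \<bar>x + 3\<bar>) powr - (1 + \<alpha>)"
      unfolding f0_def by (rule atom_weight_le) simp
    also have "\<dots> \<le> 16 * atom_const * 2 * ((1 + \<bar>x\<bar>) / 4) powr - (1 + \<alpha>)"
    proof -
      have "\<bar>x\<bar> \<le> \<bar>x + 3\<bar> + 3" using abs_triangle_ineq4[of "x + 3" 3] by simp
      have quarter: "(1 + u) / 4 \<le> 1 + v" if "u \<le> v + 3" "0 \<le> v" for u v :: real using that by simp
      have "(1 + \<bar>x\<bar>) / 4 \<le> 1 + \<bar>x + 3\<bar>" by (rule quarter[OF \<open>\<bar>x\<bar> \<le> \<bar>x + 3\<bar> + 3\<close> abs_ge_zero])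
      then show ?thesis using atom_const_pos \<alpha>_pos by (intro mult_mono powr_mono2') auto
    qed
    also have "((1 + \<bar>x\<bar>) / 4) powr - (1 + \<alpha>) = 4 powr (1 + \<alpha>) * W" unfolding W_def by (rule divide_powr_minus) auto
    also have "16 * atom_const * 2 * (4 powr (1 + \<alpha>) * W) \<le> 16 * atom_const * 2 * (4 powr 2 * W)"
      using atom_const_pos \<alpha>_less W by (intro mult_left_mono mult_right_mono powr_mono) auto
    also have "\<dots> = 32 * 16 * atom_const * W" by (simp add: powr_numeral)
    finally have 1: "\<bar>f0 x\<bar> \<le> 32 * 16 * atom_const * W" .
    have "1 / (1 + x\<^sup>2) \<le> 2 * (1 + \<bar>x\<bar>) powr -2"
    proof -
      have "(1 + \<bar>x\<bar>)\<^sup>2 \<le> 2 * (1 + x\<^sup>2)" using sum_squares_bound[of 1 "\<bar>x\<bar>"] by (simp add: power2_sum)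
      moreover have "0 < 1 + x\<^sup>2" "0 < (1 + \<bar>x\<bar>)\<^sup>2" by (auto simp: add_pos_nonneg)
      ultimately have "1 / (1 + x\<^sup>2) \<le> 2 / (1 + \<bar>x\<bar>)\<^sup>2" by (simp only: pos_divide_le_eq times_divide_eq_left pos_le_divide_eq mult_1)
      then show ?thesis by (simp add: powr_minus powr_numeral divide_inverse)
    qed
    also have "(1 + \<bar>x\<bar>) powr -2 \<le> W" unfolding W_def using \<alpha>_less by (intro powr_mono) auto
    finally have "G1 * (1 / (1 + x\<^sup>2)) \<le> G1 * (2 * W)" using G1 by (intro mult_left_mono) auto
    then have "\<bar>u\<bar> \<le> 32 * 16 * atom_const * W + G1 * (2 * W)" using 1 u by simp
    also have "\<dots> = (512 * atom_const + 2 * G1) * W" by (simp add: algebra_simps)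
    also have "\<dots> \<le> B * W" unfolding B_def using W G1 atom_const_pos by (intro mult_right_mono) auto
    finally show ?thesis by (simp add: W_def)
  qed
  have f_decay: "\<bar>f x\<bar> \<le> B * (1 + \<bar>x\<bar>) powr - (1 + \<alpha>)" for x by (rule decay[OF f_near])
  have fn_decay: "\<bar>fn N x\<bar> \<le> B * (1 + \<bar>x\<bar>) powr - (1 + \<alpha>)" for N x by (rule decay[OF fn_near])

  have nonzero: "\<exists>x. f x \<noteq> 0"
  proof -
    \<comment> \<open>A point \<open>x\<close> so far out that the initial atom exceeds the bound \<open>G1 / (1 + x^2)\<close> of all corrections. The atom there is a value of \<open>K\<close> at
      a point less than \<open>x + 4 = X\<close>, and \<open>X \<le> 5 x\<close>.\<close>
    define X where "X = (25 * G1 + 1) powr (1 / (1 - \<alpha>)) + 5"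
    define x where "x = X - 4"
    have X: "X \<ge> 5" "x \<ge> 1" by (auto simp: X_def x_def)
    have "25 * G1 < 25 * G1 + 1" by simp
    also have "\<dots> = ((25 * G1 + 1) powr (1 / (1 - \<alpha>))) powr (1 - \<alpha>)" using G1 \<alpha>_less by (simp add: powr_powr)
    also have "\<dots> \<le> X powr (1 - \<alpha>)" unfolding X_def using \<alpha>_less by (intro powr_mono2) auto
    finally have big: "25 * G1 < X powr (1 - \<alpha>)" .
    obtain \<xi> where \<xi>: "\<bar>\<xi>\<bar> < 1" "f0 x = K (x + 3 + \<xi>)"
      unfolding f0_def using atom_mvt[of 1 "x + 3"] X by auto
    have "X powr - (1 + \<alpha>) \<le> K (x + 3 + \<xi>)"
      unfolding K_def using \<xi>(1) X \<alpha>_pos by (intro powr_mono2') (auto simp: x_def)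
    moreover have "G1 / (1 + x\<^sup>2) < X powr - (1 + \<alpha>)"
    proof -
      have "X \<le> 5 * x" using X by (simp add: x_def)
      then have "X\<^sup>2 \<le> (5 * x)\<^sup>2" using X by (intro power_mono) auto
      then have "X\<^sup>2 / 25 \<le> 1 + x\<^sup>2" by (simp add: power_mult_distrib)
      then have 1: "G1 / (1 + x\<^sup>2) \<le> G1 / (X\<^sup>2 / 25)" 
      proof (rule divide_left_mono[OF _ G1])
        show "0 < (1 + x\<^sup>2) * (X\<^sup>2 / 25)"
          using X(1) by (intro mult_pos_pos add_pos_nonneg divide_pos_pos) auto
      qed
      have "X powr 2 = X\<^sup>2" using X(1) by (intro powr_numeral) simp
      then have inv: "X powr -2 = inverse (X\<^sup>2)" unfolding powr_minus by simp
      have 2: "G1 / (X\<^sup>2 / 25) = 25 * G1 * X powr -2"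
        unfolding inv inverse_eq_divide divide_divide_eq_right times_divide_eq_right mult_1_right by (simp only: mult.commute)
      have pos: "0 < X powr -2" using X(1) by simp
      have "25 * G1 * X powr -2 < X powr (1 - \<alpha>) * X powr -2" by (rule mult_strict_right_mono[OF big pos])
      with 1 have "G1 / (1 + x\<^sup>2) < X powr (1 - \<alpha>) * X powr -2" unfolding 2 by (rule le_less_trans)
      moreover have "X powr (1 - \<alpha>) * X powr -2 = X powr - (1 + \<alpha>)" unfolding powr_add[symmetric] by simp
      ultimately show ?thesis by (simp only:)
    qed
    ultimately have "G1 / (1 + x\<^sup>2) < f0 x" unfolding \<xi>(2) by (rule less_le_trans[rotated])
    then have "f x \<noteq> 0" using f_near[of x] by linarith
    then show ?thesis by blast
  qed

  \<comment> \<open>The growth rate of the Hoelder constants of the corrections: one factor \<open>D^j\<close> from the dilation, one from the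
    number of copies, and \<open>\<sigma>^(-2)\<close> from the atoms.\<close>
  define E where "E = (real D)\<^sup>2 * \<rho> powr -2"
  have E: "E \<ge> 1"
  proof -
    have "1 \<le> (real D)\<^sup>2" using D by simp
    moreover have "1 \<le> \<rho> powr -2" using powr_mono2'[of "-2" \<rho> 1] \<rho> by auto
    ultimately show ?thesis unfolding E_def using mult_mono[of 1 "(real D)\<^sup>2" 1 "\<rho> powr -2"] by simp
  qed
  define H where "H = \<Lambda> * (\<Sum>i<n. \<bar>c i\<bar>) * atom_const * \<sigma>0 powr -2"
  have H: "H \<ge> 0" unfolding H_def using \<Lambda> atom_const_pos by (intro mult_nonneg_nonneg sum_nonneg) auto
  have g_holder: "\<bar>g j x - g j y\<bar> \<le> H * E ^ j * \<bar>x - y\<bar> powr (1 - \<alpha>)" for j x y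
  proof -
    define m where "m = real (D ^ j)"
    have m: "m \<ge> 1" unfolding m_def using Dpos(2)[of j] by (simp del: of_nat_power add: Suc_le_eq)
    define h where "h = \<bar>x - y\<bar> powr (1 - \<alpha>)"
    have h: "h \<ge> 0" by (simp add: h_def)
    define S where "S = (\<Sum>i<n. \<bar>c i\<bar>) * atom_const * \<sigma> j powr -2"
    have S: "S \<ge> 0" unfolding S_def using atom_const_pos by (intro mult_nonneg_nonneg sum_nonneg) auto
    have "g j x - g j y = (\<Sum>k<D ^ j. a j k * (\<psi> j (m * x - real k) - \<psi> j (m * y - real k)))"
      unfolding g_def m_def by (simp add: right_diff_distrib sum_subtractf)
    also have "\<bar>\<dots>\<bar> \<le> (\<Sum>k<D ^ j. \<Lambda> * (S * (m * h)))"
    proof (rule order_trans[OF sum_abs sum_mono])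
      fix k
      have "\<bar>\<psi> j (m * x - real k) - \<psi> j (m * y - real k)\<bar> \<le> S * \<bar>(m * x - real k) - (m * y - real k)\<bar> powr (1 - \<alpha>)"
        unfolding \<psi>_def S_def by (rule cluster_holder[OF \<sigma>(1)])
      also have "\<bar>(m * x - real k) - (m * y - real k)\<bar> = m * \<bar>x - y\<bar>"
        using m by (simp add: abs_mult flip: right_diff_distrib)
      also have "(m * \<bar>x - y\<bar>) powr (1 - \<alpha>) = m powr (1 - \<alpha>) * h" unfolding h_def by (rule powr_mult)
      also have "S * (m powr (1 - \<alpha>) * h) \<le> S * (m * h)"
        using powr_mono[of "1 - \<alpha>" 1 m] m \<alpha>_pos S h by (intro mult_left_mono mult_right_mono) auto
      finally have 1: "\<bar>\<psi> j (m * x - real k) - \<psi> j (m * y - real k)\<bar> \<le> S * (m * h)" .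
      have "\<Lambda> * lam ^ j \<le> \<Lambda> * 1" using \<Lambda> lam by (intro mult_left_mono power_le_one) auto
      then have "\<bar>a j k\<bar> \<le> \<Lambda>" using a[of j k] by simp
      then show "\<bar>a j k * (\<psi> j (m * x - real k) - \<psi> j (m * y - real k))\<bar> \<le> \<Lambda> * (S * (m * h))"
        unfolding abs_mult using 1 \<Lambda> by (intro mult_mono) auto
    qed
    also have "\<dots> = \<Lambda> * S * m\<^sup>2 * h" by (simp add: m_def power2_eq_square)
    also have "m\<^sup>2 = ((real D)\<^sup>2) ^ j" unfolding m_def by (simp add: power_mult[symmetric] mult.commute)
    also have "\<Lambda> * S * ((real D)\<^sup>2) ^ j * h = H * E ^ j * h"
      unfolding S_def \<sigma>_powr H_def E_def power_mult_distrib by (simp only: mult_ac)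
    finally show ?thesis unfolding h_def .
  qed
  obtain \<tau> J where \<tau>: "0 < \<tau>" "\<tau> < 1"
    and g_sum: "\<And>x y. \<bar>(\<Sum>j. g j x) - (\<Sum>j. g j y)\<bar> \<le> J * \<bar>x - y\<bar> powr ((1 - \<alpha>) * \<tau>)"
    using holder_suminf[OF \<theta> E g_bound1 g_holder] by blast
  define s where "s = (1 - \<alpha>) * \<tau>"
  have f_holder: "\<bar>f x - f y\<bar> \<le> ((2 * atom_const) powr (1 - \<tau>) * atom_const powr \<tau> + J) * \<bar>x - y\<bar> powr s" for x y
  proof -
    have "\<bar>f0 x - f0 y\<bar> \<le> (2 * atom_const) powr (1 - \<tau>) * atom_const powr \<tau> * \<bar>x - y\<bar> powr ((1 - \<alpha>) * \<tau>)"
      using F[of x] F[of y] atom_holder[of 1 "x + 3" "y + 3"] by (intro interpolate_bounds \<tau>) (auto simp: f0_def)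
    then show ?thesis using g_sum[of x y] unfolding f_def s_def distrib_right by linarith
  qed
  have s: "s > 0" unfolding s_def using \<alpha>_less \<tau> by simp

  \<comment> \<open>The points at which the potential of some atom of generation \<open>j\<close> need not vanish.\<close>
  define T where "T j = (\<Union>k<D ^ j. \<Union>i<n. {x. \<bar>real (D ^ j) * x - real k - b i\<bar> < \<sigma> j})" for j
  have Tm [measurable]: "T j \<in> sets borel" for j unfolding T_def by measurable
  have T_meas: "emeasure lborel (T j) \<le> ennreal (2 * real n * \<sigma>0 * \<rho> ^ j)" for j
  proof -
    define m where "m = real (D ^ j)"
    have m: "m > 0" unfolding m_def using Dpos(2)[of j] by simp
    have one: "emeasure lborel {x. \<bar>m * x - real k - b i\<bar> < \<sigma> j} \<le> ennreal (2 * \<sigma> j / m)" for k i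
    proof -
      have "{x. \<bar>m * x - real k - b i\<bar> < \<sigma> j} \<subseteq> {(real k + b i - \<sigma> j) / m..(real k + b i + \<sigma> j) / m}"
        using m by (auto simp: abs_less_iff pos_divide_le_eq pos_le_divide_eq mult.commute)
      then have "emeasure lborel {x. \<bar>m * x - real k - b i\<bar> < \<sigma> j} \<le> emeasure lborel {(real k + b i - \<sigma> j) / m..(real k + b i + \<sigma> j) / m}"
        by (intro emeasure_mono) auto
      also have "\<dots> = ennreal ((real k + b i + \<sigma> j) / m - (real k + b i - \<sigma> j) / m)"
        using m \<sigma>(1)[of j] by (intro emeasure_lborel_Icc divide_right_mono) auto
      also have "(real k + b i + \<sigma> j) / m - (real k + b i - \<sigma> j) / m = 2 * \<sigma> j / m"
        by (simp add: diff_divide_distrib[symmetric])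
      finally show ?thesis .
    qed
    have "emeasure lborel (T j) \<le> (\<Sum>k<D ^ j. emeasure lborel (\<Union>i<n. {x. \<bar>m * x - real k - b i\<bar> < \<sigma> j}))"
      unfolding T_def m_def by (rule emeasure_subadditive_finite) auto
    also have "\<dots> \<le> (\<Sum>k<D ^ j. \<Sum>i<n. emeasure lborel {x. \<bar>m * x - real k - b i\<bar> < \<sigma> j})"
      by (intro sum_mono emeasure_subadditive_finite) auto
    also have "\<dots> \<le> (\<Sum>k<D ^ j. \<Sum>i<n. ennreal (2 * \<sigma> j / m))" by (intro sum_mono one)
    also have "\<dots> = ennreal (\<Sum>k<D ^ j. \<Sum>i<n. 2 * \<sigma> j / m)"
      using m \<sigma>(1)[of j] by (simp only: sum_ennreal sum_nonneg divide_nonneg_pos mult_nonneg_nonneg less_imp_le zero_le_numeral)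
    also have "(\<Sum>k<D ^ j. \<Sum>i<n. 2 * \<sigma> j / m) = 2 * real n * \<sigma>0 * \<rho> ^ j"
      using m by (simp add: m_def \<sigma>_def)
    finally show ?thesis .
  qed
  \<comment> \<open>The set alive at generation \<open>j\<close>.\<close>
  define S where "S j = blocks (D ^ j) (A j)" for j
  have Sm [measurable]: "S j \<in> sets borel" for j unfolding S_def by measurable
  have S0: "S 0 = {0..<1}" unfolding S_def A0 by (auto simp: blocks_def block_def)
  have S_unit: "S j \<subseteq> {0..<1}" for j unfolding S_def by (rule blocks_subset_unit[OF Dpos(2) Asub])
  have zero_AE: "AE x in lborel. x \<in> (\<Inter>j. S j) \<longrightarrow> f x = 0"
  proof -
    let ?I = "\<integral>\<^sup>+x. ennreal (\<bar>f x\<bar> powr p) * indicator (\<Inter>j. S j) x \<partial>lborel"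
    \<comment> \<open>On the set that stays alive, the integral for the limit is at most that for any partial sum plus the tail.\<close>
    have bound: "?I \<le> ennreal (U / q * (r\<^sup>2) ^ N + (G1 * \<theta> ^ N) powr p)" for N
    proof -
      have "?I \<le> (\<integral>\<^sup>+x. ennreal (\<bar>fn N x\<bar> powr p) * indicator (S N) x + ennreal ((G1 * \<theta> ^ N) powr p) * indicator {0..<1} x \<partial>lborel)"
      proof (rule nn_integral_mono)
        fix x
        show "ennreal (\<bar>f x\<bar> powr p) * indicator (\<Inter>j. S j) x \<le> ennreal (\<bar>fn N x\<bar> powr p) * indicator (S N) x + ennreal ((G1 * \<theta> ^ N) powr p) * indicator {0..<1} x"
        proof (cases "x \<in> (\<Inter>j. S j)")
          case True
          then have x: "x \<in> S N" "x \<in> {0..<1}" using S_unit[of N] by blast+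
          have "\<bar>f x\<bar> powr p \<le> \<bar>fn N x\<bar> powr p + \<bar>f x - fn N x\<bar> powr p"
            using abs_add_powr_le[OF p(1) p1, of "fn N x" "f x - fn N x"] by simp
          also have "\<bar>f x - fn N x\<bar> powr p \<le> (G1 * \<theta> ^ N) powr p" using p tail by (intro powr_mono2) auto
          finally have "\<bar>f x\<bar> powr p \<le> \<bar>fn N x\<bar> powr p + (G1 * \<theta> ^ N) powr p" by simp
          from ennreal_leI[OF this] have "ennreal (\<bar>f x\<bar> powr p) \<le> ennreal (\<bar>fn N x\<bar> powr p) + ennreal ((G1 * \<theta> ^ N) powr p)"
            by simp
          then show ?thesis using True x by simp
        qed simp
      qed
      also have "\<dots> = (\<integral>\<^sup>+x. ennreal (\<bar>fn N x\<bar> powr p) * indicator (S N) x \<partial>lborel) + ennreal ((G1 * \<theta> ^ N) powr p)"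
        by (subst nn_integral_add) (auto simp: nn_integral_cmult_indicator)
      also have "\<dots> \<le> ennreal (U / q * (r\<^sup>2) ^ N) + ennreal ((G1 * \<theta> ^ N) powr p)"
        using small[of N] unfolding fn_eq S_def by (intro add_right_mono)
      also have "\<dots> = ennreal (U / q * (r\<^sup>2) ^ N + (G1 * \<theta> ^ N) powr p)"
        using U q by (intro ennreal_plus[symmetric]) auto
      finally show ?thesis .
    qed
    have "r\<^sup>2 < 1" using r by (simp add: power_less_one_iff abs_square_less_1)
    then have "(\<lambda>N. U / q * (r\<^sup>2) ^ N + (G1 * \<theta> ^ N) powr p) \<longlonglongrightarrow> U / q * 0 + (G1 * 0) powr p"
      using \<theta> p G1 r
      by (intro tendsto_add tendsto_mult tendsto_const LIMSEQ_power_zero tendsto_powr') (auto intro!: always_eventually)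
    then have "(\<lambda>N. ennreal (U / q * (r\<^sup>2) ^ N + (G1 * \<theta> ^ N) powr p)) \<longlonglongrightarrow> ennreal 0" using p by (intro tendsto_ennrealI) simp
    then have "?I \<le> ennreal 0" by (rule LIMSEQ_le_const) (use bound in auto)
    then have "?I = 0" by simp
    then have "AE x in lborel. ennreal (\<bar>f x\<bar> powr p) * indicator (\<Inter>j. S j) x = 0"
      by (subst (asm) nn_integral_0_iff_AE) auto
    then show ?thesis by eventually_elim (auto simp: indicator_def split: if_splits)
  qed
  define V where "V = {x. x \<in> (\<Inter>j. S j) \<and> x \<notin> (\<Union>j. T j) \<and> f x = 0}"
  have Vm [measurable]: "V \<in> sets borel"
  proof -
    have "V = (\<Inter>j. S j) \<inter> - (\<Union>j. T j) \<inter> {x. f x = 0}" by (auto simp: V_def)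
    also have "\<dots> \<in> sets borel"
      by (intro sets.Int sets.countable_INT sets.compl_sets[of _ borel, simplified] sets.countable_UN) auto
    finally show ?thesis .
  qed
  have V_pos: "emeasure lborel V > 0"
  proof (rule ccontr)
    assume "\<not> emeasure lborel V > 0"
    then have V0: "emeasure lborel V = 0" by simp
    define N1 where "N1 = (\<Union>j. S j - S (Suc j))"
    define N2 where "N2 = (\<Union>j. T j)"
    define N3 where "N3 = {x. x \<in> (\<Inter>j. S j) \<and> f x \<noteq> 0}"
    have Nm: "N1 \<in> sets borel" "N2 \<in> sets borel" unfolding N1_def N2_def by measurable
    have N3m: "N3 \<in> sets borel"
    proof -
      have "N3 = (\<Inter>j. S j) \<inter> {x. f x \<noteq> 0}" by (auto simp: N3_def)
      also have "\<dots> \<in> sets borel" by (intro sets.Int sets.countable_INT) auto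
      finally show ?thesis .
    qed
    \<comment> \<open>A point of the unit interval outside \<open>V\<close> has been abandoned at some step, or is too close to a centre, or is in the null
      set where \<open>f\<close> does not vanish although the point stays alive.\<close>
    have cover: "{0..<1} \<subseteq> V \<union> (N1 \<union> (N2 \<union> N3))"
    proof
      fix x :: real assume x: "x \<in> {0..<1}"
      show "x \<in> V \<union> (N1 \<union> (N2 \<union> N3))"
      proof (cases "\<forall>j. x \<in> S j")
        case True
        then show ?thesis by (auto simp: V_def N2_def N3_def)
      next
        case False
        define j where "j = (LEAST j. x \<notin> S j)"
        have j: "x \<notin> S j" unfolding j_def by (rule LeastI_ex) (use False in simp)
        then have "j \<noteq> 0" using x S0 by metis
        then obtain i where i: "j = Suc i" using not0_implies_Suc by blast
        have "x \<in> S i" using not_less_Least[of i "\<lambda>j. x \<notin> S j"] i unfolding j_def[symmetric] by simp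
        then show ?thesis using j i by (auto simp: N1_def)
      qed
    qed
    have "ennreal 1 = emeasure lborel {0..<1::real}" by simp
    also have "\<dots> \<le> emeasure lborel (V \<union> (N1 \<union> (N2 \<union> N3)))"
      using Vm Nm N3m cover by (intro emeasure_mono) auto
    also have "\<dots> \<le> emeasure lborel V + (emeasure lborel N1 + (emeasure lborel N2 + emeasure lborel N3))"
      using Vm Nm N3m by (intro order_trans[OF emeasure_subadditive] add_left_mono) auto
    also have "emeasure lborel N3 = 0"
    proof -
      have "AE x in lborel. x \<notin> N3" using zero_AE by eventually_elim (auto simp: N3_def)
      then show ?thesis using N3m by (subst (asm) AE_iff_measurable[OF _ refl]) auto
    qed
    also have "emeasure lborel N1 \<le> ennreal (1/4)"
    proof -
      have "emeasure lborel N1 \<le> (\<Sum>j. emeasure lborel (S j - S (Suc j)))"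
        unfolding N1_def by (rule emeasure_subadditive_countably) auto
      also have "\<dots> \<le> (\<Sum>j. ennreal (U / (q * \<Lambda> powr p) * r ^ j))"
        using dead unfolding S_def by (intro suminf_le) auto
      also have "\<dots> = ennreal (U / (q * \<Lambda> powr p) * (1 / (1 - r)))"
        using U q r by (intro suminf_ennreal_eq sums_mult geometric_sums) auto
      also have "U / (q * \<Lambda> powr p) * (1 / (1 - r)) = 1/4" by (rule \<Lambda>(2))
      finally show ?thesis .
    qed
    also have "emeasure lborel N2 \<le> ennreal (1/4)"
    proof -
      have "emeasure lborel N2 \<le> (\<Sum>j. emeasure lborel (T j))"
        unfolding N2_def by (rule emeasure_subadditive_countably) auto
      also have "\<dots> \<le> (\<Sum>j. ennreal (2 * real n * \<sigma>0 * \<rho> ^ j))"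
        using T_meas by (intro suminf_le) auto
      also have "\<dots> = ennreal (2 * real n * \<sigma>0 * (1 / (1 - \<rho>)))"
        using \<sigma>0 \<rho> by (intro suminf_ennreal_eq sums_mult geometric_sums) auto
      also have "\<dots> \<le> ennreal (1/4)" using \<sigma>0(3) by (intro ennreal_leI) (simp only: times_divide_eq_right mult_1_right)
      finally show ?thesis .
    qed
    finally have "ennreal 1 \<le> ennreal (1/4) + ennreal (1/4)" using V0 by (simp add: add_mono)
    also have "\<dots> = ennreal (1/2)" by (subst ennreal_plus[symmetric]) auto
    finally have "1 \<le> (1 / 2 :: real)" by (subst (asm) ennreal_le_iff) simp_all
    then show False by simp
  qed
  have potential: "(\<integral>x. f x * \<bar>t - x\<bar> powr - (1 - \<alpha>) \<partial>lborel) = 0" if t: "t \<in> V" for t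
  proof -
    have t01: "t \<in> {0..<1}" using t S_unit[of 0] unfolding V_def by blast
    have tT: "t \<notin> T j" for j using t by (auto simp: V_def)
    have "has_bochner_integral lborel (\<lambda>x. f0 x * \<bar>t - x\<bar> powr - (1 - \<alpha>)) 0"
      using scaled_atom_potential[of 1 1 t "-3"] t01 unfolding f0_def by simp
    then have "has_bochner_integral lborel (\<lambda>x. corrected f0 \<psi> D a N x * \<bar>t - x\<bar> powr - (1 - \<alpha>)) 0" for N
      unfolding \<psi>_def
    proof (rule corrected_potential[OF \<sigma>(1) Dpos(1)])
      fix j k i assume "k < D ^ j" "i < n"
      then show "\<sigma> j \<le> \<bar>real (D ^ j) * t - real k - b i\<bar>" using tT[of j] unfolding T_def by (auto simp: not_less)
    qed
    then have zero: "(\<integral>x. fn N x * \<bar>t - x\<bar> powr - (1 - \<alpha>) \<partial>lborel) = 0" for N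
      unfolding fn_eq by (simp add: has_bochner_integral_iff)
    have "(\<lambda>N. \<integral>x. fn N x * \<bar>t - x\<bar> powr - (1 - \<alpha>) \<partial>lborel) \<longlonglongrightarrow> (\<integral>x. f x * \<bar>t - x\<bar> powr - (1 - \<alpha>) \<partial>lborel)"
    proof (rule integral_dominated_convergence[where w = "\<lambda>x. (\<bar>B\<bar> * (1 + \<bar>x\<bar>) powr - (1 + \<alpha>)) * \<bar>t - x\<bar> powr - (1 - \<alpha>)"])
      show "integrable lborel (\<lambda>x. (\<bar>B\<bar> * (1 + \<bar>x\<bar>) powr - (1 + \<alpha>)) * \<bar>t - x\<bar> powr - (1 - \<alpha>))"
        by (rule integrable_riesz[where C = "\<bar>B\<bar>"]) auto
      show "AE x in lborel. (\<lambda>N. fn N x * \<bar>t - x\<bar> powr - (1 - \<alpha>)) \<longlonglongrightarrow> f x * \<bar>t - x\<bar> powr - (1 - \<alpha>)"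
        by (intro AE_I2 tendsto_mult lim tendsto_const)
      show "AE x in lborel. norm (fn N x * \<bar>t - x\<bar> powr - (1 - \<alpha>)) \<le> (\<bar>B\<bar> * (1 + \<bar>x\<bar>) powr - (1 + \<alpha>)) * \<bar>t - x\<bar> powr - (1 - \<alpha>)" for N
      proof (rule AE_I2)
        fix x
        have "B * (1 + \<bar>x\<bar>) powr - (1 + \<alpha>) \<le> \<bar>B\<bar> * (1 + \<bar>x\<bar>) powr - (1 + \<alpha>)" by (intro mult_right_mono) auto
        then have "\<bar>fn N x\<bar> \<le> \<bar>B\<bar> * (1 + \<bar>x\<bar>) powr - (1 + \<alpha>)" using fn_decay[of N x] by linarith
        then show "norm (fn N x * \<bar>t - x\<bar> powr - (1 - \<alpha>)) \<le> (\<bar>B\<bar> * (1 + \<bar>x\<bar>) powr - (1 + \<alpha>)) * \<bar>t - x\<bar> powr - (1 - \<alpha>)"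
          unfolding real_norm_def abs_mult by (intro mult_mono) auto
      qed
    qed auto
    then show ?thesis unfolding zero using LIMSEQ_unique tendsto_const by blast
  qed
  have V_zero: "f t = 0" if "t \<in> V" for t using that by (simp add: V_def)
  show ?thesis
  proof (rule exI[of _ f], rule exI[of _ V], rule exI[of _ B], rule exI[of _ s],
      rule exI[of _ "(2 * atom_const) powr (1 - \<tau>) * atom_const powr \<tau> + J"], intro conjI allI ballI)
    show "\<exists>x. f x \<noteq> 0" by (rule nonzero)
  qed (fact fm f_decay Vm V_pos s f_holder | erule V_zero | erule potential)+
qed

end

section \<open>The theorem\<close>

text \<open>What remains is to pass from real functions and Borel measure to complex functions and Lebesgue measure.\<close>

theorem theorem1:
  fixes \<alpha> :: real
  assumes "0 < \<alpha>" and "\<alpha> < 1"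
  shows "\<exists>(f :: real \<Rightarrow> complex) (V :: real set) (r :: real).
    f \<in> dom_U \<alpha> \<and> f \<noteq> (\<lambda>x. 0) \<and>
    V \<in> sets lebesgue \<and> emeasure lebesgue V > 0 \<and>
    r > 0 \<and>
    (\<forall>t\<in>V. f t = 0) \<and>
    (\<forall>t\<in>V. riesz_potential_defined \<alpha> f t \<and> riesz_potential \<alpha> f t = 0) \<and>
    holder_condition r f"
proof -
  interpret riesz_order \<alpha> using assms by unfold_locales
  obtain f V C r H where fm [measurable]: "f \<in> borel_measurable borel"
    and decay: "\<forall>x. \<bar>f x\<bar> \<le> C * (1 + \<bar>x\<bar>) powr - (1 + \<alpha>)" and nonzero: "\<not> (\<forall>x. f x = 0)"
    and V: "V \<in> sets borel" "emeasure lborel V > 0"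
    and zero: "\<forall>t\<in>V. f t = 0 \<and> (\<integral>x. f x * \<bar>t - x\<bar> powr - (1 - \<alpha>) \<partial>lborel) = 0"
    and r: "0 < r" and holder: "\<forall>x y. \<bar>f x - f y\<bar> \<le> H * \<bar>x - y\<bar> powr r"
    using exists_real_counterexample by (elim exE conjE) (rule that; (assumption | blast))
  define F where "F x = complex_of_real (f x)" for x
  have Fm [measurable]: "F \<in> borel_measurable borel" unfolding F_def by measurable
  have f_int: "integrable lborel f"
    by (rule Bochner_Integration.integrable_bound[OF integrable_mult_right[OF integrable_weight[of "1 + \<alpha>"], of C]])
       (use \<alpha>_pos decay in \<open>auto intro!: AE_I2 order_trans[OF _ abs_ge_self]\<close>)
  then have F_int: "integrable lebesgue F"
    unfolding F_def[abs_def] by (intro integrable_completion[THEN iffD2]) auto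
  have dom: "F \<in> dom_U \<alpha>"
    unfolding dom_U_def mem_Collect_eq
  proof (intro conjI allI impI)
    fix K :: "real set" assume "compact K"
    then have "K \<in> sets lebesgue" by (intro lmeasurable_compact fmeasurableD)
    moreover have "set_integrable lebesgue UNIV F" using F_int by (simp add: set_integrable_def)
    ultimately show "F absolutely_integrable_on K" by (intro set_integrable_subset[of lebesgue UNIV F K]) auto
  next
    have "integrable lborel (\<lambda>x. norm (F x) / (1 + \<bar>x\<bar> powr (1 - \<alpha>)))"
    proof (rule Bochner_Integration.integrable_bound[OF f_int])
      show "AE x in lborel. norm (norm (F x) / (1 + \<bar>x\<bar> powr (1 - \<alpha>))) \<le> norm (f x)"
      proof (rule AE_I2)
        fix x :: real
        have "\<bar>f x\<bar> / (1 + \<bar>x\<bar> powr (1 - \<alpha>)) \<le> \<bar>f x\<bar> / 1" by (intro divide_left_mono) (auto simp: add_pos_nonneg)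
        then show "norm (norm (F x) / (1 + \<bar>x\<bar> powr (1 - \<alpha>))) \<le> norm (f x)" by (simp add: F_def)
      qed
    qed simp
    then show "integrable lebesgue (\<lambda>x. norm (F x) / (1 + \<bar>x\<bar> powr (1 - \<alpha>)))"
      by (intro integrable_completion[THEN iffD2]) auto
  qed
  have kernel: "riesz_integrand \<alpha> F t = (\<lambda>x. complex_of_real (f x * \<bar>t - x\<bar> powr - (1 - \<alpha>)))" for t
  proof
    fix x
    have "\<bar>t - x\<bar> powr - (1 - \<alpha>) = inverse (\<bar>t - x\<bar> powr (1 - \<alpha>))" by (rule powr_minus)
    then show "riesz_integrand \<alpha> F t x = complex_of_real (f x * \<bar>t - x\<bar> powr - (1 - \<alpha>))"
      by (simp only: riesz_integrand_def F_def divide_inverse of_real_mult of_real_inverse)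
  qed
  have riesz_int: "integrable lborel (\<lambda>x. f x * \<bar>t - x\<bar> powr - (1 - \<alpha>))" for t
    by (rule integrable_riesz[where C = C]) (use decay in auto)
  have potential: "riesz_potential_defined \<alpha> F t \<and> riesz_potential \<alpha> F t = 0" if t: "t \<in> V" for t
  proof
    show "riesz_potential_defined \<alpha> F t"
      unfolding riesz_potential_defined_def kernel using riesz_int[of t]
      by (intro integrable_completion[THEN iffD2] integrable_of_real) measurable
    have "riesz_potential \<alpha> F t = (\<integral>x. complex_of_real (f x * \<bar>t - x\<bar> powr - (1 - \<alpha>)) \<partial>lborel)"
      unfolding riesz_potential_def kernel by (intro integral_completion) measurable
    also have "\<dots> = complex_of_real (\<integral>x. f x * \<bar>t - x\<bar> powr - (1 - \<alpha>) \<partial>lborel)" by (rule integral_complex_of_real)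
    also have "\<dots> = 0" using zero t by simp
    finally show "riesz_potential \<alpha> F t = 0" .
  qed
  have "norm (F x - F y) \<le> H * \<bar>x - y\<bar> powr r" for x y
    using holder unfolding F_def of_real_diff[symmetric] norm_of_real by blast
  then have "holder_condition r F" unfolding holder_condition_def by blast
  moreover have "F \<noteq> (\<lambda>x. 0)" using nonzero by (auto simp: F_def fun_eq_iff)
  moreover have "V \<in> sets lebesgue" "emeasure lebesgue V > 0" using V by auto
  moreover have "\<forall>t\<in>V. F t = 0" using zero by (simp add: F_def)
  ultimately show ?thesis using dom r potential by blast
qed

end
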